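(* Let $\phi=\phi(x,t)$, $x\in\mathbb{R}^3$, be a smooth real-valued function transported by a smooth velocity field $u(x,t)\in\mathbb{R}^3$, i.e. $\phi_t+u\cdot\nabla\phi=0$. Assume that for each $t$ the zero level set $\{\phi=0\}=\{x\in\mathbb{R}^3:\phi(x,t)=0\}$ is a smooth closed surface $\partial\Omega$ (the boundary of a regular open connected set $\Omega\subset\mathbb{R}^3$) and that $|\nabla\phi|>0$ in a neighbourhood of $\{\phi=0\}$. Let $n=\nabla\phi/|\nabla\phi|$, and let $H=H(\phi)=\operatorname{div}_{\partial\Omega}(n)=\operatorname{div}(n)$ and $G=\operatorname{Tr}(\operatorname{Cof}([\nabla n]))$ be the mean and Gaussian curvatures. Let $A:\mathbb{R}\to\mathbb{R}$ be a smooth function and set $$J^H(\phi)=\int_{\{\phi=0\}}A(H(\phi))\,d\sigma .$$ Then the derivative of $J^H(\phi)$ with respect to $t$ is $$(J^H(\phi))_t=\int_{\{\phi=0\}}\Big(A(H)H-\Delta_{\partial\Omega}\big(A'(H)\big)-A'(H)(H^2-2G)\Big)\,u\cdot n\;d\sigma .$$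
   Context: $\nabla$ and $\operatorname{div}$ are taken with respect to the space variable $x$, and a subscript $t$ denotes the derivative in $t$; $d\sigma$ is surface measure. For a vector field $v$, $[\nabla v]_{ij}=\partial_j v_i$. For a $3\times3$ matrix $M$, $\operatorname{Tr}(\operatorname{Cof}(M))=\frac12(\operatorname{Tr}(M)^2-\operatorname{Tr}(M^2))$. On the surface $H=\kappa_1+\kappa_2$ (no factor $1/2$) and $G=\kappa_1\kappa_2$, where $\kappa_1,\kappa_2$ are the principal curvatures, i.e. the eigenvalues of $dn$ on the tangent plane. Tangential operators: $\nabla_{\partial\Omega}g=\nabla g-(\nabla g\cdot n)n$ for a function $g$, $\operatorname{div}_{\partial\Omega}(v)=\operatorname{div}(v)-([\nabla v]n)\cdot n$ for a vector field $v$, and $\Delta_{\partial\Omega}g=\operatorname{div}_{\partial\Omega}(\nabla_{\partial\Omega}g)$ (Laplace–Beltrami operator).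
   Formalization: The level sets are assumed not only to be closed (compact) surfaces for each t but also to stay in a bounded region locally in time; otherwise a component may arrive from infinity and the integral can jump, so the claim fails. *)

theory Defs
  imports "HOL-Analysis.Analysis"
begin

section \<open>Smooth functions and differential operators\<close>

(* Only meant for open S: all derivatives are taken with respect to the full neighbourhood filter. *)
primrec Ck_on :: "nat \<Rightarrow> 'a::euclidean_space set \<Rightarrow> ('a \<Rightarrow> 'b::real_normed_vector) \<Rightarrow> bool" where
  "Ck_on 0 S = (\<lambda>f. continuous_on S f)"
| "Ck_on (Suc k) S = (\<lambda>f. (\<forall>x\<in>S. f differentiable (at x)) \<and>
     (\<forall>v. Ck_on k S (\<lambda>x. frechet_derivative f (at x) v)))"

definition smooth_on :: "'a::euclidean_space set \<Rightarrow> ('a \<Rightarrow> 'b::real_normed_vector) \<Rightarrow> bool" where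
  "smooth_on S f \<longleftrightarrow> (\<forall>k. Ck_on k S f)"

definition grad :: "(real^'n \<Rightarrow> real) \<Rightarrow> real^'n \<Rightarrow> real^'n" where
  "grad g x = (\<chi> i. frechet_derivative g (at x) (axis i 1))"

(* The library's jacobian satisfies jacobian v (at x) $ i $ j = d v_i / d x_j. *)
definition divergence :: "(real^'n \<Rightarrow> real^'n) \<Rightarrow> real^'n \<Rightarrow> real" where
  "divergence v x = trace (jacobian v (at x))"

definition cofactor_matrix :: "real^'n^'n \<Rightarrow> real^'n^'n" where
  "cofactor_matrix M = (\<chi> i j. det (\<chi> k l. if k = i then (if l = j then 1 else 0) else M $ k $ l))"

lemma trace_cofactor_matrix_3:
  fixes M :: "real^3^3"
  shows "trace (cofactor_matrix M) = ((trace M)\<^sup>2 - trace (M ** M)) / 2"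
  by (simp add: trace_def cofactor_matrix_def det_3 sum_3 matrix_matrix_mult_def
      power2_eq_square algebra_simps)

section \<open>Level set geometry\<close>

definition unit_normal :: "(real^3 \<Rightarrow> real) \<Rightarrow> real^3 \<Rightarrow> real^3" where
  "unit_normal \<phi> x = grad \<phi> x /\<^sub>R norm (grad \<phi> x)"

definition mean_curvature :: "(real^3 \<Rightarrow> real) \<Rightarrow> real^3 \<Rightarrow> real" where
  "mean_curvature \<phi> x = divergence (unit_normal \<phi>) x"

definition gaussian_curvature :: "(real^3 \<Rightarrow> real) \<Rightarrow> real^3 \<Rightarrow> real" where
  "gaussian_curvature \<phi> x = trace (cofactor_matrix (jacobian (unit_normal \<phi>) (at x)))"

(* In the tangential operators the normal is passed as a vector field n on the ambient space. *)
definition surf_grad :: "(real^3 \<Rightarrow> real^3) \<Rightarrow> (real^3 \<Rightarrow> real) \<Rightarrow> real^3 \<Rightarrow> real^3" where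
  "surf_grad n g x = grad g x - (grad g x \<bullet> n x) *\<^sub>R n x"

definition surf_div :: "(real^3 \<Rightarrow> real^3) \<Rightarrow> (real^3 \<Rightarrow> real^3) \<Rightarrow> real^3 \<Rightarrow> real" where
  "surf_div n v x = divergence v x - (jacobian v (at x) *v n x) \<bullet> n x"

definition laplace_beltrami :: "(real^3 \<Rightarrow> real^3) \<Rightarrow> (real^3 \<Rightarrow> real) \<Rightarrow> real^3 \<Rightarrow> real" where
  "laplace_beltrami n g = surf_div n (surf_grad n g)"

section \<open>Regular open sets and surface measure\<close>

definition regular_open_set :: "(real^3) set \<Rightarrow> bool" where
  "regular_open_set \<Omega> \<longleftrightarrow> open \<Omega> \<and>
     (\<forall>p\<in>frontier \<Omega>. \<exists>V \<psi>. open V \<and> p \<in> V \<and> smooth_on V \<psi> \<and>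
        (\<forall>x\<in>V. grad \<psi> x \<noteq> 0) \<and> \<Omega> \<inter> V = {x\<in>V. \<psi> x < 0})"

definition area_element :: "(real^2 \<Rightarrow> real^3) \<Rightarrow> real^2 \<Rightarrow> real" where
  "area_element r y =
     norm (cross3 (frechet_derivative r (at y) (axis 1 1)) (frechet_derivative r (at y) (axis 2 1)))"

definition local_parametrization ::
    "(real^3) set \<Rightarrow> (real^2) set \<Rightarrow> (real^2 \<Rightarrow> real^3) \<Rightarrow> bool" where
  "local_parametrization S U r \<longleftrightarrow>
     open U \<and> smooth_on U r \<and> (\<forall>y\<in>U. area_element r y \<noteq> 0) \<and>
     (\<exists>q. homeomorphism U (r ` U) r q) \<and> openin (top_of_set S) (r ` U)"

definition is_surface_measure :: "(real^3) set \<Rightarrow> (real^3) measure \<Rightarrow> bool" where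
  "is_surface_measure S M \<longleftrightarrow>
     sets M = sets borel \<and> emeasure M (- S) = 0 \<and>
     (\<forall>U r B. local_parametrization S U r \<and> B \<in> sets borel \<and> B \<subseteq> r ` U \<longrightarrow>
        emeasure M B = (\<integral>\<^sup>+ y \<in> {y\<in>U. r y \<in> B}. ennreal (area_element r y) \<partial>lborel))"

(* For a closed smooth surface S there is exactly one such measure: the area formula fixes it on
   the charts, which cover S, and different charts agree by the change of variables theorem. *)
definition surface_measure :: "(real^3) set \<Rightarrow> (real^3) measure" where
  "surface_measure S = (THE M. is_surface_measure S M)"

(* Integrals over the level set are set integrals: away from it the integrand may be junk
   (the normal is not differentiable at critical points), so it need not be Borel globally. *)
definition curvature_energy :: "(real \<Rightarrow> real) \<Rightarrow> (real^3 \<Rightarrow> real) \<Rightarrow> real" where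
  "curvature_energy A \<phi> =
     (LINT x:{x. \<phi> x = 0}|surface_measure {x. \<phi> x = 0}. A (mean_curvature \<phi> x))"

section \<open>Moving closed surfaces\<close>

(* The family is locally uniformly compact in time, not just compact for each t. Compactness for
   each t separately would allow components to arrive from (or escape to) infinity, and the
   energy would then be discontinuous. Example: let s be smooth with s(t) = 0 for t <= 0 and
   s(t) > 0 small for t > 0, and let phi = F((|x|^2 - 1) (1 - s(t) |x|^2)) with F(z) = z near 0,
   F strictly increasing on [-1/2, 1/2] and F constant on each side of that interval; then phi is transported by a smooth u, but the level set jumps
   from the unit sphere to the boundary of the shell 1 < |x| < s(t) powr (-1/2). *)
definition moving_closed_surface :: "real set \<Rightarrow> (real \<Rightarrow> (real^3) set) \<Rightarrow> bool" where
  "moving_closed_surface T \<Gamma> \<longleftrightarrow>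
     (\<forall>t\<in>T. compact (\<Gamma> t)) \<and>
     (\<forall>t\<in>T. \<exists>\<epsilon>>0. bounded (\<Union>s \<in> {s\<in>T. \<bar>s - t\<bar> < \<epsilon>}. \<Gamma> s))"

end

theory Submission
  imports Defs
begin

text \<open>Only the normal speed \<open>V = u \<bullet> n = - \<phi>\<^sub>t / \<bar>\<nabla>\<phi>\<bar>\<close> enters. Near a point of the level set the
  surfaces are graphs \<open>z = h(y, s)\<close> over a fixed planar domain, where surface integrals become
  integrals of \<open>f \<bar>\<nabla>\<phi>\<bar> / \<bar>\<phi>\<^sub>z\<bar>\<close> over \<open>y\<close>. Write \<open>\<rho> = \<bar>\<nabla>\<phi>\<bar>\<close>. For compactly supported data two facts follow
  from the chain rule and from integrating derivatives over the plane: \<open>\<integral> div X / \<rho> d\<sigma> = 0\<close> for every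
  \<open>X\<close> tangent to the level sets, and the time derivative of \<open>\<integral> f d\<sigma>\<close> is
  \<open>\<integral> ((\<rho> f)\<^sub>t + div (\<rho> f V n)) / \<rho> d\<sigma>\<close>. A partition of unity makes both global. For \<open>f = A(H)\<close> and
  \<open>a = A'(H)\<close> the integrand differs from the asserted one by \<open>div X / \<rho>\<close> with the tangential field
  \<open>X = \<rho> (V \<nabla>\<^sub>S a - a \<nabla>\<^sub>S V)\<close>, where \<open>\<nabla>\<^sub>S\<close> is the tangential gradient; this uses
  \<open>n\<^sub>t = - \<nabla>\<^sub>S V - V (\<nabla>n) n\<close> and \<open>div ((\<nabla>n) n) = Tr ((\<nabla>n)\<^sup>2) + \<partial>\<^sub>n H\<close>.\<close>

section \<open>Calculus of finitely differentiable functions\<close>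

text \<open>The weight \<open>1 / \<rho>\<close> comes from the coarea formula:
  \<open>d\<sigma> / \<rho>\<close> is the measure that Lebesgue measure induces on a level set, and
  a field tangent to all level sets moves each of them within itself. Formally \<open>\<integral> f
  d\<sigma> = \<integral> \<rho> f \<delta>(\<Phi>) dx\<close>, and the time derivative of the delta
  factor is what \<open>div (\<rho> f V n)\<close> accounts for. Working in space-time keeps every
  geometric identity a relation between partial derivatives of one function \<open>\<Phi>\<close>.
  Two obstacles shape the proof. \<open>surface_measure\<close> is a definite description, so
  existence and uniqueness must be settled before any integral can be evaluated. And the charts must
  serve a whole time interval, for which the surfaces have to be bounded uniformly in nearby times.
  Orders of differentiability are counted because the cutoffs are only C^1. This is enough: both
  integral facts differentiate their data once, while the geometric quantities built from
  \<open>\<Phi>\<close> have every order.\<close>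

abbreviation pd :: "'a::euclidean_space \<Rightarrow> ('a \<Rightarrow> 'b::real_normed_vector) \<Rightarrow> 'a \<Rightarrow> 'b" where
  "pd v f x \<equiv> frechet_derivative f (at x) v"

text \<open>\<open>frechet_derivative\<close> is a choice among all derivatives; locally equal
  functions have the same candidates, so the choices coincide, also where there is no
  candidate.\<close>

lemma frechet_derivative_cong_open:
  assumes "open S" "x \<in> S" "\<And>y. y \<in> S \<Longrightarrow> f y = g y"
  shows "frechet_derivative f (at x) = frechet_derivative g (at x)"
proof -
  have "(f has_derivative D) (at x) \<longleftrightarrow> (g has_derivative D) (at x)" for D
    using has_derivative_transform_within_open[of f D x UNIV S g]
      has_derivative_transform_within_open[of g D x UNIV S f] assms by auto
  then show ?thesis by (simp add: frechet_derivative_def)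
qed

lemma frechet_eqI: "(f has_derivative D) (at x) \<Longrightarrow> pd v f x = D v"
  using frechet_derivative_at[of f D x] by simp

lemma differentiable_cong_open:
  assumes "open S" "x \<in> S" "\<And>y. y \<in> S \<Longrightarrow> f y = g y" "f differentiable (at x)"
  shows "g differentiable (at x)"
  using assms has_derivative_transform_within_open[of f _ x UNIV S g]
  unfolding differentiable_def by blast

lemma Ck_on_cong:
  assumes "open S" "\<And>x. x \<in> S \<Longrightarrow> f x = g x" "Ck_on k S f"
  shows "Ck_on k S g"
  using assms(2,3)
proof (induction k arbitrary: f g)
  case 0
  then show ?case using continuous_on_cong[of S S f g] by simp
next
  case (Suc k)
  have "g differentiable (at x)" if "x \<in> S" for x
    using differentiable_cong_open[OF assms(1) that Suc.prems(1)] Suc.prems(2) that by simp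
  moreover have "Ck_on k S (pd v g)" for v
  proof (rule Suc.IH)
    show "pd v f x = pd v g x" if "x \<in> S" for x
      using frechet_derivative_cong_open[OF assms(1) that Suc.prems(1)] by simp
    show "Ck_on k S (pd v f)" using Suc.prems(2) by simp
  qed
  ultimately show ?case by simp
qed

lemma Ck_on_subset: "Ck_on k S f \<Longrightarrow> S' \<subseteq> S \<Longrightarrow> Ck_on k S' f"
  by (induction k arbitrary: f) (auto intro: continuous_on_subset)

lemma Ck_on_Suc_D: "Ck_on (Suc k) S f \<Longrightarrow> Ck_on k S f"
proof (induction k arbitrary: f)
  case 0
  then show ?case
    by (simp add: continuous_at_imp_continuous_on differentiable_imp_continuous_within)
next
  case (Suc k)
  then show ?case by (metis Ck_on.simps(2))
qed

lemma Ck_on_continuous: "Ck_on k S f \<Longrightarrow> continuous_on S f"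
  by (induction k) (use Ck_on_Suc_D in auto)

lemma Ck_on_differentiable: "Ck_on (Suc k) S f \<Longrightarrow> x \<in> S \<Longrightarrow> f differentiable (at x)"
  by simp

lemma Ck_on_pd: "Ck_on (Suc k) S f \<Longrightarrow> Ck_on k S (pd v f)"
  by simp

lemma Ck_on_has_derivative:
  "Ck_on (Suc k) S f \<Longrightarrow> x \<in> S \<Longrightarrow> (f has_derivative (\<lambda>v. pd v f x)) (at x)"
  using Ck_on_differentiable frechet_derivative_works by fastforce

text \<open>The rule behind the inductions on the order that follow: any explicit derivative formula
  will do, provided that its value in each fixed direction is of class \<open>k\<close>.\<close>

lemma Ck_on_SucI:
  assumes "open S" "\<And>x. x \<in> S \<Longrightarrow> (f has_derivative D x) (at x)"
    and "\<And>v. Ck_on k S (\<lambda>x. D x v)"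
  shows "Ck_on (Suc k) S f"
proof -
  have "Ck_on k S (pd v f)" for v
    by (rule Ck_on_cong[OF assms(1) _ assms(3)[of v]]) (use assms(2) frechet_eqI in metis)
  then show ?thesis using assms(2) by (auto simp: differentiable_def)
qed

lemma Ck_on_const: "open S \<Longrightarrow> Ck_on k S (\<lambda>x. c)"
  by (induction k arbitrary: c) simp_all

lemma Ck_on_linear: "open S \<Longrightarrow> bounded_linear B \<Longrightarrow> Ck_on k S B"
proof (cases k)
  case 0
  then show "bounded_linear B \<Longrightarrow> ?thesis"
    by (simp add: linear_continuous_on)
next
  case (Suc k')
  assume "open S" "bounded_linear B"
  then show ?thesis unfolding Suc
    by (intro Ck_on_SucI[where D="\<lambda>x. B"]) (auto intro: bounded_linear_imp_has_derivative Ck_on_const)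
qed

lemma Ck_on_bounded_linear:
  assumes "open S" "bounded_linear B" "Ck_on k S f"
  shows "Ck_on k S (\<lambda>x. B (f x))"
  using assms(3)
proof (induction k arbitrary: f)
  case 0
  then show ?case using bounded_linear.continuous_on[OF assms(2)] by simp
next
  case (Suc k)
  show ?case
    by (rule Ck_on_SucI[OF assms(1) bounded_linear.has_derivative[OF assms(2) Ck_on_has_derivative[OF Suc.prems]]])
      (assumption, rule Suc.IH[OF Ck_on_pd[OF Suc.prems]])
qed

lemma Ck_on_add:
  assumes "open S" "Ck_on k S f" "Ck_on k S g"
  shows "Ck_on k S (\<lambda>x. f x + g x)"
  using assms(2,3)
proof (induction k arbitrary: f g)
  case 0
  then show ?case by (simp add: continuous_on_add)
next
  case (Suc k)
  show ?case
    by (rule Ck_on_SucI[OF assms(1) has_derivative_add[OF Ck_on_has_derivative[OF Suc.prems(1)] 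
       Ck_on_has_derivative[OF Suc.prems(2)]]])
      (assumption, assumption, rule Suc.IH[OF Ck_on_pd[OF Suc.prems(1)] Ck_on_pd[OF Suc.prems(2)]])
qed

lemma Ck_on_minus: "open S \<Longrightarrow> Ck_on k S f \<Longrightarrow> Ck_on k S (\<lambda>x. - f x)"
  by (rule Ck_on_bounded_linear[of S uminus]) (auto simp: bounded_linear_minus bounded_linear_ident)

lemma Ck_on_diff:
  "open S \<Longrightarrow> Ck_on k S f \<Longrightarrow> Ck_on k S g \<Longrightarrow> Ck_on k S (\<lambda>x. f x - g x)"
  using Ck_on_add[of S k f "\<lambda>x. - g x"] Ck_on_minus[of S k g] by simp

lemma Ck_on_sum:
  assumes "open S" "\<And>i. i \<in> I \<Longrightarrow> Ck_on k S (f i)"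
  shows "Ck_on k S (\<lambda>x. \<Sum>i\<in>I. f i x)"
  using assms(2)
  by (induction I rule: infinite_finite_induct) (simp_all add: Ck_on_add Ck_on_const assms(1) del: Ck_on.simps)

lemma Ck_on_mult:
  fixes f g :: "_ \<Rightarrow> real"
  assumes "open S" "Ck_on k S f" "Ck_on k S g"
  shows "Ck_on k S (\<lambda>x. f x * g x)"
  using assms(2,3)
proof (induction k arbitrary: f g)
  case 0
  then show ?case by (simp add: continuous_on_mult)
next
  case (Suc k)
  note C = Ck_on_Suc_D[OF Suc.prems(1)] Ck_on_Suc_D[OF Suc.prems(2)]
    Ck_on_pd[OF Suc.prems(1)] Ck_on_pd[OF Suc.prems(2)]
  show ?case
    by (rule Ck_on_SucI[OF assms(1) has_derivative_mult[OF Ck_on_has_derivative[OF Suc.prems(1)] 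
       Ck_on_has_derivative[OF Suc.prems(2)]]])
      (assumption, assumption, rule Ck_on_add[OF assms(1) Suc.IH[OF C(1) C(4)] Suc.IH[OF C(3) C(2)]])
qed

lemma Ck_on_inner_const:
  "open S \<Longrightarrow> Ck_on k S f \<Longrightarrow> Ck_on k S (\<lambda>x. f x \<bullet> b)"
  by (rule Ck_on_bounded_linear[OF _ bounded_linear_inner_left])

lemma Ck_on_scaleR_const:
  "open S \<Longrightarrow> Ck_on k S f \<Longrightarrow> Ck_on k S (\<lambda>x. f x *\<^sub>R b)"
  by (rule Ck_on_bounded_linear[OF _ bounded_linear_scaleR_left])

text \<open>In the chain rule the direction \<open>pd v G x\<close> moves with \<open>x\<close>,
  while \<open>Ck_on\<close> speaks of fixed directions. Expanding it in the basis turns the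
  derivative into a sum of products with \<open>pd b F (G x)\<close>, to which the induction
  hypothesis applies.\<close>

lemma Ck_on_compose:
  fixes F :: "'b::euclidean_space \<Rightarrow> real" and G :: "'a::euclidean_space \<Rightarrow> 'b"
  assumes "open S" "open V" "Ck_on k V F" "Ck_on k S G" "\<And>x. x \<in> S \<Longrightarrow> G x \<in> V"
  shows "Ck_on k S (\<lambda>x. F (G x))"
  using assms(3,4)
proof (induction k arbitrary: F)
  case 0
  have "G ` S \<subseteq> V" using assms(5) by auto
  then show ?case using 0 continuous_on_compose2[of V F S G] by simp
next
  case (Suc k)
  have G: "Ck_on k S G" using Suc.prems(2) by (rule Ck_on_Suc_D)
  have D: "((\<lambda>x. F (G x)) has_derivative (\<lambda>v. \<Sum>b\<in>Basis. (pd v G x \<bullet> b) * pd b F (G x))) (at x)"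
    if x: "x \<in> S" for x
  proof -
    note F' = Ck_on_has_derivative[OF Suc.prems(1) assms(5)[OF x]]
    note G' = Ck_on_has_derivative[OF Suc.prems(2) x]
    have lin: "linear (frechet_derivative F (at (G x)))"
      using Suc.prems(1) assms(5)[OF x] by (auto intro: linear_frechet_derivative)
    have "pd w F (G x) = (\<Sum>b\<in>Basis. (w \<bullet> b) * pd b F (G x))" for w
    proof -
      have "pd w F (G x) = pd (\<Sum>b\<in>Basis. (w \<bullet> b) *\<^sub>R b) F (G x)"
        by (simp add: euclidean_representation)
      also have "\<dots> = (\<Sum>b\<in>Basis. (w \<bullet> b) * pd b F (G x))"
        by (simp add: linear_sum[OF lin] linear_scale[OF lin])
      finally show ?thesis .
    qed
    then have "(\<lambda>v. pd (pd v G x) F (G x)) = (\<lambda>v. \<Sum>b\<in>Basis. (pd v G x \<bullet> b) * pd b F (G x))"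
      by blast
    then show ?thesis
      using has_derivative_compose[OF G' F'] by metis
  qed
  have C: "Ck_on k S (\<lambda>x. pd b F (G x))" for b
    by (rule Suc.IH[OF Ck_on_pd[OF Suc.prems(1)] G])
  show ?case
    by (rule Ck_on_SucI[OF assms(1) D], assumption)
      (rule Ck_on_sum[OF assms(1) Ck_on_mult[OF assms(1)
          Ck_on_inner_const[OF assms(1) Ck_on_pd[OF Suc.prems(2)]] C]])
qed

lemma Ck_on_inverse_real: "Ck_on k (- {0}) (inverse :: real \<Rightarrow> real)"
proof (induction k)
  case 0
  then show ?case by (auto intro!: continuous_intros)
next
  case (Suc k)
  show ?case
    by (rule Ck_on_SucI[where D="\<lambda>x v. - (inverse x * v * inverse x)"])
      (auto intro!: derivative_eq_intros Ck_on_minus Ck_on_mult Ck_on_const Suc)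
qed

lemma Ck_on_sqrt: "Ck_on k {0<..} sqrt"
proof (induction k)
  case 0
  then show ?case by (auto intro!: continuous_intros)
next
  case (Suc k)
  have "Ck_on k {0<..} (\<lambda>x. inverse (sqrt x))"
    using Ck_on_compose[OF open_greaterThan open_Compl[OF closed_singleton] Ck_on_inverse_real Suc] by simp
  then have "Ck_on k {0<..} (\<lambda>x. inverse (sqrt x) * (1/2) * v)" for v
    by (intro Ck_on_mult Ck_on_const open_greaterThan)
  then show ?case
    by (intro Ck_on_SucI[where D="\<lambda>x v. inverse (sqrt x) * (1/2) * v"])
      (auto intro!: derivative_eq_intros simp: field_simps)
qed

lemma Ck_on_inverse:
  fixes f :: "_ \<Rightarrow> real"
  assumes "open S" "Ck_on k S f" "\<And>x. x \<in> S \<Longrightarrow> f x \<noteq> 0"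
  shows "Ck_on k S (\<lambda>x. inverse (f x))"
  using Ck_on_compose[OF assms(1) open_Compl[OF closed_singleton] Ck_on_inverse_real assms(2)] assms(3) by simp

lemma Ck_on_divide:
  fixes f g :: "_ \<Rightarrow> real"
  assumes "open S" "Ck_on k S f" "Ck_on k S g" "\<And>x. x \<in> S \<Longrightarrow> g x \<noteq> 0"
  shows "Ck_on k S (\<lambda>x. f x / g x)"
  using Ck_on_mult[OF assms(1,2) Ck_on_inverse[OF assms(1,3,4)]] by (simp add: divide_inverse)

lemma Ck_on_sqrt_compose:
  assumes "open S" "Ck_on k S f" "\<And>x. x \<in> S \<Longrightarrow> f x > 0"
  shows "Ck_on k S (\<lambda>x. sqrt (f x))"
  using Ck_on_compose[OF assms(1) open_greaterThan Ck_on_sqrt assms(2)] assms(3) by simp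

text \<open>Profile of the cutoffs in the partition of unity. It is C^1 and no better, since the
  derivative \<open>2 * max 0 q\<close> has a corner at 0.\<close>

lemma Ck_on_pos_part_square: "Ck_on (Suc 0) UNIV (\<lambda>q::real. (max 0 q)\<^sup>2)"
proof (rule Ck_on_SucI[where D="\<lambda>q v. 2 * max 0 q * v"])
  fix q :: real
  have "((\<lambda>q::real. (max 0 q)\<^sup>2) has_real_derivative 2 * max 0 q) (at q)"
  proof (cases "q = 0")
    case False
    show ?thesis
    proof (cases "q > 0")
      case True
      have "((\<lambda>q::real. q\<^sup>2) has_real_derivative 2 * max 0 q) (at q)"
        using True by (auto intro!: derivative_eq_intros)
      then show ?thesis
        by (rule has_field_derivative_transform_within_open[where S="{0<..}"]) (use True in auto)
    next
      case F: False
      have "((\<lambda>q::real. 0) has_real_derivative 2 * max 0 q) (at q)"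
        using F False by auto
      then show ?thesis
        by (rule has_field_derivative_transform_within_open[where S="{..<0}"]) (use F False in auto)
    qed
  next
    case True
    have "((\<lambda>h. ((max 0 h)\<^sup>2) / h) \<longlongrightarrow> 0) (at (0::real))"
    proof (rule Lim_null_comparison[where g="\<lambda>h. \<bar>h\<bar>"])
      show "\<forall>\<^sub>F h in at (0::real). norm ((max 0 h)\<^sup>2 / h) \<le> \<bar>h\<bar>"
        by (rule always_eventually) (simp add: max_def power2_eq_square)
      show "((\<lambda>h. \<bar>h\<bar>) \<longlongrightarrow> 0) (at (0::real))"
        by (rule tendsto_rabs_zero) (rule tendsto_ident_at)
    qed
    then show ?thesis using True by (simp add: DERIV_def)
  qed
  then show "((\<lambda>q::real. (max 0 q)\<^sup>2) has_derivative (\<lambda>v. 2 * max 0 q * v)) (at q)"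
    unfolding has_field_derivative_def .
next
  fix v
  show "Ck_on 0 UNIV (\<lambda>q::real. 2 * max 0 q * v)"
    unfolding Ck_on.simps by (intro continuous_intros)
qed (rule open_UNIV)

subsection \<open>Differentiation rules and symmetry of second derivatives\<close>

lemma pd_add:
  assumes "f differentiable (at x)" "g differentiable (at x)"
  shows "pd v (\<lambda>x. f x + g x) x = pd v f x + pd v g x"
  using frechet_eqI[OF has_derivative_add[OF assms[unfolded frechet_derivative_works]]] .

lemma pd_diff:
  assumes "f differentiable (at x)" "g differentiable (at x)"
  shows "pd v (\<lambda>x. f x - g x) x = pd v f x - pd v g x"
  using frechet_eqI[OF has_derivative_diff[OF assms[unfolded frechet_derivative_works]]] .

lemma pd_minus:
  assumes "f differentiable (at x)"
  shows "pd v (\<lambda>x. - f x) x = - pd v f x"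
  using frechet_eqI[OF has_derivative_minus[OF assms[unfolded frechet_derivative_works]]] .

lemma pd_sum:
  assumes "\<And>i. i \<in> I \<Longrightarrow> f i differentiable (at x)"
  shows "pd v (\<lambda>x. \<Sum>i\<in>I. f i x) x = (\<Sum>i\<in>I. pd v (f i) x)"
  using frechet_eqI[OF has_derivative_sum[OF assms[unfolded frechet_derivative_works]]] .

lemma pd_mult:
  fixes f g :: "_ \<Rightarrow> real"
  assumes "f differentiable (at x)" "g differentiable (at x)"
  shows "pd v (\<lambda>x. f x * g x) x = f x * pd v g x + pd v f x * g x"
  using frechet_eqI[OF has_derivative_mult[OF assms[unfolded frechet_derivative_works]]] by simp

lemma pd_compose_real:
  fixes f :: "_ \<Rightarrow> real" and F :: "real \<Rightarrow> real"
  assumes "f differentiable (at x)" "F differentiable (at (f x))"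
  shows "pd v (\<lambda>x. F (f x)) x = deriv F (f x) * pd v f x"
proof -
  have "(F has_real_derivative deriv F (f x)) (at (f x))"
    using assms(2) by (simp add: DERIV_deriv_iff_real_differentiable)
  then have "(F has_derivative (\<lambda>v. deriv F (f x) * v)) (at (f x))"
    by (simp add: has_field_derivative_def)
  from has_derivative_compose[OF assms(1)[unfolded frechet_derivative_works] this]
  show ?thesis by (simp add: frechet_eqI)
qed

lemma pd_cong_open:
  "open S \<Longrightarrow> x \<in> S \<Longrightarrow> (\<And>y. y \<in> S \<Longrightarrow> f y = g y) \<Longrightarrow> pd v f x = pd v g x"
  using frechet_derivative_cong_open by metis

lemma pd_scaleR_direction:
  assumes "f differentiable (at x)" shows "pd (c *\<^sub>R v) f x = c *\<^sub>R pd v f x"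
  using linear_scale[OF linear_frechet_derivative[OF assms]] by simp

lemma pd_add_direction:
  assumes "f differentiable (at x)" shows "pd (v + w) f x = pd v f x + pd w f x"
  using linear_add[OF linear_frechet_derivative[OF assms]] by simp

lemma has_derivative_along_line:
  assumes "f differentiable (at (x + h *\<^sub>R v))"
  shows "((\<lambda>h. f (x + h *\<^sub>R v)) has_vector_derivative pd v f (x + h *\<^sub>R v)) (at h)"
proof -
  have "((\<lambda>h. x + h *\<^sub>R v) has_derivative (\<lambda>k. k *\<^sub>R v)) (at h)"
    by (auto intro!: derivative_eq_intros)
  from has_derivative_compose[OF this assms[unfolded frechet_derivative_works]]
  show ?thesis by (simp add: has_vector_derivative_def pd_scaleR_direction[OF assms])
qed

lemma DERIV_snd:
  fixes Q :: "'a::euclidean_space \<times> real \<Rightarrow> real"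
  assumes "Q differentiable (at (y, s))"
  shows "((\<lambda>s. Q (y, s)) has_real_derivative pd (0, 1) Q (y, s)) (at s)"
proof -
  have "Q differentiable (at ((y, 0) + s *\<^sub>R (0, 1)))" using assms by simp
  from has_derivative_along_line[OF this] show ?thesis
    by (simp add: has_real_derivative_iff_has_vector_derivative)
qed

text \<open>Two applications of the mean value theorem: in direction \<open>v\<close> to the
  increment of \<open>f\<close> along \<open>h *\<^sub>R w\<close>, then in direction
  \<open>w\<close> to \<open>pd v f\<close>.\<close>

lemma second_difference_mean_value:
  fixes f :: "'a::euclidean_space \<Rightarrow> real"
  assumes C: "Ck_on 2 S f" and "h > 0"
    and S: "\<And>a b. 0 \<le> a \<Longrightarrow> a \<le> h \<Longrightarrow> 0 \<le> b \<Longrightarrow> b \<le> h \<Longrightarrow> x + a *\<^sub>R v + b *\<^sub>R w \<in> S"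
  obtains a b where "0 < a" "a < h" "0 < b" "b < h"
    "f (x + h *\<^sub>R v + h *\<^sub>R w) - f (x + h *\<^sub>R v) - f (x + h *\<^sub>R w) + f x
       = h * h * pd w (pd v f) (x + a *\<^sub>R v + b *\<^sub>R w)"
proof -
  have C1: "Ck_on 1 S f" and C1': "Ck_on 1 S (pd v f)"
    using C Ck_on_Suc_D[of 1 S f] Ck_on_pd[of 1 S f v] by (auto simp: numeral_2_eq_2)
  define g where "g a = f (x + h *\<^sub>R w + a *\<^sub>R v) - f (x + a *\<^sub>R v)" for a
  have g': "(g has_real_derivative pd v f (x + h *\<^sub>R w + a *\<^sub>R v) - pd v f (x + a *\<^sub>R v)) (at a)"
    if "0 \<le> a" "a \<le> h" for a
  proof -
    have "f differentiable at (x + h *\<^sub>R w + a *\<^sub>R v)" "f differentiable at (x + a *\<^sub>R v)"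
      using C1 S[of a h] S[of a 0] that \<open>h > 0\<close> by (auto simp: algebra_simps)
    from this[THEN has_derivative_along_line] show ?thesis
      unfolding g_def by (auto intro!: derivative_intros simp: has_real_derivative_iff_has_vector_derivative)
  qed
  obtain a where a: "0 < a" "a < h" 
    and ga: "g h - g 0 = h * (pd v f (x + h *\<^sub>R w + a *\<^sub>R v) - pd v f (x + a *\<^sub>R v))"
    using MVT2[OF \<open>h > 0\<close> g'] by auto
  have "((\<lambda>b. pd v f (x + a *\<^sub>R v + b *\<^sub>R w)) has_real_derivative pd w (pd v f) (x + a *\<^sub>R v + b *\<^sub>R w)) (at b)"
    if "0 \<le> b" "b \<le> h" for b
    using has_derivative_along_line[of "pd v f" "x + a *\<^sub>R v" b w] C1' S[of a b] that a
    by (simp add: has_real_derivative_iff_has_vector_derivative)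
  from MVT2[OF \<open>h > 0\<close> this] obtain b where b: "0 < b" "b < h"
    "pd v f (x + a *\<^sub>R v + h *\<^sub>R w) - pd v f (x + a *\<^sub>R v) = h * pd w (pd v f) (x + a *\<^sub>R v + b *\<^sub>R w)"
    by auto
  have "f (x + h *\<^sub>R v + h *\<^sub>R w) - f (x + h *\<^sub>R v) - f (x + h *\<^sub>R w) + f x = g h - g 0"
    unfolding g_def by (simp add: algebra_simps)
  also have "\<dots> = h * h * pd w (pd v f) (x + a *\<^sub>R v + b *\<^sub>R w)"
    using ga b(3) by (simp add: algebra_simps)
  finally show ?thesis using that a b by blast
qed

text \<open>The second difference is symmetric in \<open>v\<close> and \<open>w\<close>, and
  \<open>second_difference_mean_value\<close> equates it with \<open>h * h\<close> times either
  mixed derivative at some nearby point. If these differed at \<open>x\<close>, continuity would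
  keep them apart near \<open>x\<close>.\<close>

lemma pd_commute:
  fixes f :: "'a::euclidean_space \<Rightarrow> real"
  assumes "open S" and C: "Ck_on 2 S f" and "x \<in> S"
  shows "pd v (pd w f) x = pd w (pd v f) x"
proof (rule ccontr)
  assume neq: "pd v (pd w f) x \<noteq> pd w (pd v f) x"
  define e where "e = \<bar>pd v (pd w f) x - pd w (pd v f) x\<bar> / 2"
  have "e > 0" using neq by (simp add: e_def)
  have "continuous_on S (pd v (pd w f))" "continuous_on S (pd w (pd v f))"
    using C by (auto simp: numeral_2_eq_2)
  then obtain d where d: "d > 0" "ball x d \<subseteq> S"
    "\<And>y. y \<in> ball x d \<Longrightarrow> \<bar>pd v (pd w f) y - pd v (pd w f) x\<bar> < e"
    "\<And>y. y \<in> ball x d \<Longrightarrow> \<bar>pd w (pd v f) y - pd w (pd v f) x\<bar> < e"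
  proof -
    assume c: "continuous_on S (pd v (pd w f))" "continuous_on S (pd w (pd v f))"
    obtain d0 where d0: "d0 > 0" "ball x d0 \<subseteq> S" using assms openE by blast
    obtain d1 where d1: "d1 > 0" "\<forall>y\<in>S. dist y x < d1 \<longrightarrow> dist (pd v (pd w f) y) (pd v (pd w f) x) < e"
      using c(1) \<open>x \<in> S\<close> \<open>e > 0\<close> unfolding continuous_on_iff by blast
    obtain d2 where d2: "d2 > 0" "\<forall>y\<in>S. dist y x < d2 \<longrightarrow> dist (pd w (pd v f) y) (pd w (pd v f) x) < e"
      using c(2) \<open>x \<in> S\<close> \<open>e > 0\<close> unfolding continuous_on_iff by blast
    show ?thesis
      by (rule that[of "min d0 (min d1 d2)"])
        (use d0 d1 d2 in \<open>auto simp: dist_commute dist_real_def[symmetric] subset_iff\<close>)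
  qed
  \<comment> \<open>Chosen so that the parallelogram spanned by \<open>h *\<^sub>R v\<close> and
    \<open>h *\<^sub>R w\<close> stays within distance \<open>d / 2\<close> of \<open>x\<close>; the
    summand 1 keeps \<open>M\<close> positive when both directions vanish.\<close>
  define M where "M = norm v + norm w + 1"
  define h where "h = d / 2 / M"
  have np: "M > 0" by (simp add: add_nonneg_pos M_def)
  have "h > 0" using d(1) np by (simp add: h_def)
  have inb: "x + a *\<^sub>R v + b *\<^sub>R w \<in> ball x d" if "0 \<le> a" "a \<le> h" "0 \<le> b" "b \<le> h" for a b
  proof -
    have "norm (a *\<^sub>R v + b *\<^sub>R w) \<le> a * norm v + b * norm w"
      using norm_triangle_ineq[of "a *\<^sub>R v" "b *\<^sub>R w"] that by simp
    also have "\<dots> \<le> h * norm v + h * norm w"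
      using that by (intro add_mono mult_right_mono) auto
    also have "\<dots> \<le> h * M" using \<open>h > 0\<close> by (simp add: M_def algebra_simps)
    also have "\<dots> = d / 2" using np by (simp add: h_def)
    also have "\<dots> < d" using d(1) by simp
    finally show ?thesis by (simp add: dist_norm add.assoc norm_minus_commute add.commute)
  qed
  obtain a b where ab: "0 < a" "a < h" "0 < b" "b < h"
    "f (x + h *\<^sub>R v + h *\<^sub>R w) - f (x + h *\<^sub>R v) - f (x + h *\<^sub>R w) + f x
       = h * h * pd w (pd v f) (x + a *\<^sub>R v + b *\<^sub>R w)"
    using second_difference_mean_value[OF C \<open>h > 0\<close>, of x v w] inb d(2) by blast
  have inb': "x + a *\<^sub>R w + b *\<^sub>R v \<in> ball x d" if "0 \<le> a" "a \<le> h" "0 \<le> b" "b \<le> h" for a b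
    using inb[of b a] that by (simp add: algebra_simps)
  obtain c c' where cc: "0 < c" "c < h" "0 < c'" "c' < h"
    "f (x + h *\<^sub>R w + h *\<^sub>R v) - f (x + h *\<^sub>R w) - f (x + h *\<^sub>R v) + f x
       = h * h * pd v (pd w f) (x + c *\<^sub>R w + c' *\<^sub>R v)"
    using second_difference_mean_value[OF C \<open>h > 0\<close>, of x w v] inb' d(2) by blast
  have "h * h * pd w (pd v f) (x + a *\<^sub>R v + b *\<^sub>R w) = h * h * pd v (pd w f) (x + c *\<^sub>R w + c' *\<^sub>R v)"
    using ab(5) cc(5) by (simp add: algebra_simps)
  then have eq: "pd w (pd v f) (x + a *\<^sub>R v + b *\<^sub>R w) = pd v (pd w f) (x + c *\<^sub>R w + c' *\<^sub>R v)"
    using \<open>h > 0\<close> by simp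
  have "\<bar>pd v (pd w f) x - pd w (pd v f) x\<bar> < 2 * e"
    using d(4)[OF inb[of a b]] d(3)[OF inb'[of c c']] ab cc eq by auto
  then show False by (simp add: e_def)
qed

section \<open>Smooth implicit functions\<close>

lemma Ck_on_Pair_real:
  fixes h :: "'a::euclidean_space \<Rightarrow> real"
  assumes "open S" "Ck_on k S h"
  shows "Ck_on k S (\<lambda>w. (w, h w))"
proof -
  have "bounded_linear (\<lambda>w::'a. (w, 0::real))"
    by (intro bounded_linear_Pair bounded_linear_ident bounded_linear_zero)
  then have "Ck_on k S (\<lambda>w. (w, 0::real) + h w *\<^sub>R (0, 1))"
    by (intro Ck_on_add assms Ck_on_linear Ck_on_scaleR_const)
  then show ?thesis by simp
qed

text \<open>Needed for the implicit function: there the second factor involves an intermediate point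
  of the mean value theorem, and only its continuity at \<open>x\<close> is known. Since
  \<open>p x = 0\<close>, the product rule makes no demand on a derivative of
  \<open>q\<close>.\<close>

lemma has_derivative_mult_continuous:
  fixes p q :: "'a::euclidean_space \<Rightarrow> real"
  assumes p: "(p has_derivative p') (at x)" "p x = 0" and q: "isCont q x"
  shows "((\<lambda>y. p y * q y) has_derivative (\<lambda>v. p' v * q x)) (at x)"
proof -
  interpret p': bounded_linear p' using p(1) by (rule has_derivative_bounded_linear)
  have "((\<lambda>y. q y * ((p y - p' (y - x)) /\<^sub>R norm (y - x)) 
            + (p' (y - x) /\<^sub>R norm (y - x)) * (q y - q x)) \<longlongrightarrow> q x * 0 + 0) (at x)"
  proof (intro tendsto_add tendsto_mult)
    show "(q \<longlongrightarrow> q x) (at x)" using q by (simp add: isCont_def)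
    then have q0: "((\<lambda>y. q y - q x) \<longlongrightarrow> 0) (at x)" by (simp add: LIM_zero)
    show "((\<lambda>y. (p y - p' (y - x)) /\<^sub>R norm (y - x)) \<longlongrightarrow> 0) (at x)"
      using p by (simp add: has_derivative_def Lim_ident_at)
    obtain K where K: "\<And>v. norm (p' v) \<le> norm v * K" "K > 0" using p'.pos_bounded by blast
    show "((\<lambda>y. (p' (y - x) /\<^sub>R norm (y - x)) * (q y - q x)) \<longlongrightarrow> 0) (at x)"
    proof (rule Lim_null_comparison)
      have "norm (p' (y - x) /\<^sub>R norm (y - x)) \<le> K" for y
        using K(1)[of "y - x"] K(2) by (cases "y = x") (auto simp: divide_simps mult.commute)
      then have "norm ((p' (y - x) /\<^sub>R norm (y - x)) * (q y - q x)) \<le> K * \<bar>q y - q x\<bar>" for y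
        using mult_right_mono[of "norm (p' (y - x) /\<^sub>R norm (y - x))" K "norm (q y - q x)"]
          norm_mult[of "p' (y - x) /\<^sub>R norm (y - x)" "q y - q x"] real_norm_def[of "q y - q x"] norm_ge_zero
        by metis
      then show "\<forall>\<^sub>F y in at x. norm ((p' (y - x) /\<^sub>R norm (y - x)) * (q y - q x)) \<le> K * \<bar>q y - q x\<bar>"
        by simp
      show "((\<lambda>y. K * \<bar>q y - q x\<bar>) \<longlongrightarrow> 0) (at x)"
        using tendsto_mult_right_zero[OF tendsto_rabs_zero[OF q0]] .
    qed
  qed
  moreover have "(\<lambda>y. q y * ((p y - p' (y - x)) /\<^sub>R norm (y - x)) 
            + (p' (y - x) /\<^sub>R norm (y - x)) * (q y - q x))
     = (\<lambda>y. (p y * q y - p x * q x - p' (y - x) * q x) /\<^sub>R norm (y - x))"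
    using p(2) by (auto simp: algebra_simps)
  ultimately show ?thesis
    by (simp add: has_derivative_def Lim_ident_at bounded_linear_mult_const p'.bounded_linear_axioms)
qed

lemma isCont_eventually_less:
  fixes f :: "'a::t2_space \<Rightarrow> real"
  assumes "isCont f x" "f x < c" shows "\<forall>\<^sub>F y in nhds x. f y < c"
  using assms order_tendstoD(2) unfolding isCont_def tendsto_at_iff_tendsto_nhds by blast

lemma isCont_eventually_greater:
  fixes f :: "'a::t2_space \<Rightarrow> real"
  assumes "isCont f x" "f x > c" shows "\<forall>\<^sub>F y in nhds x. f y > c"
  using assms order_tendstoD(1) unfolding isCont_def tendsto_at_iff_tendsto_nhds by blast

text \<open>On each vertical segment \<open>F\<close> increases from a negative to a positive value,
  so existence, uniqueness and continuity of the zero all come from signs.\<close>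

locale monotone_slab =
  fixes F :: "'a::euclidean_space \<times> real \<Rightarrow> real" and w0 :: 'a and z0 e \<eta> :: real and V
  assumes open_V: "open V" and smooth_F: "\<And>k. Ck_on k V F"
    and eta: "\<eta> > 0" and e: "e > 0"
    and slab: "\<And>w z. w \<in> ball w0 e \<Longrightarrow> \<bar>z - z0\<bar> \<le> \<eta> \<Longrightarrow> (w, z) \<in> V"
    and pos: "\<And>p. p \<in> V \<Longrightarrow> pd (0, 1) F p > 0"
    and bottom: "\<And>w. w \<in> ball w0 e \<Longrightarrow> F (w, z0 - \<eta>) < 0"
    and top: "\<And>w. w \<in> ball w0 e \<Longrightarrow> F (w, z0 + \<eta>) > 0"
begin

lemma vertical_derivative:
  assumes "(w, z) \<in> V"
  shows "((\<lambda>z. F (w, z)) has_real_derivative pd (0, 1) F (w, z)) (at z)"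
  by (rule DERIV_snd) (use smooth_F[of 1] assms in simp)

text \<open>The order of \<open>z1\<close> and \<open>z2\<close> is left open, as
  \<open>h_has_derivative\<close> compares \<open>h w'\<close> with \<open>h w\<close> without
  knowing which is larger.\<close>

lemma vertical_mean_value:
  assumes "w \<in> ball w0 e" "\<bar>z1 - z0\<bar> \<le> \<eta>" "\<bar>z2 - z0\<bar> \<le> \<eta>"
  shows "\<exists>\<xi>. \<bar>\<xi> - z1\<bar> \<le> \<bar>z2 - z1\<bar> \<and> \<bar>\<xi> - z0\<bar> \<le> \<eta> \<and> F (w, z2) - F (w, z1) = (z2 - z1) * pd (0, 1) F (w, \<xi>)"
proof -
  have der: "((\<lambda>z. F (w, z)) has_real_derivative pd (0, 1) F (w, z)) (at z)" if "\<bar>z - z0\<bar> \<le> \<eta>" for z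
    using vertical_derivative slab[OF assms(1) that] .
  consider "z1 = z2" | "z1 < z2" | "z2 < z1" by linarith
  then show ?thesis
  proof cases
    case 1
    then show ?thesis using assms by (intro exI[of _ z1]) auto
  next
    case 2
    obtain \<xi> where "z1 < \<xi>" "\<xi> < z2" "F (w, z2) - F (w, z1) = (z2 - z1) * pd (0, 1) F (w, \<xi>)"
      using MVT2[OF 2, of "\<lambda>z. F (w, z)" "\<lambda>z. pd (0, 1) F (w, z)"] der assms by auto
    then show ?thesis using assms by (intro exI[of _ \<xi>]) auto
  next
    case 3
    obtain \<xi> where "z2 < \<xi>" "\<xi> < z1" "F (w, z1) - F (w, z2) = (z1 - z2) * pd (0, 1) F (w, \<xi>)"
      using MVT2[OF 3, of "\<lambda>z. F (w, z)" "\<lambda>z. pd (0, 1) F (w, z)"] der assms by auto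
    then show ?thesis using assms by (intro exI[of _ \<xi>]) (auto simp: algebra_simps)
  qed
qed

lemma vertical_mono:
  assumes "w \<in> ball w0 e" "\<bar>z1 - z0\<bar> \<le> \<eta>" "\<bar>z2 - z0\<bar> \<le> \<eta>" "z1 < z2"
  shows "F (w, z1) < F (w, z2)"
proof -
  obtain \<xi> where "\<bar>\<xi> - z0\<bar> \<le> \<eta>" "F (w, z2) - F (w, z1) = (z2 - z1) * pd (0, 1) F (w, \<xi>)"
    using vertical_mean_value[OF assms(1-3)] by blast
  moreover have "pd (0, 1) F (w, \<xi>) > 0" using pos slab assms(1) calculation(1) by blast
  ultimately show ?thesis using assms(4) mult_pos_pos[of "z2 - z1" "pd (0, 1) F (w, \<xi>)"] by linarith
qed

definition h :: "'a \<Rightarrow> real" where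
  "h w = (SOME z. \<bar>z - z0\<bar> < \<eta> \<and> F (w, z) = 0)"

lemma h: assumes w: "w \<in> ball w0 e" shows "\<bar>h w - z0\<bar> < \<eta>" "F (w, h w) = 0"
proof -
  have "continuous_on {z0 - \<eta>..z0 + \<eta>} (\<lambda>z. F (w, z))"
    by (intro continuous_at_imp_continuous_on ballI DERIV_isCont[OF vertical_derivative] slab w) auto
  then obtain z where z: "z0 - \<eta> \<le> z" "z \<le> z0 + \<eta>" "F (w, z) = 0"
    using IVT'[of "\<lambda>z. F (w, z)" "z0 - \<eta>" 0 "z0 + \<eta>"] bottom[OF w] top[OF w] eta by auto
  moreover have "z \<noteq> z0 - \<eta>" "z \<noteq> z0 + \<eta>" using z(3) bottom[OF w] top[OF w] by auto
  ultimately have "\<bar>z - z0\<bar> < \<eta> \<and> F (w, z) = 0" by auto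
  then have "\<bar>h w - z0\<bar> < \<eta> \<and> F (w, h w) = 0" unfolding h_def by (rule someI)
  then show "\<bar>h w - z0\<bar> < \<eta>" "F (w, h w) = 0" by auto
qed

lemma h_unique:
  assumes w: "w \<in> ball w0 e" and "\<bar>z - z0\<bar> < \<eta>" shows "F (w, z) = 0 \<longleftrightarrow> z = h w"
  using vertical_mono[OF w, of z "h w"] vertical_mono[OF w, of "h w" z] h[OF w] assms(2)
  by (cases z "h w" rule: linorder_cases) auto

lemma isCont_F: "p \<in> V \<Longrightarrow> isCont F p"
  using smooth_F[of 1] by (simp add: differentiable_imp_continuous_within)

text \<open>\<open>F\<close> is negative slightly below the zero and positive slightly above it.
  Both signs persist for nearby \<open>w'\<close>, and monotonicity traps \<open>h w'\<close>
  between the two heights.\<close>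

lemma isCont_h: assumes w: "w \<in> ball w0 e" shows "isCont h w"
proof -
  have "\<exists>d>0. \<forall>w'. dist w' w < d \<longrightarrow> dist (h w') (h w) < r" if "r > 0" for r
  proof -
    \<comment> \<open>Half of the smaller number: \<open>r'\<close> is below the tolerance
      \<open>r\<close>, and \<open>h w - r'\<close> and \<open>h w + r'\<close> stay strictly inside
      the slab.\<close>
    define r' where "r' = min r ((\<eta> - \<bar>h w - z0\<bar>)) / 2"
    have "r' > 0" "r' \<le> r / 2" "r' \<le> (\<eta> - \<bar>h w - z0\<bar>) / 2"
      using that h(1)[OF w] by (auto simp: r'_def)
    then have "\<bar>h w - z0\<bar> + r' < \<eta>" "r' > 0" "r' < r" using that h(1)[OF w] by argo+
    then have r': "r' > 0" "r' < r" "\<bar>h w - r' - z0\<bar> < \<eta>" "\<bar>h w + r' - z0\<bar> < \<eta>"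
      by arith+
    have neg: "F (w, h w - r') < 0" and pos: "F (w, h w + r') > 0"
      using vertical_mono[OF w, of "h w - r'" "h w"] vertical_mono[OF w, of "h w" "h w + r'"] r' h[OF w] by auto
    have c: "isCont (\<lambda>w. F (w, z)) w" if "\<bar>z - z0\<bar> \<le> \<eta>" for z
      by (rule isCont_o2[where g=F and f="\<lambda>w. (w, z)"]) (auto intro!: continuous_intros isCont_F slab w that)
    have "\<forall>\<^sub>F w' in nhds w. F (w', h w - r') < 0"
      using c[of "h w - r'"] r' neg isCont_eventually_less by simp
    moreover have "\<forall>\<^sub>F w' in nhds w. F (w', h w + r') > 0"
      using c[of "h w + r'"] r' pos isCont_eventually_greater by simp
    moreover have "\<forall>\<^sub>F w' in nhds w. w' \<in> ball w0 e"
      using w by (intro eventually_nhds_in_open) auto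
    ultimately have "\<forall>\<^sub>F w' in nhds w. dist (h w') (h w) < r"
    proof eventually_elim
      case (elim w')
      have "h w' > h w - r'"
        using vertical_mono[OF elim(3), of "h w'" "h w - r'"] elim(1) h[OF elim(3)] r'
        by (cases "h w'" "h w - r'" rule: linorder_cases) auto
      moreover have "h w' < h w + r'"
        using vertical_mono[OF elim(3), of "h w + r'" "h w'"] elim(2) h[OF elim(3)] r'
        by (cases "h w'" "h w + r'" rule: linorder_cases) auto
      ultimately show ?case using r' by (auto simp: dist_real_def)
    qed
    then show ?thesis by (simp add: eventually_nhds_metric)
  qed
  then show ?thesis by (simp add: continuous_at_eps_delta)
qed

lemma graph_in_V: "w \<in> ball w0 e \<Longrightarrow> (w, h w) \<in> V"
  using slab[of w "h w"] h[of w] by auto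

text \<open>As \<open>F (w', h w') = 0\<close>, the mean value theorem reads
  \<open>h w' = h w - F (w', h w) / pd (0, 1) F (w', \<xi> w')\<close>. The numerator is
  differentiable at \<open>w\<close> and vanishes there, the reciprocal is continuous at
  \<open>w\<close>, and \<open>has_derivative_mult_continuous\<close> yields the derivative without
  an a priori bound on difference quotients.\<close>

lemma h_has_derivative:
  assumes w: "w \<in> ball w0 e"
  shows "(h has_derivative (\<lambda>v. - pd (v, 0) F (w, h w) * inverse (pd (0, 1) F (w, h w)))) (at w)"
proof -
  \<comment> \<open>An arbitrary choice of intermediate points; continuity at \<open>w\<close> is
    forced by \<open>\<bar>\<xi> w' - h w\<bar> \<le> \<bar>h w' - h w\<bar>\<close>.\<close>
  define \<xi> where "\<xi> w' = (SOME \<xi>. \<bar>\<xi> - h w\<bar> \<le> \<bar>h w' - h w\<bar> \<and> \<bar>\<xi> - z0\<bar> \<le> \<eta> \<and> 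
      F (w', h w') - F (w', h w) = (h w' - h w) * pd (0, 1) F (w', \<xi>))" for w'
  have xi: "\<bar>\<xi> w' - h w\<bar> \<le> \<bar>h w' - h w\<bar> \<and> \<bar>\<xi> w' - z0\<bar> \<le> \<eta> \<and> 
      F (w', h w') - F (w', h w) = (h w' - h w) * pd (0, 1) F (w', \<xi> w')" if "w' \<in> ball w0 e" for w'
    unfolding \<xi>_def by (rule someI_ex, rule vertical_mean_value) (use that h[OF w] h[OF that] in auto)
  define q where "q w' = inverse (pd (0, 1) F (w', \<xi> w'))" for w'
  have xi_w: "\<xi> w = h w" using xi[OF w] by auto
  have ev: "\<forall>\<^sub>F w' in nhds w. w' \<in> ball w0 e"
    using w by (intro eventually_nhds_in_open) auto
  have "((\<lambda>w'. \<bar>h w' - h w\<bar>) \<longlongrightarrow> 0) (at w)"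
    using isCont_h[OF w] by (intro tendsto_rabs_zero LIM_zero) (simp add: isCont_def)
  then have "((\<lambda>w'. \<xi> w' - h w) \<longlongrightarrow> 0) (at w)"
  proof (rule Lim_null_comparison[rotated])
    show "\<forall>\<^sub>F w' in at w. norm (\<xi> w' - h w) \<le> \<bar>h w' - h w\<bar>"
      using ev unfolding eventually_at_filter by eventually_elim (use xi in auto)
  qed
  then have cont_xi: "isCont \<xi> w" by (simp add: isCont_def LIM_zero_iff xi_w)
  have cont_pd: "isCont (pd (0, 1) F) (w, \<xi> w)"
    using Ck_on_continuous[OF Ck_on_pd[OF smooth_F[of "Suc 0"]]] open_V graph_in_V[OF w]
    by (simp add: xi_w continuous_on_eq_continuous_at)
  have "isCont (\<lambda>w'. pd (0, 1) F (w', \<xi> w')) w"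
    by (rule isCont_o2[where g="pd (0,1) F" and f="\<lambda>w'. (w', \<xi> w')"])
      (auto intro!: continuous_intros cont_xi cont_pd)
  then have cont_q: "isCont q w"
    unfolding q_def by (intro continuous_at_within_inverse) (use pos[OF graph_in_V[OF w]] xi_w in auto)
  have "F differentiable (at (w, h w))" using smooth_F[of 1] graph_in_V[OF w] by simp
  then have "(F has_derivative (\<lambda>v. pd v F (w, h w))) (at (w, h w))"
    by (simp add: frechet_derivative_works)
  moreover have "((\<lambda>w'. (w', h w)) has_derivative (\<lambda>v. (v, 0))) (at w)"
    by (auto intro!: derivative_eq_intros)
  ultimately have p: "((\<lambda>w'. F (w', h w)) has_derivative (\<lambda>v. pd (v, 0) F (w, h w))) (at w)"
    using has_derivative_compose[of "\<lambda>w'. (w', h w)" "\<lambda>v. (v, 0)" w UNIV F] by simp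
  have "((\<lambda>w'. h w - F (w', h w) * q w') has_derivative (\<lambda>v. - (pd (v, 0) F (w, h w) * q w))) (at w)"
    using has_derivative_diff[OF has_derivative_const[of "h w"] has_derivative_mult_continuous[OF p _ cont_q]] h[OF w]
    by simp
  then have "(h has_derivative (\<lambda>v. - (pd (v, 0) F (w, h w) * q w))) (at w)"
  proof (rule has_derivative_transform_within_open[of _ _ _ _ "ball w0 e"])
    fix w' assume w': "w' \<in> ball w0 e"
    have "pd (0, 1) F (w', \<xi> w') > 0" using xi[OF w'] slab[OF w'] pos by blast
    then show "h w - F (w', h w) * q w' = h w'"
      using xi[OF w'] h[OF w'] by (simp add: q_def field_simps)
  qed (use w in auto)
  then show ?thesis by (simp add: q_def xi_w)
qed

text \<open>Bootstrapping: the derivative of \<open>h\<close> is a smooth expression in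
  \<open>(w, h w)\<close>, so it inherits the order of \<open>h\<close>, which raises the order of
  \<open>h\<close> by one.\<close>

lemma smooth_h: "Ck_on k (ball w0 e) h"
proof (induction k)
  case 0
  then show ?case using isCont_h by (simp add: continuous_at_imp_continuous_on)
next
  case (Suc k)
  have graph: "Ck_on k (ball w0 e) (\<lambda>w. (w, h w))"
    using Suc by (intro Ck_on_Pair_real) auto
  have "Ck_on k (ball w0 e) (\<lambda>w. pd v F (w, h w))" for v
    by (rule Ck_on_compose[OF open_ball open_V Ck_on_pd[OF smooth_F] graph graph_in_V])
  then have "Ck_on k (ball w0 e) (\<lambda>w. - pd (v, 0) F (w, h w) * inverse (pd (0, 1) F (w, h w)))" for v
    by (intro Ck_on_mult Ck_on_minus Ck_on_inverse open_ball) (use pos[OF graph_in_V] in force)+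
  then show ?case by (intro Ck_on_SucI[OF open_ball h_has_derivative])
qed

end

lemma implicit_function:
  fixes F :: "'a::euclidean_space \<times> real \<Rightarrow> real"
  assumes V: "open V" "\<And>k. Ck_on k V F" "(w0, z0) \<in> V" and F0: "F (w0, z0) = 0"
    and pos: "\<And>p. p \<in> V \<Longrightarrow> pd (0, 1) F p > 0"
  obtains e \<eta> h where "e > 0" "\<eta> > 0"
    "\<And>w z. w \<in> ball w0 e \<Longrightarrow> \<bar>z - z0\<bar> \<le> \<eta> \<Longrightarrow> (w, z) \<in> V"
    "\<And>w. w \<in> ball w0 e \<Longrightarrow> \<bar>h w - z0\<bar> < \<eta>"
    "\<And>w z. w \<in> ball w0 e \<Longrightarrow> \<bar>z - z0\<bar> < \<eta> \<Longrightarrow> F (w, z) = 0 \<longleftrightarrow> z = h w"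
    "\<And>k. Ck_on k (ball w0 e) h"
proof -
  obtain d where d: "d > 0" "ball (w0, z0) d \<subseteq> V" using V openE by blast
  \<comment> \<open>\<open>d/2\<close> horizontally and \<open>d/4\<close> vertically, so that the
    slab fits into the ball of radius \<open>d\<close> of the product space.\<close>
  have slab: "(w, z) \<in> V" if "w \<in> ball w0 (d/2)" "\<bar>z - z0\<bar> \<le> d/4" for w z
  proof -
    have "dist (w0, z0) (w, z) \<le> dist w0 w + dist z0 z"
      by (simp add: dist_Pair_Pair sqrt_sum_squares_le_sum)
    also have "\<dots> < d"
      using that(1) that(2)[unfolded abs_minus_commute[of z z0]] d(1) unfolding mem_ball dist_real_def by linarith
    finally show ?thesis using d(2) by auto
  qed
  have der: "((\<lambda>z. F (w0, z)) has_real_derivative pd (0, 1) F (w0, z)) (at z)" if "\<bar>z - z0\<bar> \<le> d/4" for z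
    by (rule DERIV_snd) (use V(2)[of 1] slab[of w0 z] that d(1) in simp)
  have incr: "F (w0, z1) < F (w0, z2)" if "z1 < z2" "z0 - d/4 \<le> z1" "z2 \<le> z0 + d/4" for z1 z2
  proof (rule DERIV_pos_imp_increasing[OF that(1)])
    fix z assume "z1 \<le> z" "z \<le> z2"
    then have "\<bar>z - z0\<bar> \<le> d/4" using that unfolding abs_le_iff by linarith
    then show "\<exists>y. ((\<lambda>z. F (w0, z)) has_real_derivative y) (at z) \<and> 0 < y"
      using der[of z] pos slab[of w0 z] d(1) by auto
  qed
  have cont: "isCont (\<lambda>w. F (w, z)) w0" if "\<bar>z - z0\<bar> \<le> d/4" for z
  proof -
    have "isCont F (w0, z)" using V(2)[of 1] slab[of w0 z] that d(1)
      by (simp add: differentiable_imp_continuous_within)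
    then show ?thesis
      by (intro isCont_o2[where g=F and f="\<lambda>w. (w, z)"]) (auto intro!: continuous_intros)
  qed
  have "F (w0, z0 - d/4) < 0" "F (w0, z0 + d/4) > 0"
    using incr[of "z0 - d/4" z0] incr[of z0 "z0 + d/4"] d(1) F0 by auto
  then have "\<forall>\<^sub>F w in nhds w0. F (w, z0 - d/4) < 0" "\<forall>\<^sub>F w in nhds w0. F (w, z0 + d/4) > 0"
    using isCont_eventually_less[OF cont[of "z0 - d/4"]] isCont_eventually_greater[OF cont[of "z0 + d/4"]] d(1)
    by auto
  then have "\<forall>\<^sub>F w in nhds w0. F (w, z0 - d/4) < 0 \<and> F (w, z0 + d/4) > 0"
    by eventually_elim auto
  then obtain e0 where e0: "e0 > 0" "\<And>w. dist w w0 < e0 \<Longrightarrow> F (w, z0 - d/4) < 0 \<and> F (w, z0 + d/4) > 0"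
    by (auto simp: eventually_nhds_metric)
  define e where "e = min e0 (d/2)"
  have e: "e > 0" "e \<le> e0" "e \<le> d/2" using e0 d by (auto simp: e_def)
  have be: "w \<in> ball w0 (d/2)" "dist w w0 < e0" if "w \<in> ball w0 e" for w
    using that e by (auto simp: dist_commute)
  interpret monotone_slab F w0 z0 e "d/4" V
  proof unfold_locales
    show "(w, z) \<in> V" if "w \<in> ball w0 e" "\<bar>z - z0\<bar> \<le> d/4" for w z
      by (rule slab[OF be(1)[OF that(1)] that(2)])
    show "F (w, z0 - d/4) < 0" "F (w, z0 + d/4) > 0" if "w \<in> ball w0 e" for w
      using e0(2)[OF be(2)[OF that]] by auto
    show "d/4 > 0" using d(1) by simp
    show "open V" "Ck_on k V F" "e > 0" for k by (rule V(1) V(2) e(1))+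
    show "pd (0, 1) F p > 0" if "p \<in> V" for p by (rule pos[OF that])
  qed
  show ?thesis
  proof (rule that[of e "d/4" h])
    show "(w, z) \<in> V" if "w \<in> ball w0 e" "\<bar>z - z0\<bar> \<le> d/4" for w z
      by (rule slab[OF that])
    show "\<bar>h w - z0\<bar> < d/4" if "w \<in> ball w0 e" for w by (rule h(1)[OF that])
    show "F (w, z) = 0 \<longleftrightarrow> z = h w" if "w \<in> ball w0 e" "\<bar>z - z0\<bar> < d/4" for w z
      by (rule h_unique[OF that])
    show "Ck_on k (ball w0 e) h" for k by (rule smooth_h)
  qed (rule e(1) eta)+
qed

section \<open>Graph coordinates and surface measure\<close>

text \<open>Graphs over any of the three coordinate planes are treated uniformly by numbering the
  coordinates cyclically from the vertical one.\<close>

definition nx :: "3 \<Rightarrow> 3" where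
  "nx k = (if k = 1 then 2 else if k = 2 then 3 else 1)"

definition emb :: "3 \<Rightarrow> real^2 \<Rightarrow> real \<Rightarrow> real^3" where
  "emb k y z = z *\<^sub>R axis k 1 + y $ 1 *\<^sub>R axis (nx k) 1 + y $ 2 *\<^sub>R axis (nx (nx k)) 1"

definition prj :: "3 \<Rightarrow> real^3 \<Rightarrow> real^2" where
  "prj k x = (\<chi> i. if i = 1 then x $ nx k else x $ nx (nx k))"

lemma nx_distinct [simp]:
  "nx k \<noteq> k" "nx (nx k) \<noteq> k" "nx (nx k) \<noteq> nx k" "k \<noteq> nx k" "k \<noteq> nx (nx k)" "nx k \<noteq> nx (nx k)"
  by (auto simp: nx_def)

lemma UNIV_nx: "UNIV = {k, nx k, nx (nx k)}"
proof -
  have "i \<in> {k, nx k, nx (nx k)}" for i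
    using exhaust_3[of i] exhaust_3[of k] by (auto simp: nx_def)
  then show ?thesis by blast
qed

lemma sum_nx: "sum f (UNIV :: 3 set) = f k + f (nx k) + f (nx (nx k))"
  unfolding UNIV_nx[of k] by (simp add: add.assoc)

lemma nx_cases: obtains "i = k" | "i = nx k" | "i = nx (nx k)"
  using UNIV_nx[of k] by auto

lemma emb_nth [simp]: "emb k y z $ k = z" "emb k y z $ nx k = y $ 1" "emb k y z $ nx (nx k) = y $ 2"
  by (simp_all add: emb_def axis_def)

lemma prj_nth [simp]: "prj k x $ 1 = x $ nx k" "prj k x $ 2 = x $ nx (nx k)"
  by (simp_all add: prj_def)

lemma prj_emb [simp]: "prj k (emb k y z) = y"
  by (simp add: vec_eq_iff forall_2)

lemma emb_prj: "emb k (prj k x) (x $ k) = x"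
proof -
  have "emb k (prj k x) (x $ k) $ i = x $ i" for i
    by (cases i rule: nx_cases[where k=k]) simp_all
  then show ?thesis by (simp add: vec_eq_iff)
qed

lemma bounded_linear_emb: "bounded_linear (\<lambda>(y, z). emb k y z)"
  unfolding emb_def split_beta
  by (intro bounded_linear_add bounded_linear_scaleR_const bounded_linear_snd
      bounded_linear_compose[OF bounded_linear_vec_nth bounded_linear_fst])

lemma bounded_linear_prj: "bounded_linear (prj k)"
proof -
  have "linear (prj k)"
    by (rule linearI) (auto simp: vec_eq_iff prj_def)
  then show ?thesis by (simp add: linear_conv_bounded_linear)
qed

lemma emb_axis: "emb k 0 z = z *\<^sub>R axis k 1" "emb k (axis 1 1) 0 = axis (nx k) 1" "emb k (axis 2 1) 0 = axis (nx (nx k)) 1"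
  by (simp_all add: emb_def axis_def)

lemma continuous_on_prj [continuous_intros]:
  "continuous_on S f \<Longrightarrow> continuous_on S (\<lambda>x. prj k (f x))"
  by (rule bounded_linear.continuous_on[OF bounded_linear_prj])

lemma grad_nth: "grad g x $ i = pd (axis i 1) g x"
  by (simp add: grad_def)

lemma frechet_derivative_grad:
  assumes "f differentiable (at x)" shows "pd v f x = grad f x \<bullet> v"
proof -
  have lin: "linear (frechet_derivative f (at x))" using assms by (rule linear_frechet_derivative)
  have "pd v f x = pd (\<Sum>i\<in>UNIV. v $ i *\<^sub>R axis i 1) f x"
    using basis_expansion[of v] by (simp add: scalar_mult_eq_scaleR)
  also have "\<dots> = (\<Sum>i\<in>UNIV. v $ i * pd (axis i 1) f x)"
    by (simp add: linear_sum[OF lin] linear_scale[OF lin])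
  finally show ?thesis by (simp add: grad_def inner_vec_def mult.commute)
qed

text \<open>By the Lagrange identity \<open>g\<close> has zero cross product with
  \<open>cross3 a b\<close>, so the two vectors are parallel; the claim compares their
  \<open>k\<close>-th coordinates and norms.\<close>

lemma cross3_parallel:
  fixes g a b :: "real^3"
  assumes "g \<bullet> a = 0" "g \<bullet> b = 0"
  shows "\<bar>cross3 a b $ k\<bar> * norm g = \<bar>g $ k\<bar> * norm (cross3 a b)"
proof -
  have "cross3 g (cross3 a b) = 0"
    using Lagrange[of g a b] assms by simp
  then have "cross3 a b $ k *\<^sub>R g = g $ k *\<^sub>R cross3 a b"
    using exhaust_3[of k] by (auto simp: cross3_simps vec_eq_iff forall_3)
  then have "norm (cross3 a b $ k *\<^sub>R g) = norm (g $ k *\<^sub>R cross3 a b)" by simp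
  then show ?thesis by simp
qed

lemma cross3_nx: "cross3 a b $ k = a $ nx k * b $ nx (nx k) - a $ nx (nx k) * b $ nx k"
  using exhaust_3[of k] by (auto simp: cross3_simps nx_def)

text \<open>The area density of a level set written as a graph in direction \<open>k\<close>: the
  reciprocal of \<open>\<bar>n_k\<bar>\<close>, or \<open>sqrt (1 + |grad h|^2)\<close> in terms of
  the height \<open>h\<close>.\<close>

definition slope :: "(real^3 \<Rightarrow> real) \<Rightarrow> 3 \<Rightarrow> real^3 \<Rightarrow> real" where
  "slope \<phi> k x = norm (grad \<phi> x) / \<bar>pd (axis k 1) \<phi> x\<bar>"

text \<open>Both tangent vectors are orthogonal to the gradient, so their cross product is parallel to it.
  This also yields the change of variables between charts without inverting a parametrization.\<close>

lemma area_element_projection: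
  fixes r :: "real^2 \<Rightarrow> real^3"
  assumes r: "r differentiable (at y)" and U: "open U" "y \<in> U" "\<And>y'. y' \<in> U \<Longrightarrow> \<phi> (r y') = 0"
    and \<phi>: "\<phi> differentiable (at (r y))" "pd (axis k 1) \<phi> (r y) \<noteq> 0"
  shows "\<bar>det (matrix (\<lambda>v. prj k (pd v r y)))\<bar> * slope \<phi> k (r y) = area_element r y"
proof -
  define a b where "a = pd (axis 1 1) r y" and "b = pd (axis 2 1) r y"
  have "((\<lambda>y. \<phi> (r y)) has_derivative (\<lambda>v. pd (pd v r y) \<phi> (r y))) (at y)"
    using has_derivative_compose[OF r[unfolded frechet_derivative_works] \<phi>(1)[unfolded frechet_derivative_works]] .
  moreover have "((\<lambda>y. \<phi> (r y)) has_derivative (\<lambda>v. 0)) (at y)"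
    by (rule has_derivative_transform_within_open[OF has_derivative_const U(1,2)]) (simp add: U(3))
  ultimately have "(\<lambda>v. pd (pd v r y) \<phi> (r y)) = (\<lambda>v. 0)"
    by (rule has_derivative_unique)
  then have "grad \<phi> (r y) \<bullet> pd v r y = 0" for v
    using frechet_derivative_grad[OF \<phi>(1)] by metis
  then have "\<bar>cross3 a b $ k\<bar> * norm (grad \<phi> (r y)) = \<bar>grad \<phi> (r y) $ k\<bar> * norm (cross3 a b)"
    by (intro cross3_parallel) (simp_all add: a_def b_def)
  moreover have "det (matrix (\<lambda>v. prj k (pd v r y))) = cross3 a b $ k"
    by (simp add: det_2 matrix_def cross3_nx a_def b_def)
  ultimately show ?thesis using \<phi>(2)
    by (simp add: area_element_def slope_def a_def b_def grad_nth divide_simps mult.commute)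
qed

section \<open>Measures carried by a parametrization, and graph charts of a fixed surface\<close>

lemma local_parametrization_measurable:
  assumes "local_parametrization S U q"
  shows "(\<lambda>y. indicator U y *\<^sub>R q y) \<in> borel_measurable borel"
    "(\<lambda>y. indicator U y *\<^sub>R area_element q y) \<in> borel_measurable borel"
proof -
  have U: "open U" and C: "\<And>n. Ck_on n U q"
    using assms by (auto simp: local_parametrization_def smooth_on_def simp del: Ck_on.simps)
  have cont_q: "continuous_on U q" using Ck_on_continuous[OF C] .
  have cont_pd: "continuous_on U (pd v q)" for v
    using Ck_on_continuous[OF Ck_on_pd[OF C]] .
  have cont_area: "continuous_on U (area_element q)"
    unfolding area_element_def by (intro continuous_intros cont_pd continuous_on_cross)
  show "(\<lambda>y. indicator U y *\<^sub>R q y) \<in> borel_measurable borel"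
     "(\<lambda>y. indicator U y *\<^sub>R area_element q y) \<in> borel_measurable borel"
    by (intro borel_measurable_continuous_on_indicator cont_q cont_area; simp add: U)+
qed

text \<open>Makes the right-hand side of the area formula a measure in the image set, so that
  additivity over Borel pieces is available. Off \<open>U\<close> the map has the dummy value 0, but
  the density vanishes there.\<close>

definition parametrized_area :: "(real^2) set \<Rightarrow> (real^2 \<Rightarrow> real^3) \<Rightarrow> (real^3) measure" where
  "parametrized_area U q = distr (density lborel (\<lambda>y. ennreal (indicator U y *\<^sub>R area_element q y)))
     borel (\<lambda>y. indicator U y *\<^sub>R q y)"

lemma emeasure_parametrized_area:
  assumes q: "local_parametrization S U q" and B: "B \<in> sets borel"
  shows "emeasure (parametrized_area U q) B = (\<integral>\<^sup>+ y \<in> {y\<in>U. q y \<in> B}. ennreal (area_element q y) \<partial>lborel)"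
proof -
  note m = local_parametrization_measurable[OF q]
  let ?q = "\<lambda>y. indicator U y *\<^sub>R q y"
  have "open U" using q by (simp add: local_parametrization_def)
  have "emeasure (parametrized_area U q) B = emeasure (density lborel (\<lambda>y. ennreal (indicator U y *\<^sub>R area_element q y))) (?q -` B)"
    unfolding parametrized_area_def using m B by (subst emeasure_distr) auto
  also have "\<dots> = (\<integral>\<^sup>+ y. ennreal (indicator U y *\<^sub>R area_element q y) * indicator (?q -` B) y \<partial>lborel)"
    using m measurable_sets[OF m(1) B] by (subst emeasure_density) auto
  also have "\<dots> = (\<integral>\<^sup>+ y \<in> {y\<in>U. q y \<in> B}. ennreal (area_element q y) \<partial>lborel)"
    by (intro nn_integral_cong) (auto simp: indicator_def)
  finally show ?thesis .
qed

text \<open>The bounds on \<open>Y\<close> and on \<open>slope\<close> serve the change of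
  variables, where they make the area density integrable. The last clause says that inside
  \<open>C\<close> the level set is exactly the graph.\<close>

definition graph_chart ::
    "(real^3 \<Rightarrow> real) \<Rightarrow> 3 \<Rightarrow> (real^2) set \<Rightarrow> (real^3) set \<Rightarrow> (real^2 \<Rightarrow> real) \<Rightarrow> real \<Rightarrow> bool" where
  "graph_chart \<phi> k Y C h M \<longleftrightarrow>
     open Y \<and> bounded Y \<and> open C \<and> (\<forall>n. Ck_on n Y h) \<and> (\<forall>n. Ck_on n C \<phi>) \<and>
     (\<forall>x\<in>C. pd (axis k 1) \<phi> x \<noteq> 0 \<and> slope \<phi> k x \<le> M) \<and>
     (\<forall>y\<in>Y. emb k y (h y) \<in> C) \<and>
     (\<forall>x\<in>C. prj k x \<in> Y \<and> (\<phi> x = 0 \<longleftrightarrow> x $ k = h (prj k x)))"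

locale surface_graph =
  fixes \<phi> k Y C h M
  assumes chart: "graph_chart \<phi> k Y C h M"
begin

lemma open_Y: "open Y" and bounded_Y: "bounded Y" and open_C: "open C"
  and smooth_h: "Ck_on n Y h" and smooth_phi: "Ck_on n C \<phi>"
  and phi_k: "x \<in> C \<Longrightarrow> pd (axis k 1) \<phi> x \<noteq> 0" and slope_le: "x \<in> C \<Longrightarrow> slope \<phi> k x \<le> M"
  and graph_in: "y \<in> Y \<Longrightarrow> emb k y (h y) \<in> C" and prj_in: "x \<in> C \<Longrightarrow> prj k x \<in> Y"
  and level_iff: "x \<in> C \<Longrightarrow> \<phi> x = 0 \<longleftrightarrow> x $ k = h (prj k x)"
  using chart unfolding graph_chart_def by auto

definition r :: "real^2 \<Rightarrow> real^3" where "r y = emb k y (h y)"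

definition S :: "(real^3) set" where "S = {x. \<phi> x = 0}"

lemma r_in: "y \<in> Y \<Longrightarrow> r y \<in> C" by (simp add: r_def graph_in)

lemma phi_r: "y \<in> Y \<Longrightarrow> \<phi> (r y) = 0"
  using level_iff[OF r_in] by (simp add: r_def)

lemma prj_r [simp]: "prj k (r y) = y" by (simp add: r_def)

lemma r_prj: "x \<in> C \<Longrightarrow> \<phi> x = 0 \<Longrightarrow> r (prj k x) = x"
  using level_iff[of x] emb_prj[of k x] by (simp add: r_def)

lemma image_r: "r ` Y = S \<inter> C"
  using r_in phi_r r_prj prj_in by (force simp: S_def)

lemma smooth_r: "Ck_on n Y r"
proof -
  have "Ck_on n Y (\<lambda>y. emb k y 0 + h y *\<^sub>R axis k 1)"
    using bounded_linear_compose[OF bounded_linear_emb bounded_linear_Pair[OF bounded_linear_ident bounded_linear_zero]]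
    by (intro Ck_on_add Ck_on_scaleR_const Ck_on_linear open_Y smooth_h) simp
  moreover have "emb k y 0 + h y *\<^sub>R axis k 1 = r y" for y by (simp add: r_def emb_def)
  ultimately show ?thesis by simp
qed

lemma continuous_on_r: "continuous_on Y r"
  using Ck_on_continuous smooth_r .

text \<open>The projection undoes \<open>r\<close>, so the determinant in
  \<open>area_element_projection\<close> is 1.\<close>

lemma area_element_r:
  assumes "y \<in> Y" shows "area_element r y = slope \<phi> k (r y)"
proof -
  have r': "r differentiable (at y)" using smooth_r[of 1] assms by simp
  have "((\<lambda>y. prj k (r y)) has_derivative (\<lambda>v. prj k (pd v r y))) (at y)"
    by (rule bounded_linear.has_derivative[OF bounded_linear_prj r'[unfolded frechet_derivative_works]])
  then have "(\<lambda>v. prj k (pd v r y)) = (\<lambda>v. v)"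
    using has_derivative_unique[OF _ has_derivative_ident] by simp
  then have "\<bar>det (matrix (\<lambda>v. prj k (pd v r y)))\<bar> = 1"
    by (simp add: matrix_id_mat_1[unfolded id_def] det_I)
  then show ?thesis
    using area_element_projection[OF r' open_Y assms phi_r _ phi_k[OF r_in[OF assms]]]
      smooth_phi[of 1] r_in[OF assms] by simp
qed

lemma slope_pos: "x \<in> C \<Longrightarrow> slope \<phi> k x > 0"
proof -
  assume "x \<in> C"
  then have "grad \<phi> x $ k \<noteq> 0" "pd (axis k 1) \<phi> x \<noteq> 0" using phi_k by (auto simp: grad_nth)
  then have "norm (grad \<phi> x) > 0" "\<bar>pd (axis k 1) \<phi> x\<bar> > 0" by auto
  then show ?thesis unfolding slope_def by (rule divide_pos_pos)
qed

lemma parametrization: "local_parametrization S Y r"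
  unfolding local_parametrization_def
proof (intro conjI exI)
  show "open Y" by (rule open_Y)
  show "smooth_on Y r" by (simp add: smooth_on_def smooth_r del: Ck_on.simps)
  show "\<forall>y\<in>Y. area_element r y \<noteq> 0"
    using slope_pos[OF r_in] area_element_r by (metis less_irrefl)
  show "homeomorphism Y (r ` Y) r (prj k)"
    by (intro homeomorphismI continuous_on_r continuous_on_prj continuous_on_id) auto
  show "openin (top_of_set S) (r ` Y)"
    unfolding image_r using open_C by (auto simp: openin_open)
qed

lemma continuous_on_slope_r: "continuous_on Y (\<lambda>y. slope \<phi> k (r y))"
proof -
  have c: "continuous_on C (pd v \<phi>)" for v
    using Ck_on_continuous[OF Ck_on_pd[OF smooth_phi]] .
  have "continuous_on C (slope \<phi> k)"
    unfolding slope_def norm_vec_def L2_set_def grad_nth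
    by (intro continuous_intros c) (use phi_k in auto)
  then show ?thesis
    by (rule continuous_on_compose2[OF _ continuous_on_r]) (use r_in in auto)
qed

definition rr :: "real^2 \<Rightarrow> real^3" where "rr y = indicator Y y *\<^sub>R r y"

definition wt :: "real^2 \<Rightarrow> real" where "wt y = indicator Y y * slope \<phi> k (r y)"

lemma wt_eq_area: "wt y = indicator Y y *\<^sub>R area_element r y"
  by (cases "y \<in> Y") (simp_all add: wt_def area_element_r)

lemma measurable_rr [measurable]: "rr \<in> borel_measurable borel"
  using local_parametrization_measurable(1)[OF parametrization] by (simp add: rr_def[abs_def])

lemma measurable_wt [measurable]: "wt \<in> borel_measurable borel"
  using local_parametrization_measurable(2)[OF parametrization] by (simp add: wt_eq_area[abs_def])

lemma wt_nonneg: "wt y \<ge> 0" by (simp add: wt_def slope_def)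

definition pushed :: "(real^3) measure" where
  "pushed = distr (density lborel (\<lambda>y. ennreal (wt y))) borel rr"

lemma sets_pushed [measurable_cong, simp]: "sets pushed = sets borel" by (simp add: pushed_def)

lemma emeasure_pushed:
  "B \<in> sets borel \<Longrightarrow>
    emeasure pushed B = (\<integral>\<^sup>+ y \<in> {y\<in>Y. r y \<in> B}. ennreal (area_element r y) \<partial>lborel)"
  using emeasure_parametrized_area[OF parametrization]
  by (simp add: pushed_def parametrized_area_def wt_eq_area rr_def[abs_def])

end

text \<open>The change of variables theorem concerns absolutely integrable vector-valued functions
  and Lebesgue measure, hence the wrapping into \<open>real^1\<close> and the passage between
  \<open>lborel\<close> and its completion. Boundedness of the image and of \<open>w\<close> gives
  integrability there, and the theorem returns it on \<open>A\<close>.\<close>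

lemma nn_integral_change_of_variables:
  fixes g :: "real^2 \<Rightarrow> real^2" and w :: "real^2 \<Rightarrow> real"
  assumes A: "A \<in> sets borel" and gA: "g ` A \<in> sets borel" "bounded (g ` A)"
    and g: "\<And>y. y \<in> A \<Longrightarrow> (g has_derivative g' y) (at y)" "inj_on g A"
    and w: "(\<lambda>y. indicator (g ` A) y * w y) \<in> borel_measurable borel" "\<And>y. y \<in> g ` A \<Longrightarrow> 0 \<le> w y \<and> w y \<le> M"
    and m: "(\<lambda>y. indicator A y * (\<bar>det (matrix (g' y))\<bar> * w (g y))) \<in> borel_measurable borel"
  shows "(\<integral>\<^sup>+ y \<in> A. ennreal (\<bar>det (matrix (g' y))\<bar> * w (g y)) \<partial>lborel) = (\<integral>\<^sup>+ y \<in> g ` A. ennreal (w y) \<partial>lborel)"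
proof -
  define f :: "real^2 \<Rightarrow> real^1" where "f y = vec (w y)" for y
  have int_gA: "set_integrable lborel (g ` A) w"
  proof -
    have "integrable lborel (\<lambda>y. indicator (g ` A) y * M)"
      using emeasure_bounded_finite[OF gA(2)] gA(1) by (auto simp: integrable_mult_left_iff)
    then show ?thesis
      unfolding set_integrable_def
    proof (rule Bochner_Integration.integrable_bound)
      have "norm (indicator (g ` A) y *\<^sub>R w y) \<le> norm (indicator (g ` A) y * M)" for y
        using w(2)[of y] by (cases "y \<in> g ` A") auto
      then show "AE y in lborel. norm (indicator (g ` A) y *\<^sub>R w y) \<le> norm (indicator (g ` A) y * M)"
        by simp
    qed (use w(1) in simp)
  qed
  then have "w absolutely_integrable_on (g ` A)"
    by (simp add: set_integrable_def integrable_completion w)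
  then have "f absolutely_integrable_on (g ` A)"
    by (subst absolutely_integrable_componentwise_iff) (simp add: f_def Basis_vec_def inner_axis)
  moreover have "A \<in> sets lebesgue" using A by simp
  ultimately have cv: "(\<lambda>x. \<bar>det (matrix (g' x))\<bar> *\<^sub>R f (g x)) absolutely_integrable_on A"
    "integral A (\<lambda>x. \<bar>det (matrix (g' x))\<bar> *\<^sub>R f (g x)) = integral (g ` A) f"
    using has_absolute_integral_change_of_variables[of A g g' f "integral (g ` A) f"] g
      has_derivative_at_withinI by blast+
  have cv1: "(\<lambda>x. \<bar>det (matrix (g' x))\<bar> * w (g x)) absolutely_integrable_on A"
    using iffD1[OF absolutely_integrable_componentwise_iff cv(1)]
    by (simp add: Basis_vec_def inner_axis f_def)
  have cv2: "integral A (\<lambda>x. \<bar>det (matrix (g' x))\<bar> * w (g x)) = integral (g ` A) w"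
  proof -
    have "integral A (\<lambda>x. (\<bar>det (matrix (g' x))\<bar> *\<^sub>R f (g x)) $ 1) = integral (g ` A) (\<lambda>x. f x $ 1)"
      using integral_component_eq_cart[OF set_lebesgue_integral_eq_integral(1)[OF cv(1)], of 1] cv(2)
        integral_component_eq_cart[OF set_lebesgue_integral_eq_integral(1)[OF \<open>f absolutely_integrable_on (g ` A)\<close>], of 1]
      by (simp only:)
    then show ?thesis by (simp add: f_def)
  qed
  have nn: "(\<integral>\<^sup>+ y \<in> B. ennreal (q y) \<partial>lborel) = ennreal (integral B q)"
    if "q absolutely_integrable_on B" "\<And>y. y \<in> B \<Longrightarrow> q y \<ge> 0" 
      "(\<lambda>y. indicator B y * q y) \<in> borel_measurable borel" for B :: "(real^2) set" and q :: "real^2 \<Rightarrow> real"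
  proof -
    have i: "integrable lborel (\<lambda>y. indicator B y * q y)"
      using that(1,3) by (simp add: set_integrable_def integrable_completion)
    have "(\<integral>\<^sup>+ y \<in> B. ennreal (q y) \<partial>lborel) = (\<integral>\<^sup>+ y. ennreal (indicator B y * q y) \<partial>lborel)"
      by (intro nn_integral_cong) (auto simp: indicator_def)
    also have "\<dots> = ennreal (\<integral> y. indicator B y * q y \<partial>lborel)"
      by (intro nn_integral_eq_integral i AE_I2) (use that(2) in \<open>auto simp: indicator_def\<close>)
    also have "(\<integral> y. indicator B y * q y \<partial>lborel) = (\<integral> y. indicator B y * q y \<partial>lebesgue)"
      using that(3) by (simp add: integral_completion)
    also have "\<dots> = integral B q"
      using set_lebesgue_integral_eq_integral(2)[OF that(1)] by (simp add: set_lebesgue_integral_def)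
    finally show ?thesis .
  qed
  show ?thesis
    using nn[OF cv1 _ m] nn[OF \<open>w absolutely_integrable_on (g ` A)\<close> _ w(1)] w(2) cv2 by auto
qed

section \<open>Independence of the parametrization, and integrals in a graph chart\<close>

context surface_graph
begin

text \<open>The passage from \<open>q\<close> to the graph chart is the explicit map
  \<open>g\<close>, the composition of \<open>q\<close> with the projection. It is injective since
  \<open>r (g y) = q y\<close>, and \<open>area_element_projection\<close> says that its Jacobian
  carries the area density of \<open>r\<close> to that of \<open>q\<close>.\<close>

lemma parametrization_area:
  assumes loc: "local_parametrization S U q" and B: "B \<in> sets borel" "B \<subseteq> q ` U" "B \<subseteq> C"
  shows "(\<integral>\<^sup>+ y \<in> {y\<in>U. q y \<in> B}. ennreal (area_element q y) \<partial>lborel) = emeasure pushed B"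
proof -
  have U: "open U" and q: "\<And>n. Ck_on n U q" and oi: "openin (top_of_set S) (q ` U)"
    and homeo: "\<exists>p. homeomorphism U (q ` U) q p"
    using loc by (auto simp: local_parametrization_def smooth_on_def simp del: Ck_on.simps)
  define A where "A = {y\<in>U. q y \<in> B}"
  define g where "g = (\<lambda>y. prj k (q y))"
  define g' where "g' = (\<lambda>y v. prj k (pd v q y))"
  have BS: "B \<subseteq> S" using B(2) oi openin_imp_subset by blast
  have phi_q: "\<phi> (q y) = 0" if "y \<in> U" for y
    using openin_imp_subset[OF oi] that by (auto simp: S_def)
  have inj_q: "inj_on q U" using homeo unfolding homeomorphism_def inj_on_def by metis
  have q': "q differentiable (at y)" if "y \<in> U" for y using q[of 1] that by simp
  have A_borel: "A \<in> sets borel"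
  proof -
    note local_parametrization_measurable(1)[OF loc]
    then have "(\<lambda>y. indicator U y *\<^sub>R q y) -` B \<inter> space borel \<in> sets borel"
      using B(1) by (rule measurable_sets)
    then have "((\<lambda>y. indicator U y *\<^sub>R q y) -` B \<inter> space borel) \<inter> U \<in> sets borel"
      by (rule sets.Int[OF _ borel_open[OF U]])
    moreover have "((\<lambda>y. indicator U y *\<^sub>R q y) -` B \<inter> space borel) \<inter> U = A"
      by (auto simp: A_def)
    ultimately show ?thesis by simp
  qed
  have gA: "g ` A = {y\<in>Y. r y \<in> B}"
  proof -
    have "g y \<in> Y \<and> r (g y) = q y" if "y \<in> A" for y
      using that B(3) prj_in r_prj phi_q unfolding g_def A_def by blast
    moreover have "\<exists>y'\<in>A. y = g y'" if y: "y \<in> Y" "r y \<in> B" for y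
    proof -
      obtain y' where "y' \<in> U" "r y = q y'" using y(2) B(2) by blast
      moreover from this have "prj k (q y') = y" by (metis prj_r)
      ultimately show ?thesis using y(2) by (intro bexI[of _ y']) (auto simp: g_def A_def)
    qed
    ultimately show ?thesis unfolding A_def by fastforce
  qed
  have r_g: "r (g y) = q y" if "y \<in> A" for y
      using that B(3) r_prj phi_q unfolding g_def A_def by blast
  have gA_borel: "g ` A \<in> sets borel"
  proof -
    have "rr -` B \<inter> space borel \<in> sets borel" using measurable_rr B(1) by (rule measurable_sets)
    then have "(rr -` B \<inter> space borel) \<inter> Y \<in> sets borel"
      by (rule sets.Int[OF _ borel_open[OF open_Y]])
    moreover have "(rr -` B \<inter> space borel) \<inter> Y = g ` A" unfolding gA by (auto simp: rr_def)
    ultimately show ?thesis by simp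
  qed
  have area: "\<bar>det (matrix (g' y))\<bar> * slope \<phi> k (r (g y)) = area_element q y" if "y \<in> A" for y
  proof -
    have y: "y \<in> U" "q y \<in> C" using that B(3) by (auto simp: A_def)
    show ?thesis
      using area_element_projection[OF q'[OF y(1)] U y(1) phi_q _ phi_k[OF y(2)]] smooth_phi[of 1] y(2)
      unfolding r_g[OF that] g'_def by simp
  qed
  note local_parametrization_measurable(2)[OF loc]
  then have "(\<lambda>y. indicator A y * (indicator U y *\<^sub>R area_element q y)) \<in> borel_measurable borel"
    using A_borel by measurable
  moreover have "(\<lambda>y. indicator A y * (indicator U y *\<^sub>R area_element q y)) 
     = (\<lambda>y. indicator A y * (\<bar>det (matrix (g' y))\<bar> * slope \<phi> k (r (g y))))"
  proof
    fix y show "indicator A y * (indicator U y *\<^sub>R area_element q y) 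
       = indicator A y * (\<bar>det (matrix (g' y))\<bar> * slope \<phi> k (r (g y)))"
      using area[of y] by (cases "y \<in> A") (auto simp: A_def)
  qed
  ultimately have m: "(\<lambda>y. indicator A y * (\<bar>det (matrix (g' y))\<bar> * slope \<phi> k (r (g y)))) \<in> borel_measurable borel"
    by simp
  have w: "(\<lambda>y. indicator (g ` A) y * slope \<phi> k (r y)) \<in> borel_measurable borel"
  proof -
    have "(\<lambda>y. indicator (g ` A) y * wt y) \<in> borel_measurable borel"
      using gA_borel by measurable
    moreover have "(\<lambda>y. indicator (g ` A) y * wt y) = (\<lambda>y. indicator (g ` A) y * slope \<phi> k (r y))"
      unfolding gA by (auto simp: wt_def indicator_def)
    ultimately show ?thesis by simp
  qed
  have "(\<integral>\<^sup>+ y \<in> A. ennreal (area_element q y) \<partial>lborel)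
      = (\<integral>\<^sup>+ y \<in> A. ennreal (\<bar>det (matrix (g' y))\<bar> * slope \<phi> k (r (g y))) \<partial>lborel)"
    by (intro nn_integral_cong) (use area in \<open>auto simp: indicator_def\<close>)
  also have "\<dots> = (\<integral>\<^sup>+ y \<in> g ` A. ennreal (slope \<phi> k (r y)) \<partial>lborel)"
  proof (rule nn_integral_change_of_variables[OF A_borel gA_borel _ _ _ w _ m])
    show "bounded (g ` A)" by (rule bounded_subset[OF bounded_Y]) (auto simp: gA)
    show "(g has_derivative g' y) (at y)" if "y \<in> A" for y
      unfolding g_def g'_def
      by (rule bounded_linear.has_derivative[OF bounded_linear_prj q'[unfolded frechet_derivative_works]])
        (use that in \<open>simp add: A_def\<close>)
    show "inj_on g A"
    proof (rule inj_onI)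
      fix y y' assume y: "y \<in> A" "y' \<in> A" "g y = g y'"
      then have "q y = q y'" using r_g by metis
      then show "y = y'" using y inj_q by (auto simp: A_def inj_on_def)
    qed
    show "0 \<le> slope \<phi> k (r y) \<and> slope \<phi> k (r y) \<le> M" if "y \<in> g ` A" for y
      using that slope_le[OF r_in] by (auto simp: gA slope_def)
  qed
  also have "\<dots> = (\<integral>\<^sup>+ y \<in> {y\<in>Y. r y \<in> B}. ennreal (area_element r y) \<partial>lborel)"
    unfolding gA by (intro nn_integral_cong) (auto simp: indicator_def area_element_r)
  finally show ?thesis unfolding A_def using emeasure_pushed[OF B(1)] by simp
qed

lemma surface_measure_pushed:
  assumes M: "is_surface_measure S N" and B: "B \<in> sets borel" "B \<subseteq> S \<inter> C"
  shows "emeasure N B = emeasure pushed B"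
  using M B parametrization emeasure_pushed[OF B(1)] unfolding is_surface_measure_def image_r[symmetric]
  by simp

lemma sets_S_Int_C: "S \<inter> C \<in> sets borel"
proof -
  have "closedin (top_of_set C) {x\<in>C. \<phi> x = 0}"
    using continuous_closedin_preimage_constant[OF Ck_on_continuous[OF smooth_phi], of 0] by simp
  then obtain T where "closed T" "{x\<in>C. \<phi> x = 0} = C \<inter> T" by (auto simp: closedin_closed)
  moreover have "{x\<in>C. \<phi> x = 0} = S \<inter> C" by (auto simp: S_def)
  ultimately show ?thesis using open_C by (metis borel_closed borel_open sets.Int)
qed

lemma pushed_outside: 
  assumes "B \<in> sets borel" shows "emeasure pushed B = emeasure pushed (B \<inter> (S \<inter> C))"
proof -
  have "(\<integral>\<^sup>+ y \<in> {y\<in>Y. r y \<in> B}. ennreal (area_element r y) \<partial>lborel) =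
     (\<integral>\<^sup>+ y \<in> {y\<in>Y. r y \<in> B \<inter> (S \<inter> C)}. ennreal (area_element r y) \<partial>lborel)"
    unfolding image_r[symmetric] by (intro nn_integral_cong) (auto simp: indicator_def)
  then show ?thesis using assms sets_S_Int_C by (simp add: emeasure_pushed)
qed

text \<open>Restricting \<open>N\<close> to the chart by an indicator density yields
  \<open>pushed\<close>, after which the density and image measure formulas compute the integral. By
  \<open>zero\<close>, the rest of the surface contributes nothing.\<close>

lemma surface_integral:
  assumes N: "is_surface_measure S N"
    and zero: "\<And>x. x \<in> S \<Longrightarrow> x \<notin> C \<Longrightarrow> f x = 0" and cont: "continuous_on Y (\<lambda>y. f (r y))"
  shows "(LINT x:S|N. f x) = (LINT y|lborel. wt y * f (r y))" (is ?eq)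
    and "integrable lborel (\<lambda>y. wt y * f (r y)) \<Longrightarrow> set_integrable N S f" (is "?i \<Longrightarrow> ?i'")
proof -
  have sN: "sets N = sets borel" using N by (simp add: is_surface_measure_def)
  define F where "F x = indicator (S \<inter> C) x * f x" for x :: "real^3"
  have ind: "indicator S x *\<^sub>R f x = indicator (S \<inter> C) x *\<^sub>R F x" for x
    using zero[of x] by (auto simp: F_def indicator_def)
  \<comment> \<open>Off the surface \<open>f\<close> is arbitrary. On \<open>S \<inter> C\<close> it
    agrees with \<open>f (r (prj k x))\<close>, which is continuous on all of
    \<open>C\<close>.\<close>
  have F_borel: "F \<in> borel_measurable borel"
  proof -
    have "continuous_on C (\<lambda>x. f (r (prj k x)))"
      by (rule continuous_on_compose2[OF cont]) (use prj_in in \<open>auto intro!: continuous_intros\<close>)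
    then have "(\<lambda>x. indicator C x *\<^sub>R f (r (prj k x))) \<in> borel_measurable borel"
      by (intro borel_measurable_continuous_on_indicator) (simp_all add: open_C)
    then have "(\<lambda>x. indicator (S \<inter> C) x * (indicator C x *\<^sub>R f (r (prj k x)))) \<in> borel_measurable borel"
      using sets_S_Int_C by measurable
    moreover have "(\<lambda>x. indicator (S \<inter> C) x * (indicator C x *\<^sub>R f (r (prj k x)))) = F"
      using r_prj by (auto simp: F_def indicator_def S_def)
    ultimately show ?thesis by simp
  qed
  have dens: "density N (\<lambda>x. ennreal (indicator (S \<inter> C) x)) = pushed"
  proof (rule measure_eqI)
    fix B assume "B \<in> sets (density N (\<lambda>x. ennreal (indicator (S \<inter> C) x)))"
    then have B: "B \<in> sets borel" by (simp add: sN)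
    have "emeasure (density N (\<lambda>x. ennreal (indicator (S \<inter> C) x))) B
       = (\<integral>\<^sup>+ x. ennreal (indicator (S \<inter> C) x) * indicator B x \<partial>N)"
      using B sets_S_Int_C by (intro emeasure_density) (simp_all add: sN measurable_cong_sets[OF sN refl])
    also have "\<dots> = (\<integral>\<^sup>+ x. indicator (B \<inter> (S \<inter> C)) x \<partial>N)"
      by (intro nn_integral_cong) (auto simp: indicator_def)
    also have "\<dots> = emeasure N (B \<inter> (S \<inter> C))"
      using B sets_S_Int_C sN by simp
    also have "\<dots> = emeasure pushed (B \<inter> (S \<inter> C))"
      using surface_measure_pushed[OF N sets.Int[OF B sets_S_Int_C]] by blast
    finally show "emeasure (density N (\<lambda>x. ennreal (indicator (S \<inter> C) x))) B = emeasure pushed B"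
      using pushed_outside[OF B] by simp
  qed (simp add: sN)
  have Fr: "wt y * F (rr y) = wt y * f (r y)" for y
    using r_in phi_r by (auto simp: wt_def F_def rr_def indicator_def S_def)
  have mN: "F \<in> borel_measurable N" "indicator (S \<inter> C) \<in> borel_measurable N"
    using F_borel sets_S_Int_C by (simp_all add: measurable_cong_sets[OF sN refl])
  have "(LINT x:S|N. f x) = (LINT x|N. indicator (S \<inter> C) x *\<^sub>R F x)"
    unfolding set_lebesgue_integral_def ind ..
  also have "\<dots> = (LINT x|density N (\<lambda>x. ennreal (indicator (S \<inter> C) x)). F x)"
    using mN by (intro integral_density[symmetric]) auto
  also have "\<dots> = (LINT y|density lborel (\<lambda>y. ennreal (wt y)). F (rr y))"
    unfolding dens pushed_def by (rule integral_distr) (use F_borel in measurable)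
  also have "\<dots> = (LINT y|lborel. wt y *\<^sub>R F (rr y))"
    using F_borel wt_nonneg by (intro integral_density) auto
  finally show ?eq by (simp add: Fr)
  have "set_integrable N S f \<longleftrightarrow> integrable N (\<lambda>x. indicator (S \<inter> C) x *\<^sub>R F x)"
    unfolding set_integrable_def ind ..
  also have "\<dots> \<longleftrightarrow> integrable (density N (\<lambda>x. ennreal (indicator (S \<inter> C) x))) F"
    using mN by (intro integrable_density[symmetric]) auto
  also have "\<dots> \<longleftrightarrow> integrable (density lborel (\<lambda>y. ennreal (wt y))) (\<lambda>y. F (rr y))"
    unfolding dens pushed_def by (rule integrable_distr_eq) (use F_borel in measurable)
  also have "\<dots> \<longleftrightarrow> integrable lborel (\<lambda>y. wt y *\<^sub>R F (rr y))"
    using F_borel wt_nonneg by (intro integrable_density) auto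
  finally show "?i \<Longrightarrow> ?i'" by (simp add: Fr)
qed

end

text \<open>Existence glues the pushforwards of the finitely many charts along a disjoint Borel
  decomposition; uniqueness holds because every piece lies in a single chart.\<close>

lemma ex1_surface_measure:
  fixes m :: nat
  assumes charts: "\<And>i. i < m \<Longrightarrow> graph_chart \<phi> (k i) (Y i) (C i) (h i) (M i)"
    and closed: "closed {x. \<phi> x = 0}" and cover: "{x. \<phi> x = 0} \<subseteq> (\<Union>i<m. C i)"
  shows "\<exists>!N. is_surface_measure {x. \<phi> x = 0} N"
proof -
  define S where "S = {x. \<phi> x = 0}"
  define E where "E i = S \<inter> C i - (\<Union>j<i. C j)" for i
  define N where "N i = surface_graph.pushed \<phi> (k i) (Y i) (h i)" for i
  have sg: "surface_graph \<phi> (k i) (Y i) (C i) (h i) (M i)" if "i < m" for i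
    using charts[OF that] by unfold_locales
  have S_def': "surface_graph.S \<phi> = S" if "i < m" for i
    using surface_graph.S_def[OF sg[OF that]] by (simp add: S_def)
  have open_C: "open (C i)" if "i < m" for i using surface_graph.open_C[OF sg[OF that]] .
  have sets_S: "S \<in> sets borel" using closed by (simp add: S_def)
  have sets_E: "E i \<in> sets borel" if "i < m" for i
    unfolding E_def using sets_S open_C that by (intro sets.Diff sets.Int sets.finite_UN) auto
  have E_sub: "E i \<subseteq> S \<inter> C i" for i by (auto simp: E_def)
  have E_un: "S = (\<Union>i<m. E i)"
  proof
    show "S \<subseteq> (\<Union>i<m. E i)"
    proof
      fix x assume x: "x \<in> S"
      then have ex: "\<exists>i. i < m \<and> x \<in> C i" using cover by (auto simp: S_def)
      define i where "i = (LEAST i. i < m \<and> x \<in> C i)"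
      have "i < m \<and> x \<in> C i" unfolding i_def by (rule LeastI_ex[OF ex])
      moreover have "x \<notin> C j" if "j < i" for j
        using not_less_Least[of j "\<lambda>i. i < m \<and> x \<in> C i"] that calculation by (auto simp: i_def[symmetric])
      ultimately show "x \<in> (\<Union>i<m. E i)" using x by (auto simp: E_def)
    qed
  qed (use E_sub in blast)
  have E_disj: "disjoint_family_on E {..<m}"
    unfolding disjoint_family_on_def
  proof (intro ballI impI)
    fix i j :: nat assume "i \<in> {..<m}" "j \<in> {..<m}" "i \<noteq> j"
    then consider "i < j" | "j < i" by linarith
    then show "E i \<inter> E j = {}" by cases (auto simp: E_def)
  qed
  have split: "emeasure L B = (\<Sum>i<m. emeasure L (B \<inter> E i))"
    if "sets L = sets borel" "B \<in> sets borel" "B \<subseteq> S" for L :: "(real^3) measure" and B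
  proof -
    have "(\<Sum>i<m. emeasure L (B \<inter> E i)) = emeasure L (\<Union>i<m. B \<inter> E i)"
    proof (rule sum_emeasure)
      show "disjoint_family_on (\<lambda>i. B \<inter> E i) {..<m}"
        using E_disj unfolding disjoint_family_on_def by blast
    qed (use that sets_E in auto)
    moreover have "(\<Union>i<m. B \<inter> E i) = B" using E_un that(3) by blast
    ultimately show ?thesis by simp
  qed
  define \<mu> where "\<mu> B = (\<Sum>i<m. emeasure (N i) (B \<inter> E i))" for B
  define L where "L = measure_of UNIV (sets borel) \<mu>"
  have sN: "sets (N i) = sets borel" if "i < m" for i
    unfolding N_def using surface_graph.sets_pushed[OF sg[OF that]] .
  have sL: "sets L = sets borel"
    using sets.sigma_sets_eq[of borel] by (simp add: L_def)
  have eL: "emeasure L B = \<mu> B" if "B \<in> sets borel" for B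
    unfolding L_def
  proof (rule emeasure_measure_of_sigma)
    show "sigma_algebra (UNIV :: (real^3) set) (sets borel)"
      using sets.sigma_algebra_axioms[of borel] by simp
    show "positive (sets borel) \<mu>" by (simp add: positive_def \<mu>_def)
    show "countably_additive (sets borel) \<mu>"
    proof (rule countably_additiveI)
      fix D :: "nat \<Rightarrow> (real^3) set" assume D: "range D \<subseteq> sets borel" "disjoint_family D"
      have "(\<Sum>n. \<mu> (D n)) = (\<Sum>i<m. \<Sum>n. emeasure (N i) (D n \<inter> E i))"
        unfolding \<mu>_def by (rule suminf_sum) simp
      also have "\<dots> = (\<Sum>i<m. emeasure (N i) (\<Union>n. D n \<inter> E i))"
      proof (rule sum.cong[OF refl])
        fix i assume "i \<in> {..<m}"
        then show "(\<Sum>n. emeasure (N i) (D n \<inter> E i)) = emeasure (N i) (\<Union>n. D n \<inter> E i)"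
          using D sN sets_E by (intro suminf_emeasure) (auto simp: disjoint_family_on_def)
      qed
      finally show "(\<Sum>n. \<mu> (D n)) = \<mu> (\<Union> (range D))" by (simp add: \<mu>_def)
    qed
  qed (use that in simp)
  have "is_surface_measure S L"
    unfolding is_surface_measure_def
  proof (intro conjI allI impI sL)
    have "- S \<inter> E i = {}" for i using E_sub by blast
    then show "emeasure L (- S) = 0" using sets_S by (subst eL) (auto simp: \<mu>_def borel_comp)
  next
    fix U q B assume "local_parametrization S U q \<and> B \<in> sets borel \<and> B \<subseteq> q ` U"
    then have q: "local_parametrization S U q" and B: "B \<in> sets borel" "B \<subseteq> q ` U" by auto
    have qS: "q ` U \<subseteq> S" using q openin_imp_subset unfolding local_parametrization_def by blast
    let ?P = "parametrized_area U q"
    note eP = emeasure_parametrized_area[OF q]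
    have "emeasure L B = (\<Sum>i<m. emeasure (N i) (B \<inter> E i))" using B by (simp add: eL \<mu>_def)
    \<comment> \<open>On each piece \<open>parametrization_area\<close> replaces the graph measure
      by the area of \<open>q\<close>; the pieces then add up because \<open>?P\<close> is a
      measure.\<close>
    also have "\<dots> = (\<Sum>i<m. emeasure ?P (B \<inter> E i))"
    proof (rule sum.cong[OF refl])
      fix i assume "i \<in> {..<m}"
      then have i: "i < m" by simp
      have "(\<integral>\<^sup>+ y \<in> {y\<in>U. q y \<in> B \<inter> E i}. ennreal (area_element q y) \<partial>lborel) = emeasure (N i) (B \<inter> E i)"
        unfolding N_def
        by (rule surface_graph.parametrization_area[OF sg[OF i]])
          (use q S_def'[OF i] B sets_E[OF i] E_sub in auto)
      then show "emeasure (N i) (B \<inter> E i) = emeasure ?P (B \<inter> E i)"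
        using eP B sets_E[OF i] by simp
    qed
    also have "\<dots> = emeasure ?P B"
      by (rule split[symmetric]) (use B qS in \<open>auto simp: parametrized_area_def\<close>)
    finally show "emeasure L B = (\<integral>\<^sup>+ y \<in> {y\<in>U. q y \<in> B}. ennreal (area_element q y) \<partial>lborel)"
      using eP B by simp
  qed
  moreover have "L1 = L2" if L1: "is_surface_measure S L1" and L2: "is_surface_measure S L2" for L1 L2
  proof (rule measure_eqI)
    have s: "sets L1 = sets borel" "sets L2 = sets borel" and z: "emeasure L1 (- S) = 0" "emeasure L2 (- S) = 0"
      using L1 L2 by (auto simp: is_surface_measure_def)
    then show "sets L1 = sets L2" by simp
    have *: "emeasure L' B = (\<Sum>i<m. emeasure (N i) (B \<inter> E i))"
      if L': "is_surface_measure S L'" and B: "B \<in> sets borel" for L' B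
    proof -
      have s: "sets L' = sets borel" and z: "emeasure L' (- S) = 0" using L' by (auto simp: is_surface_measure_def)
      \<comment> \<open>The definition gives no mass off the surface, so \<open>B\<close> may be cut
        down to it before splitting.\<close>
      have "AE x in L'. x \<notin> - S" by (rule AE_not_in) (use z s sets_S in \<open>simp add: null_sets_def borel_comp\<close>)
      then have "emeasure L' B = emeasure L' (B \<inter> S)"
        by (intro emeasure_eq_AE) (use s B sets_S in \<open>auto\<close>)
      also have "\<dots> = (\<Sum>i<m. emeasure L' (B \<inter> S \<inter> E i))"
        by (rule split) (use s B sets_S in auto)
      also have "\<dots> = (\<Sum>i<m. emeasure (N i) (B \<inter> E i))"
      proof (rule sum.cong[OF refl])
        fix i assume "i \<in> {..<m}"
        then have i: "i < m" by simp
        have "B \<inter> S \<inter> E i = B \<inter> E i" using E_sub by blast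
        then show "emeasure L' (B \<inter> S \<inter> E i) = emeasure (N i) (B \<inter> E i)"
          unfolding N_def using surface_graph.surface_measure_pushed[OF sg[OF i], of L' "B \<inter> E i"]
            L' S_def'[OF i] B sets_E[OF i] E_sub by fastforce
      qed
      finally show ?thesis .
    qed
    show "emeasure L1 B = emeasure L2 B" if "B \<in> sets L1" for B
      using *[OF L1] *[OF L2] that s by simp
  qed
  ultimately show ?thesis unfolding S_def by blast
qed

lemma surface_measure_works:
  assumes "\<exists>!N. is_surface_measure S N" shows "is_surface_measure S (surface_measure S)"
  unfolding surface_measure_def using assms by (rule theI')

section \<open>Differentiation of integrals with compact support\<close>

lemma Ck_on_Un:
  assumes "open S" "open T" "Ck_on k S f" "Ck_on k T f"
  shows "Ck_on k (S \<union> T) f"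
  using assms(3,4)
  by (induction k arbitrary: f) (auto intro: continuous_on_open_Un assms(1,2))

lemma integrable_compact_support:
  fixes F :: "'a::euclidean_space \<Rightarrow> real"
  assumes "compact K" "continuous_on UNIV F" "\<And>y. y \<notin> K \<Longrightarrow> F y = 0"
  shows "integrable lborel F"
proof -
  have "integrable lborel (\<lambda>y. indicator K y *\<^sub>R F y)"
    by (rule borel_integrable_compact[OF assms(1)]) (use assms(2) continuous_on_subset in blast)
  moreover have "(\<lambda>y. indicator K y *\<^sub>R F y) = F"
    using assms(3) by (auto simp: indicator_def fun_eq_iff)
  ultimately show ?thesis by simp
qed

lemma integral_lborel_cbox:
  fixes F :: "'a::euclidean_space \<Rightarrow> real"
  assumes "continuous_on UNIV F" "\<And>y. y \<notin> cbox a b \<Longrightarrow> F y = 0"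
  shows "(LINT y|lborel. F y) = integral (cbox a b) F"
proof -
  have "(\<lambda>y. indicator (cbox a b) y *\<^sub>R F y) = F"
    using assms(2) by (auto simp: indicator_def fun_eq_iff)
  moreover have "set_integrable lborel (cbox a b) F"
    unfolding set_integrable_def
    by (rule borel_integrable_compact) (use assms(1) continuous_on_subset in auto)
  ultimately show ?thesis
    using set_borel_integral_eq_integral(2)[of "cbox a b" F] by (simp add: set_lebesgue_integral_def)
qed

lemma continuous_on_slice:
  assumes "continuous_on (UNIV \<times> I) F" "s \<in> I"
  shows "continuous_on UNIV (\<lambda>y. F (y, s))"
  by (rule continuous_on_compose2[OF assms(1)]) (use assms(2) in \<open>auto intro!: continuous_intros\<close>)

lemma pd_zero_outside:
  assumes "\<And>y s. y \<notin> K \<Longrightarrow> s \<in> I \<Longrightarrow> Q (y, s) = 0" "compact K" "open I" "y \<notin> K" "s \<in> I"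
  shows "pd v Q (y, s) = (0::real)"
proof -
  have "pd v Q (y, s) = pd v (\<lambda>_. 0) (y, s)"
    by (rule pd_cong_open[of "(- K) \<times> I"])
      (use assms in \<open>auto intro!: open_Times simp: compact_imp_closed open_Compl\<close>)
  then show ?thesis by simp
qed

text \<open>A support bounded uniformly in \<open>s\<close> puts all integrals on one box, where the
  Leibniz rule applies.\<close>

lemma DERIV_integral_compact_support:
  fixes Q :: "'a::euclidean_space \<times> real \<Rightarrow> real"
  assumes Q: "Ck_on (Suc 0) (UNIV \<times> I) Q" and K: "compact K" and I: "open I" "s \<in> I"
    and zero: "\<And>y s. y \<notin> K \<Longrightarrow> s \<in> I \<Longrightarrow> Q (y, s) = 0"
  shows "((\<lambda>s. LINT y|lborel. Q (y, s)) has_real_derivative (LINT y|lborel. pd (0, 1) Q (y, s))) (at s)"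
proof -
  obtain a b where ab: "K \<subseteq> cbox a b" using bounded_subset_cbox_symmetric[OF compact_imp_bounded[OF K]] by metis
  obtain d where d: "d > 0" "ball s d \<subseteq> I" using I openE by blast
  have contQ: "continuous_on (UNIV \<times> I) Q" using Ck_on_continuous[OF Q] .
  have contpd: "continuous_on (UNIV \<times> I) (pd (0, 1) Q)"
    using Ck_on_continuous[OF Ck_on_pd[OF Q]] .
  have "((\<lambda>s. integral (cbox a b) (\<lambda>y. Q (y, s))) has_real_derivative 
      integral (cbox a b) (\<lambda>y. pd (0, 1) Q (y, s))) (at s within ball s d)"
  proof (rule leibniz_rule_field_derivative)
    show "((\<lambda>s. Q (y, s)) has_real_derivative pd (0, 1) Q (y, s')) (at s' within ball s d)"
      if "s' \<in> ball s d" for s' y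
      by (rule has_field_derivative_at_within[OF DERIV_snd]) (use Q d(2) that in auto)
    show "(\<lambda>y. Q (y, s')) integrable_on cbox a b" if "s' \<in> ball s d" for s'
      by (intro integrable_continuous continuous_on_subset[OF continuous_on_slice[OF contQ]])
        (use that d(2) in auto)
    show "continuous_on (ball s d \<times> cbox a b) (\<lambda>(s', y). pd (0, 1) Q (y, s'))"
      unfolding split_beta
      by (rule continuous_on_compose2[OF contpd]) (use d(2) in \<open>auto intro!: continuous_intros\<close>)
  qed (use d in auto)
  then have "((\<lambda>s. integral (cbox a b) (\<lambda>y. Q (y, s))) has_real_derivative 
      integral (cbox a b) (\<lambda>y. pd (0, 1) Q (y, s))) (at s)"
    using d(1) by (simp add: at_within_open[of s "ball s d"])
  moreover have "integral (cbox a b) (\<lambda>y. pd (0, 1) Q (y, s)) = (LINT y|lborel. pd (0, 1) Q (y, s))"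
  proof (rule integral_lborel_cbox[symmetric])
    show "continuous_on UNIV (\<lambda>y. pd (0, 1) Q (y, s))" by (rule continuous_on_slice[OF contpd I(2)])
    show "pd (0, 1) Q (y, s) = 0" if "y \<notin> cbox a b" for y
      by (rule pd_zero_outside[where K=K and I=I]) (use zero K I ab that in auto)
  qed
  ultimately have "((\<lambda>s. integral (cbox a b) (\<lambda>y. Q (y, s))) has_real_derivative 
      (LINT y|lborel. pd (0, 1) Q (y, s))) (at s)" by simp
  then show ?thesis
  proof (rule has_field_derivative_transform_within_open)
    show "integral (cbox a b) (\<lambda>y. Q (y, s')) = (LINT y|lborel. Q (y, s'))" if "s' \<in> ball s d" for s'
    proof (rule integral_lborel_cbox[symmetric])
      have s': "s' \<in> I" using that d(2) by blast
      show "continuous_on UNIV (\<lambda>y. Q (y, s'))" by (rule continuous_on_slice[OF contQ s'])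
      show "Q (y, s') = 0" if "y \<notin> cbox a b" for y using zero[OF _ s'] that ab by blast
    qed
  qed (use d(1) in auto)
qed

text \<open>Translating the integrand leaves its integral unchanged; differentiate in the translation.\<close>

lemma integral_pd_compact_support:
  fixes Q :: "'a::euclidean_space \<times> real \<Rightarrow> real"
  assumes Q: "Ck_on (Suc 0) (UNIV \<times> I) Q" and K: "compact K" and I: "open I" "s \<in> I"
    and zero: "\<And>y s. y \<notin> K \<Longrightarrow> s \<in> I \<Longrightarrow> Q (y, s) = 0"
  shows "(LINT y|lborel. pd (v, 0) Q (y, s)) = 0"
proof -
  define R where "R p = Q (fst p + snd p *\<^sub>R v, s)" for p :: "'a \<times> real"
  \<comment> \<open>A compact set containing the supports of all translates of the slice by
    \<open>\<tau> *\<^sub>R v\<close> with \<open>\<bar>\<tau>\<bar> \<le> 1\<close>.\<close>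
  define K' where "K' = (\<lambda>(y, \<tau>). y - \<tau> *\<^sub>R v) ` (K \<times> {-1..1})"
  have opn: "open (UNIV \<times> I)" using I(1) by (intro open_Times) auto
  have Q1: "(Q has_derivative (\<lambda>q. pd q Q (y, s))) (at (y, s))" for y
    using Ck_on_has_derivative[OF Q] I(2) by simp
  have R': "(R has_derivative (\<lambda>q. pd (fst q + snd q *\<^sub>R v, 0) Q (fst p + snd p *\<^sub>R v, s))) (at p)" for p
  proof -
    have "((\<lambda>p. (fst p + snd p *\<^sub>R v, s)) has_derivative (\<lambda>q. (fst q + snd q *\<^sub>R v, 0))) (at p)"
      by (auto intro!: derivative_eq_intros)
    from has_derivative_compose[OF this Q1] show ?thesis by (simp add: R_def[abs_def])
  qed
  have "Ck_on (Suc 0) (UNIV \<times> {-1<..<1}) R"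
  proof (rule Ck_on_SucI[OF _ R'])
    fix q :: "'a \<times> real"
    show "Ck_on 0 (UNIV \<times> {-1<..<1}) (\<lambda>x. pd (fst q + snd q *\<^sub>R v, 0) Q (fst x + snd x *\<^sub>R v, s))"
      unfolding Ck_on.simps
      by (rule continuous_on_compose2[OF Ck_on_continuous[OF Ck_on_pd[OF Q]]])
        (auto intro!: continuous_intros simp: I(2))
  qed (auto intro: open_Times)
  moreover have "compact K'"
    unfolding K'_def using K by (intro compact_continuous_image compact_Times)
      (auto intro!: continuous_intros simp: split_beta)
  moreover have "R (y, \<tau>) = 0" if "y \<notin> K'" "\<tau> \<in> {-1<..<1}" for y \<tau>
  proof -
    have "y + \<tau> *\<^sub>R v \<notin> K"
    proof
      assume "y + \<tau> *\<^sub>R v \<in> K"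
      then have "(y + \<tau> *\<^sub>R v) - \<tau> *\<^sub>R v \<in> K'"
        unfolding K'_def using that(2) by (intro image_eqI[of _ _ "(y + \<tau> *\<^sub>R v, \<tau>)"]) auto
      then show False using that(1) by simp
    qed
    then show ?thesis using zero I(2) by (simp add: R_def)
  qed
  ultimately have "((\<lambda>\<tau>. LINT y|lborel. R (y, \<tau>)) has_real_derivative (LINT y|lborel. pd (0, 1) R (y, 0))) (at 0)"
    by (intro DERIV_integral_compact_support) auto
  moreover have "(LINT y|lborel. R (y, \<tau>)) = (LINT y|lborel. Q (y, s))" for \<tau>
  proof -
    have cont: "continuous_on UNIV (\<lambda>y. Q (y, s))"
      using continuous_on_slice[OF Ck_on_continuous[OF Q] I(2)] .
    have "(LINT y|lborel. Q (y, s)) = (LINT y|distr lborel borel ((+) (\<tau> *\<^sub>R v)). Q (y, s))"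
      by (simp add: lborel_distr_plus)
    also have "\<dots> = (LINT y|lborel. Q (\<tau> *\<^sub>R v + y, s))"
      using borel_measurable_continuous_onI[OF cont] by (intro integral_distr) auto
    finally show ?thesis by (simp add: R_def add.commute)
  qed
  ultimately have "(LINT y|lborel. pd (0, 1) R (y, 0)) = 0"
    using DERIV_unique[OF _ DERIV_const[of "LINT y|lborel. Q (y, s)" "at 0"]] by simp
  moreover have "pd (0, 1) R (y, 0) = pd (v, 0) Q (y, s)" for y
    using frechet_eqI[OF R'[of "(y, 0)"], of "(0, 1)"] by simp
  ultimately show ?thesis by simp
qed

section \<open>Planar integrals of data given on an open set and supported in a compact part of
  it\<close>

definition zero_extension :: "'a set \<Rightarrow> ('a \<times> real \<Rightarrow> real) \<Rightarrow> 'a \<times> real \<Rightarrow> real" where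
  "zero_extension Y Q p = (if fst p \<in> Y then Q p else 0)"

text \<open>\<open>Y \<times> I\<close> and \<open>(- K) \<times> I\<close> are open and cover
  \<open>UNIV \<times> I\<close> because \<open>K \<subseteq> Y\<close>; the extension is
  \<open>Q\<close> on the former and 0 on the latter.\<close>

lemma Ck_on_zero_extension:
  fixes Q :: "'a::euclidean_space \<times> real \<Rightarrow> real"
  assumes Q: "Ck_on k (Y \<times> I) Q" and Y: "open Y" and I: "open I" and K: "compact K" "K \<subseteq> Y"
    and zero: "\<And>y s. y \<in> Y - K \<Longrightarrow> s \<in> I \<Longrightarrow> Q (y, s) = 0"
  shows "Ck_on k (UNIV \<times> I) (zero_extension Y Q)"
proof -
  have "Ck_on k (Y \<times> I) (zero_extension Y Q)"
    by (rule Ck_on_cong[OF _ _ Q]) (use Y I in \<open>auto simp: zero_extension_def intro: open_Times\<close>)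
  moreover have "Ck_on k ((- K) \<times> I) (zero_extension Y Q)"
    by (rule Ck_on_cong[OF _ _ Ck_on_const[of _ _ 0]])
      (use zero I K(1) in \<open>auto simp: zero_extension_def compact_imp_closed intro!: open_Times\<close>)
  ultimately have "Ck_on k (Y \<times> I \<union> (- K) \<times> I) (zero_extension Y Q)"
    by (intro Ck_on_Un open_Times Y I) (auto simp: K compact_imp_closed)
  moreover have "Y \<times> I \<union> (- K) \<times> I = UNIV \<times> I" using K(2) by auto
  ultimately show ?thesis by simp
qed

lemma pd_zero_extension:
  fixes Q :: "'a::euclidean_space \<times> real \<Rightarrow> real"
  assumes "open Y" "open I" "y \<in> Y" "s \<in> I"
  shows "pd v (zero_extension Y Q) (y, s) = pd v Q (y, s)"
  by (rule pd_cong_open[of "Y \<times> I"]) (use assms in \<open>auto simp: zero_extension_def intro: open_Times\<close>)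

lemma zero_extension_eq: "zero_extension Y Q (y, s) = indicator Y y * Q (y, s)"
  by (auto simp: zero_extension_def)

locale compact_support =
  fixes Q :: "'a::euclidean_space \<times> real \<Rightarrow> real" and Y I K
  assumes Q: "Ck_on (Suc 0) (Y \<times> I) Q" and Y: "open Y" and I: "open I" and K: "compact K" "K \<subseteq> Y"
    and zero: "\<And>y s. y \<in> Y - K \<Longrightarrow> s \<in> I \<Longrightarrow> Q (y, s) = 0"
begin

lemma ext: "Ck_on (Suc 0) (UNIV \<times> I) (zero_extension Y Q)"
  by (rule Ck_on_zero_extension[OF Q Y I K zero])

lemma ext_zero: "y \<notin> K \<Longrightarrow> s \<in> I \<Longrightarrow> zero_extension Y Q (y, s) = 0"
  using zero by (auto simp: zero_extension_def)

lemma pd_ext_zero: "y \<notin> K \<Longrightarrow> s \<in> I \<Longrightarrow> pd v (zero_extension Y Q) (y, s) = 0"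
  by (rule pd_zero_outside[where K=K and I=I]) (use ext_zero K I in auto)

lemma pd_ext: 
  assumes "s \<in> I" shows "pd v (zero_extension Y Q) (y, s) = indicator Y y * pd v Q (y, s)"
proof (cases "y \<in> Y")
  case True
  then show ?thesis using pd_zero_extension[OF Y I _ assms] by simp
next
  case False
  then have "y \<notin> K" using K(2) by blast
  then show ?thesis using pd_ext_zero[OF _ assms, of y v] False by simp
qed

lemma integrable_pd: "s \<in> I \<Longrightarrow> integrable lborel (\<lambda>y. indicator Y y * pd v Q (y, s))"
proof -
  assume s: "s \<in> I"
  have "integrable lborel (\<lambda>y. pd v (zero_extension Y Q) (y, s))"
    by (rule integrable_compact_support[OF K(1) continuous_on_slice[OF Ck_on_continuous[OF Ck_on_pd[OF ext]] s]])
      (rule pd_ext_zero[OF _ s])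
  then show ?thesis by (simp add: pd_ext[OF s])
qed

lemma DERIV_integral:
  assumes s: "s \<in> I"
  shows "((\<lambda>s. LINT y|lborel. indicator Y y * Q (y, s)) has_real_derivative 
     (LINT y|lborel. indicator Y y * pd (0, 1) Q (y, s))) (at s)"
  using DERIV_integral_compact_support[OF ext K(1) I s ext_zero] unfolding pd_ext[OF s] zero_extension_eq .

lemma integral_pd:
  assumes s: "s \<in> I"
  shows "(LINT y|lborel. indicator Y y * pd (v, 0) Q (y, s)) = 0"
  using integral_pd_compact_support[OF ext K(1) I s ext_zero] unfolding pd_ext[OF s] .

end

section \<open>Integrals over moving graphs\<close>

abbreviation dx :: "'n \<Rightarrow> ((real^'n) \<times> real \<Rightarrow> real) \<Rightarrow> (real^'n) \<times> real \<Rightarrow> real" where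
  "dx j F \<equiv> pd (axis j 1, 0) F"

abbreviation dt :: "('a::euclidean_space \<times> real \<Rightarrow> real) \<Rightarrow> 'a \<times> real \<Rightarrow> real" where
  "dt F \<equiv> pd (0, 1) F"

locale moving_chart =
  fixes \<Phi> :: "(real^3) \<times> real \<Rightarrow> real" and W k Y I C h
  assumes open_W: "open W" and open_Y: "open Y" and open_I: "open I" and open_C: "open C" and bounded_Y: "bounded Y"
    and C_I: "C \<times> I \<subseteq> W" and smooth_Phi: "\<And>n. Ck_on n W \<Phi>" and smooth_h: "\<And>n. Ck_on n (Y \<times> I) h"
    and Phi_k: "\<And>p. p \<in> C \<times> I \<Longrightarrow> dx k \<Phi> p \<noteq> 0"
    and graph_in: "\<And>y s. y \<in> Y \<Longrightarrow> s \<in> I \<Longrightarrow> emb k y (h (y, s)) \<in> C"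
    and prj_in: "\<And>x. x \<in> C \<Longrightarrow> prj k x \<in> Y"
    and level: "\<And>x s. x \<in> C \<Longrightarrow> s \<in> I \<Longrightarrow> \<Phi> (x, s) = 0 \<longleftrightarrow> x $ k = h (prj k x, s)"
begin

definition \<gamma> :: "(real^2) \<times> real \<Rightarrow> (real^3) \<times> real" where
  "\<gamma> p = (emb k (fst p) (h p), snd p)"

abbreviation g :: "3 \<Rightarrow> (real^3) \<times> real \<Rightarrow> real" where "g j \<equiv> dx j \<Phi>"

lemma gamma_in: "p \<in> Y \<times> I \<Longrightarrow> \<gamma> p \<in> C \<times> I"
  using graph_in by (auto simp: \<gamma>_def)

lemma Phi_gamma: "p \<in> Y \<times> I \<Longrightarrow> \<Phi> (\<gamma> p) = 0"
  using level[OF graph_in] by (auto simp: \<gamma>_def)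

lemma gamma_has_derivative:
  assumes "p \<in> Y \<times> I"
  shows "(\<gamma> has_derivative (\<lambda>q. (emb k (fst q) (pd q h p), snd q))) (at p)"
proof -
  have "((\<lambda>p. (fst p, h p)) has_derivative (\<lambda>q. (fst q, pd q h p))) (at p)"
    using Ck_on_has_derivative[OF smooth_h assms] by (auto intro!: derivative_eq_intros)
  from bounded_linear.has_derivative[OF bounded_linear_emb[of k] this]
  have "((\<lambda>p. emb k (fst p) (h p)) has_derivative (\<lambda>q. emb k (fst q) (pd q h p))) (at p)" by simp
  then show ?thesis
    unfolding \<gamma>_def[abs_def] by (auto intro!: derivative_eq_intros)
qed

lemma smooth_gamma: "Ck_on n (Y \<times> I) \<gamma>"
proof -
  have opn: "open (Y \<times> I)" using open_Y open_I by (rule open_Times)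
  have "bounded_linear (\<lambda>p :: (real^2) \<times> real. (emb k (fst p) 0, snd p))"
    using bounded_linear_compose[OF bounded_linear_emb[of k] bounded_linear_Pair[OF bounded_linear_fst bounded_linear_zero]]
    by (intro bounded_linear_Pair bounded_linear_snd) simp
  then have "Ck_on n (Y \<times> I) (\<lambda>p. (emb k (fst p) 0, snd p) + h p *\<^sub>R (axis k 1, 0))"
    by (intro Ck_on_add opn Ck_on_linear Ck_on_scaleR_const smooth_h)
  moreover have "(emb k (fst p) 0, snd p) + h p *\<^sub>R (axis k 1, 0) = \<gamma> p" for p
    by (simp add: \<gamma>_def emb_def)
  ultimately show ?thesis by simp
qed

lemma pd_gamma:
  assumes p: "p \<in> Y \<times> I" and F: "F differentiable (at (\<gamma> p))"
  shows "pd q (\<lambda>p. F (\<gamma> p)) p = pd (emb k (fst q) 0, snd q) F (\<gamma> p) + pd q h p * dx k F (\<gamma> p)"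
proof -
  have "pd q (\<lambda>p. F (\<gamma> p)) p = pd (emb k (fst q) (pd q h p), snd q) F (\<gamma> p)"
    using frechet_eqI[OF has_derivative_compose[OF gamma_has_derivative[OF p] F[unfolded frechet_derivative_works]]] .
  also have "(emb k (fst q) (pd q h p), snd q) = (emb k (fst q) 0, snd q) + pd q h p *\<^sub>R (axis k 1, 0)"
    by (simp add: emb_def)
  also have "pd \<dots> F (\<gamma> p) = pd (emb k (fst q) 0, snd q) F (\<gamma> p) + pd q h p * dx k F (\<gamma> p)"
    using F by (simp add: pd_add_direction pd_scaleR_direction del: scaleR_Pair)
  finally show ?thesis .
qed

text \<open>Implicit differentiation of \<open>\<Phi> (\<gamma> p) = 0\<close>.\<close>

lemma pd_h:
  assumes p: "p \<in> Y \<times> I"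
  shows "pd q h p = - pd (emb k (fst q) 0, snd q) \<Phi> (\<gamma> p) / g k (\<gamma> p)"
proof -
  have in_W: "\<gamma> p \<in> W" by (rule subsetD[OF C_I gamma_in[OF p]])
  have "pd q (\<lambda>p. \<Phi> (\<gamma> p)) p = pd q (\<lambda>_. 0) p"
    using pd_cong_open[OF open_Times[OF open_Y open_I] p, of "\<lambda>p. \<Phi> (\<gamma> p)" "\<lambda>_. 0" q] Phi_gamma by blast
  moreover have "pd q (\<lambda>p. \<Phi> (\<gamma> p)) p = pd (emb k (fst q) 0, snd q) \<Phi> (\<gamma> p) + pd q h p * g k (\<gamma> p)"
    using pd_gamma[OF p Ck_on_differentiable[OF smooth_Phi in_W], of q] .
  ultimately have "pd (emb k (fst q) 0, snd q) \<Phi> (\<gamma> p) + pd q h p * g k (\<gamma> p) = 0"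
    by (simp only: frechet_derivative_const)
  then have "pd q h p * g k (\<gamma> p) = - pd (emb k (fst q) 0, snd q) \<Phi> (\<gamma> p)" by linarith
  then show ?thesis using Phi_k[OF gamma_in[OF p]] nonzero_eq_divide_eq by blast
qed

lemma pd_divide_g:
  assumes "F differentiable (at p)" "p \<in> C \<times> I"
  shows "pd v (\<lambda>p. F p / g k p) p = (pd v F p * g k p - F p * pd v (g k) p) / (g k p)\<^sup>2"
proof -
  have "p \<in> W" using assms(2) C_I by blast
  then have "g k differentiable (at p)"
    by (rule Ck_on_differentiable[OF Ck_on_pd[OF smooth_Phi]])
  from has_derivative_divide[OF assms(1)[unfolded frechet_derivative_works] this[unfolded frechet_derivative_works] Phi_k[OF assms(2)]]
  have "pd v (\<lambda>p. F p / g k p) p = - F p * (inverse (g k p) * pd v (g k) p * inverse (g k p)) + pd v F p / g k p"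
    by (rule frechet_eqI)
  then show ?thesis using Phi_k[OF assms(2)] by (simp add: field_simps power2_eq_square)
qed

text \<open>Kept for a general direction \<open>q\<close> because it is needed for the two
  directions of the plane and for time. The derivative of \<open>h\<close> is eliminated by
  \<open>pd_h\<close>, so only derivatives of \<open>F\<close> and \<open>\<Phi>\<close>
  remain.\<close>

lemma pd_over_g:
  assumes p: "p \<in> Y \<times> I" and F: "F differentiable (at (\<gamma> p))"
  defines "v \<equiv> \<lambda>q. (emb k (fst q) 0, snd q)"
  shows "pd q (\<lambda>p. F (\<gamma> p) / g k (\<gamma> p)) p
    = (pd (v q) F (\<gamma> p) * g k (\<gamma> p) - F (\<gamma> p) * pd (v q) (g k) (\<gamma> p)) / (g k (\<gamma> p))\<^sup>2
      - pd (v q) \<Phi> (\<gamma> p) / g k (\<gamma> p) * ((dx k F (\<gamma> p) * g k (\<gamma> p) - F (\<gamma> p) * dx k (g k) (\<gamma> p)) / (g k (\<gamma> p))\<^sup>2)"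
proof -
  have pC: "\<gamma> p \<in> C \<times> I" by (rule gamma_in[OF p])
  then have "\<gamma> p \<in> W" by (rule subsetD[OF C_I])
  then have "(\<lambda>p. F p / g k p) differentiable (at (\<gamma> p))"
    by (rule differentiable_divide[OF F Ck_on_differentiable[OF Ck_on_pd[OF smooth_Phi]] Phi_k[OF pC]])
  from pd_gamma[OF p this, of q] show ?thesis
    by (simp add: pd_divide_g[OF F pC] pd_h[OF p] v_def)
qed

lemma compact_support_over_g:
  assumes D: "open D" "D \<subseteq> C \<times> I" "\<gamma> ` (Y \<times> I) \<subseteq> D" and w: "Ck_on (Suc 0) D w"
    and K: "compact K" "K \<subseteq> Y" and zero: "\<And>y s. y \<in> Y - K \<Longrightarrow> s \<in> I \<Longrightarrow> w (\<gamma> (y, s)) = 0"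
  shows "compact_support (\<lambda>p. w (\<gamma> p) / g k (\<gamma> p)) Y I K"
proof
  have "Ck_on (Suc 0) D (g k)"
    using Ck_on_subset[OF Ck_on_pd[OF smooth_Phi]] D(2) C_I by blast
  then have "Ck_on (Suc 0) D (\<lambda>p. w p / g k p)"
    using Phi_k D by (intro Ck_on_divide w) auto
  then show "Ck_on (Suc 0) (Y \<times> I) (\<lambda>p. w (\<gamma> p) / g k (\<gamma> p))"
    by (rule Ck_on_compose[OF open_Times[OF open_Y open_I] D(1) _ smooth_gamma]) (use D(3) in auto)
qed (use open_Y open_I K zero in auto)

text \<open>By tangency, \<open>div X / g\<^sub>k\<close> restricted to the graph is the planar divergence of the two
  horizontal components of \<open>X / g\<^sub>k\<close>.\<close>

lemma surface_divergence:
  assumes D: "open D" "D \<subseteq> C \<times> I" "\<gamma> ` (Y \<times> I) \<subseteq> D" and X: "\<And>j. Ck_on (Suc 0) D (X j)"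
    and tang: "\<And>p. p \<in> D \<Longrightarrow> (\<Sum>j\<in>UNIV. X j p * g j p) = 0"
    and K: "compact K" "K \<subseteq> Y" and zero: "\<And>j y s. y \<in> Y - K \<Longrightarrow> s \<in> I \<Longrightarrow> X j (\<gamma> (y, s)) = 0"
    and s: "s \<in> I"
  shows "(LINT y|lborel. indicator Y y * ((\<Sum>j\<in>UNIV. dx j (X j) (\<gamma> (y, s))) / g k (\<gamma> (y, s)))) = 0"
    and "integrable lborel (\<lambda>y. indicator Y y * ((\<Sum>j\<in>UNIV. dx j (X j) (\<gamma> (y, s))) / g k (\<gamma> (y, s))))"
proof -
  define Q where "Q j p = X j (\<gamma> p) / g k (\<gamma> p)" for j p
  define Dv where "Dv j v = pd v (X j)" for j v
  have cs: "compact_support (Q j) Y I K" for j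
    unfolding Q_def by (rule compact_support_over_g[OF D X K zero])
  have key: "dx 1 (Q (nx k)) (y, s) + dx 2 (Q (nx (nx k))) (y, s)
    = (\<Sum>j\<in>UNIV. dx j (X j) (\<gamma> (y, s))) / g k (\<gamma> (y, s))" if y: "y \<in> Y" for y
  proof -
    define p where "p = (y, s)"
    have p: "p \<in> Y \<times> I" using y s by (simp add: p_def)
    have pD: "\<gamma> p \<in> D" and pC: "\<gamma> p \<in> C \<times> I" and pW: "\<gamma> p \<in> W" using p D(2,3) C_I by auto
    have Xd: "X j differentiable (at (\<gamma> p))" for j using X[of j] pD by auto
    have gd: "g j differentiable (at (\<gamma> p))" for j
      by (rule Ck_on_differentiable[OF Ck_on_pd[OF smooth_Phi] pW])
    have sym: "dx k (g j) (\<gamma> p) = dx j (g k) (\<gamma> p)" for j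
      by (rule pd_commute[OF open_W smooth_Phi pW])
    \<comment> \<open>Tangency holds on an open set, so its derivative in direction \<open>k\<close>
      vanishes too. This accounts for the vertical derivatives that the slope of the graph brings
      into the planar divergence.\<close>
    have "0 = dx k (\<lambda>p. \<Sum>j\<in>UNIV. X j p * g j p) (\<gamma> p)"
      using pd_cong_open[OF D(1) pD, of "\<lambda>p. \<Sum>j\<in>UNIV. X j p * g j p" "\<lambda>_. 0" "(axis k 1, 0)"] tang by simp
    also have "\<dots> = (\<Sum>j\<in>UNIV. X j (\<gamma> p) * dx k (g j) (\<gamma> p) + dx k (X j) (\<gamma> p) * g j (\<gamma> p))"
      by (subst pd_sum) (use Xd gd in \<open>auto simp: pd_mult\<close>)
    finally have e1: "(\<Sum>j\<in>UNIV. X j (\<gamma> p) * dx j (g k) (\<gamma> p) + dx k (X j) (\<gamma> p) * g j (\<gamma> p)) = 0"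
      by (simp add: sym)
    note q1 = pd_over_g[OF p Xd[of "nx k"], of "(axis 1 1, 0)", unfolded fst_conv snd_conv emb_axis]
    note q2 = pd_over_g[OF p Xd[of "nx (nx k)"], of "(axis 2 1, 0)", unfolded fst_conv snd_conv emb_axis]
    \<comment> \<open>\<open>G\<close> is \<open>g k\<close>, the indices 1 and 2 are the two
      horizontal coordinates, \<open>a11\<close> and the like are derivatives of \<open>X\<close>,
      and \<open>b1\<close>, \<open>b2\<close>, \<open>bk\<close> those of \<open>g k\<close>.
      Treating \<open>inverse G\<close> as an unknown with \<open>G * inverse G = 1\<close> makes
      the claim polynomial.\<close>
    have alg: "(a11 * G - x1 * b1) / G\<^sup>2 - g1 / G * ((a1k * G - x1 * bk) / G\<^sup>2)
      + ((a22 * G - x2 * b2) / G\<^sup>2 - g2 / G * ((a2k * G - x2 * bk) / G\<^sup>2)) = (akk + a11 + a22) / G"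
      if "G \<noteq> 0" "xk * G + x1 * g1 + x2 * g2 = 0" 
        "(xk * bk + akk * G) + (x1 * b1 + a1k * g1) + (x2 * b2 + a2k * g2) = 0"
      for a11 a22 akk a1k a2k G x1 x2 xk b1 b2 bk g1 g2 :: real
    proof -
      have Gi: "G * inverse G = 1" using that(1) by simp
      have "(a11 * G - x1 * b1) * (inverse G)\<^sup>2 - g1 * inverse G * ((a1k * G - x1 * bk) * (inverse G)\<^sup>2)
        + ((a22 * G - x2 * b2) * (inverse G)\<^sup>2 - g2 * inverse G * ((a2k * G - x2 * bk) * (inverse G)\<^sup>2))
        = (akk + a11 + a22) * inverse G"
        using Gi that(2,3) by algebra
      then show ?thesis by (simp only: divide_inverse power_inverse)
    qed
    show ?thesis
      using q1 q2 alg[OF Phi_k[OF pC] tang[OF pD, unfolded sum_nx[of _ k]] e1[unfolded sum_nx[of _ k]]]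
      unfolding p_def[symmetric] sum_nx[of _ k] Q_def by simp
  qed
  have eq: "(\<lambda>y. indicator Y y * ((\<Sum>j\<in>UNIV. dx j (X j) (\<gamma> (y, s))) / g k (\<gamma> (y, s))))
    = (\<lambda>y. indicator Y y * dx 1 (Q (nx k)) (y, s) + indicator Y y * dx 2 (Q (nx (nx k))) (y, s))"
    using key by (auto simp: indicator_def fun_eq_iff)
  show "(LINT y|lborel. indicator Y y * ((\<Sum>j\<in>UNIV. dx j (X j) (\<gamma> (y, s))) / g k (\<gamma> (y, s)))) = 0"
    unfolding eq by (simp add: compact_support.integrable_pd[OF cs s] compact_support.integral_pd[OF cs s])
  show "integrable lborel (\<lambda>y. indicator Y y * ((\<Sum>j\<in>UNIV. dx j (X j) (\<gamma> (y, s))) / g k (\<gamma> (y, s))))"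
    unfolding eq by (intro Bochner_Integration.integrable_add compact_support.integrable_pd[OF cs s])
qed

text \<open>Differentiating along the graph gives the divergence of the vertical field
  \<open>- w \<Phi>\<^sub>t / g\<^sub>k\<close> in place of that of the normal field \<open>Z\<close>; their difference is tangential.\<close>

lemma time_derivative:
  assumes D: "open D" "D \<subseteq> C \<times> I" "\<gamma> ` (Y \<times> I) \<subseteq> D" and w: "Ck_on (Suc 0) D w"
    and K: "compact K" "K \<subseteq> Y" and zero: "\<And>y s. y \<in> Y - K \<Longrightarrow> s \<in> I \<Longrightarrow> w (\<gamma> (y, s)) = 0"
    and s: "s \<in> I"
  defines "Z \<equiv> \<lambda>j p. - (w p * dt \<Phi> p) * g j p / (\<Sum>i\<in>UNIV. g i p * g i p)"
  defines "L \<equiv> \<lambda>y. indicator Y y * ((dt w (\<gamma> (y, s)) + (\<Sum>j\<in>UNIV. dx j (Z j) (\<gamma> (y, s)))) / g k (\<gamma> (y, s)))"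
  shows "((\<lambda>s. LINT y|lborel. indicator Y y * (w (\<gamma> (y, s)) / g k (\<gamma> (y, s)))) has_real_derivative (LINT y|lborel. L y)) (at s)"
    and "integrable lborel L"
proof -
  define Q where "Q p = w (\<gamma> p) / g k (\<gamma> p)" for p
  define T where "T p = w p * dt \<Phi> p / g k p" for p
  \<comment> \<open>Tangential because \<open>Z\<close> and the vertical field with component
    \<open>- T\<close> have the same inner product \<open>- (w p * dt \<Phi> p)\<close> with the
    gradient.\<close>
  define X where "X j p = Z j p + (if j = k then T p else 0)" for j p
  have cs: "compact_support Q Y I K"
    unfolding Q_def by (rule compact_support_over_g[OF D w K zero])
  have smooth: "Ck_on (Suc 0) D (pd v \<Phi>)" for v
    using Ck_on_subset[OF Ck_on_pd[OF smooth_Phi]] D(2) C_I by blast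
  have sq: "(\<Sum>i\<in>UNIV. g i p * g i p) > 0" if "p \<in> D" for p
  proof -
    have "g k p * g k p > 0" using Phi_k[of p] D(2) that not_real_square_gt_zero by blast
    also have "g k p * g k p \<le> (\<Sum>i\<in>UNIV. g i p * g i p)"
      by (rule member_le_sum) auto
    finally show ?thesis .
  qed
  have ZC: "Ck_on (Suc 0) D (Z j)" for j
    unfolding Z_def by (intro Ck_on_divide Ck_on_mult Ck_on_minus Ck_on_sum D(1) w smooth) (use sq in force)
  have TC: "Ck_on (Suc 0) D T"
    unfolding T_def[abs_def] by (intro Ck_on_divide Ck_on_mult D(1) w smooth) (use Phi_k D(2) in auto)
  have X_eq: "X j = (if j = k then (\<lambda>p. Z j p + T p) else Z j)" for j by (auto simp: X_def)
  have XC: "Ck_on (Suc 0) D (X j)" for j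
    unfolding X_eq using ZC[of j] Ck_on_add[OF D(1) ZC TC, of j] by (cases "j = k") (simp_all del: Ck_on.simps)
  have tang: "(\<Sum>j\<in>UNIV. X j p * g j p) = 0" if "p \<in> D" for p
  proof -
    have "(\<Sum>j\<in>UNIV. Z j p * g j p) = - (w p * dt \<Phi> p) / (\<Sum>i\<in>UNIV. g i p * g i p) * (\<Sum>j\<in>UNIV. g j p * g j p)"
      unfolding sum_distrib_left by (rule sum.cong[OF refl]) (simp add: Z_def)
    also have "\<dots> = - (w p * dt \<Phi> p)" using sq[OF that] by simp
    finally have "(\<Sum>j\<in>UNIV. Z j p * g j p) = - (w p * dt \<Phi> p)" .
    moreover have "(\<Sum>j\<in>UNIV. (if j = k then T p else 0) * g j p) = w p * dt \<Phi> p"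
      using Phi_k[of p] D(2) that by (auto simp: T_def if_distrib[of "\<lambda>x. x * _"] cong: if_cong)
    ultimately show ?thesis by (simp add: X_def distrib_right sum.distrib)
  qed
  have X0: "X j (\<gamma> (y, s)) = 0" if "y \<in> Y - K" "s \<in> I" for j y s
    using zero[OF that] by (simp add: X_def Z_def T_def)
  note div = surface_divergence[OF D XC tang K X0 s]
  have key: "L y = indicator Y y * dt Q (y, s) 
     + indicator Y y * ((\<Sum>j\<in>UNIV. dx j (X j) (\<gamma> (y, s))) / g k (\<gamma> (y, s)))" for y
  proof (cases "y \<in> Y")
    case True
    define p where "p = (y, s)"
    have p: "p \<in> Y \<times> I" using True s by (simp add: p_def)
    have pD: "\<gamma> p \<in> D" and pC: "\<gamma> p \<in> C \<times> I" and pW: "\<gamma> p \<in> W" using p D(2,3) C_I by auto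
    have wd: "w differentiable (at (\<gamma> p))" and Zd: "Z j differentiable (at (\<gamma> p))"
      and Td: "T differentiable (at (\<gamma> p))" for j
      using w ZC[of j] TC pD by auto
    have gd: "pd v \<Phi> differentiable (at (\<gamma> p))" for v
      by (rule Ck_on_differentiable[OF Ck_on_pd[OF smooth_Phi] pW])
    have sym: "dx k (dt \<Phi>) (\<gamma> p) = dt (g k) (\<gamma> p)"
      by (rule pd_commute[OF open_W smooth_Phi pW])
    have divX: "(\<Sum>j\<in>UNIV. dx j (X j) (\<gamma> p)) = (\<Sum>j\<in>UNIV. dx j (Z j) (\<gamma> p)) + dx k T (\<gamma> p)"
    proof -
      have "dx j (X j) (\<gamma> p) = dx j (Z j) (\<gamma> p) + (if j = k then dx k T (\<gamma> p) else 0)" for j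
        unfolding X_eq using pd_add[OF Zd Td] by simp
      then show ?thesis by (simp add: sum.distrib)
    qed
    have wTd: "(\<lambda>p. w p * dt \<Phi> p) differentiable (at (\<gamma> p))" using wd gd by simp
    have T': "dx k T (\<gamma> p) = ((w (\<gamma> p) * dt (g k) (\<gamma> p) + dx k w (\<gamma> p) * dt \<Phi> (\<gamma> p)) * g k (\<gamma> p)
        - w (\<gamma> p) * dt \<Phi> (\<gamma> p) * dx k (g k) (\<gamma> p)) / (g k (\<gamma> p))\<^sup>2"
      unfolding T_def[abs_def] pd_divide_g[OF wTd pC] pd_mult[OF wd gd] sym ..
    note Q' = pd_over_g[OF p wd, of "(0, 1)", unfolded fst_conv snd_conv emb_axis scaleR_zero_left, folded Q_def]
    have alg: "(wt * G - w * gt) / G\<^sup>2 - ft / G * ((wk * G - w * gk) / G\<^sup>2) 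
        + (zz + ((w * gt + wk * ft) * G - w * ft * gk) / G\<^sup>2) / G = (wt + zz) / G"
      if "G \<noteq> 0" for wt G w gt ft wk gk zz :: real
    proof -
      have Gi: "G * inverse G = 1" using that by simp
      have "(wt * G - w * gt) * (inverse G)\<^sup>2 - ft * inverse G * ((wk * G - w * gk) * (inverse G)\<^sup>2) 
        + (zz + ((w * gt + wk * ft) * G - w * ft * gk) * (inverse G)\<^sup>2) * inverse G = (wt + zz) * inverse G"
        using Gi by algebra
      then show ?thesis by (simp only: divide_inverse power_inverse)
    qed
    have "dt Q p + (\<Sum>j\<in>UNIV. dx j (X j) (\<gamma> p)) / g k (\<gamma> p)
       = (dt w (\<gamma> p) + (\<Sum>j\<in>UNIV. dx j (Z j) (\<gamma> p))) / g k (\<gamma> p)"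
      unfolding divX T' Q' by (rule alg[OF Phi_k[OF pC]])
    then show ?thesis using True by (simp add: L_def p_def)
  qed (simp add: L_def)
  show "integrable lborel L"
    unfolding key[abs_def] by (intro Bochner_Integration.integrable_add compact_support.integrable_pd[OF cs s] div(2))
  have "(LINT y|lborel. L y) = (LINT y|lborel. indicator Y y * dt Q (y, s))"
    unfolding key using div by (simp add: compact_support.integrable_pd[OF cs s])
  then show "((\<lambda>s. LINT y|lborel. indicator Y y * (w (\<gamma> (y, s)) / g k (\<gamma> (y, s)))) has_real_derivative (LINT y|lborel. L y)) (at s)"
    using compact_support.DERIV_integral[OF cs s] by (simp add: Q_def)
qed

end

section \<open>Charts of a moving level set\<close>

lemma pd_slice:
  assumes "F differentiable (at (x, s))"
  shows "pd v (\<lambda>x. F (x, s)) x = pd (v, 0) F (x, s)"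
proof -
  have "((\<lambda>x. (x, s)) has_derivative (\<lambda>v. (v, 0))) (at x)"
    by (auto intro!: derivative_eq_intros)
  from has_derivative_compose[OF this assms[unfolded frechet_derivative_works]]
  show ?thesis by (rule frechet_eqI)
qed

lemma Ck_on_slice:
  fixes F :: "'a::euclidean_space \<times> real \<Rightarrow> real"
  assumes "open S" "open V" "Ck_on n V F" "\<And>x. x \<in> S \<Longrightarrow> (x, s) \<in> V"
  shows "Ck_on n S (\<lambda>x. F (x, s))"
  by (rule Ck_on_compose[OF assms(1-3) Ck_on_Pair_real[OF assms(1) Ck_on_const[OF assms(1)]] assms(4)])

text \<open>The factor \<open>\<rho>\<close> of the overview, as a function on space-time so that it
  can also be differentiated in time. It is not the speed of the surface, which is
  \<open>vel\<close> below.\<close>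

definition level_speed :: "((real^3) \<times> real \<Rightarrow> real) \<Rightarrow> (real^3) \<times> real \<Rightarrow> real" where
  "level_speed \<Phi> p = sqrt (\<Sum>i\<in>UNIV. dx i \<Phi> p * dx i \<Phi> p)"

lemma norm_grad_slice:
  assumes "\<Phi> differentiable (at (x, s))"
  shows "norm (grad (\<lambda>x. \<Phi> (x, s)) x) = level_speed \<Phi> (x, s)"
  by (simp add: norm_eq_sqrt_inner inner_vec_def grad_nth pd_slice[OF assms] level_speed_def)

lemma slope_slice:
  assumes "\<Phi> differentiable (at (x, s))"
  shows "slope (\<lambda>x. \<Phi> (x, s)) k x = level_speed \<Phi> (x, s) / \<bar>dx k \<Phi> (x, s)\<bar>"
  by (simp add: slope_def norm_grad_slice[OF assms] pd_slice[OF assms])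

text \<open>The implicit function theorem with \<open>(y, s)\<close> as parameters and coordinate
  \<open>k\<close> as the unknown, so that the height is smooth in space and time jointly. The sign
  \<open>\<sigma>\<close> makes the derivative positive and later lets absolute values be
  dropped.\<close>

lemma exists_moving_chart:
  fixes \<Phi> :: "(real^3) \<times> real \<Rightarrow> real"
  assumes T: "open T" and smooth: "\<And>n. Ck_on n (UNIV \<times> T) \<Phi>" and t: "t \<in> T"
    and zero: "\<Phi> (x0, t) = 0" and nz: "dx k \<Phi> (x0, t) \<noteq> 0"
  shows "\<exists>Y I C h M \<sigma>. moving_chart \<Phi> (UNIV \<times> T) k Y I C h \<and> x0 \<in> C \<and> t \<in> I \<and>
     (\<forall>p\<in>C \<times> I. \<bar>dx k \<Phi> p\<bar> = \<sigma> * dx k \<Phi> p) \<and>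
     (\<forall>p\<in>C \<times> I. level_speed \<Phi> p \<le> M * \<bar>dx k \<Phi> p\<bar>)"
proof -
  define \<sigma> where "\<sigma> = sgn (dx k \<Phi> (x0, t))"
  have \<sigma>: "\<sigma> = 1 \<or> \<sigma> = -1" using nz by (auto simp: \<sigma>_def sgn_if)
  define G where "G p = \<sigma> * dx k \<Phi> p" for p
  \<comment> \<open>One more than the slope at the base point, so that the strict inequality
    defining the open set \<open>W'\<close> holds there.\<close>
  define M where "M = level_speed \<Phi> (x0, t) / G (x0, t) + 1"
  have G0: "G (x0, t) > 0" using nz by (simp add: G_def \<sigma>_def sgn_if)
  have opn: "open (UNIV \<times> T :: ((real^3) \<times> real) set)" using T by (simp add: open_Times)
  define W' where "W' = {p \<in> UNIV \<times> T. G p > 0 \<and> M * G p - level_speed \<Phi> p > 0}"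
  have cont_pd: "continuous_on (UNIV \<times> T) (pd v \<Phi>)" for v
    using Ck_on_continuous[OF Ck_on_pd[OF smooth]] .
  have cont_G: "continuous_on (UNIV \<times> T) G" unfolding G_def by (intro continuous_intros cont_pd)
  have cont_S: "continuous_on (UNIV \<times> T) (level_speed \<Phi>)"
    unfolding level_speed_def by (intro continuous_intros cont_pd)
  have open_W': "open W'"
  proof -
    have "open ({p \<in> UNIV \<times> T. G p \<in> {0<..}} \<inter> {p \<in> UNIV \<times> T. M * G p - level_speed \<Phi> p \<in> {0<..}})"
      by (intro open_Int continuous_open_preimage[unfolded vimage_def Int_def, simplified] 
          continuous_intros cont_G cont_S opn open_greaterThan)
    moreover have "{p \<in> UNIV \<times> T. G p \<in> {0<..}} \<inter> {p \<in> UNIV \<times> T. M * G p - level_speed \<Phi> p \<in> {0<..}} = W'"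
      by (auto simp: W'_def)
    ultimately show ?thesis by simp
  qed
  \<comment> \<open>Rearranges \<open>((y, s), z)\<close>, where the unknown comes last, into a
    point of space and a time.\<close>
  define B where "B w = (emb k (fst (fst w)) (snd w), snd (fst w))" for w :: "((real^2) \<times> real) \<times> real"
  have lin_B: "bounded_linear B"
  proof -
    have "bounded_linear (\<lambda>w :: ((real^2) \<times> real) \<times> real. (fst (fst w), snd w))"
      by (intro bounded_linear_Pair bounded_linear_snd bounded_linear_compose[OF bounded_linear_fst bounded_linear_fst])
    from bounded_linear_compose[OF bounded_linear_emb[of k] this] show ?thesis
      unfolding B_def[abs_def]
      by (intro bounded_linear_Pair bounded_linear_compose[OF bounded_linear_snd bounded_linear_fst]) simp
  qed
  define V where "V = B -` W'"
  have open_V: "open V"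
    unfolding V_def using open_W' linear_continuous_on[OF lin_B, of UNIV] by (simp add: open_vimage)
  define F where "F w = \<sigma> * \<Phi> (B w)" for w
  have V_T: "B w \<in> UNIV \<times> T" if "w \<in> V" for w using that by (auto simp: V_def W'_def)
  have smooth_F: "Ck_on n V F" for n
    unfolding F_def[abs_def]
    by (intro Ck_on_mult Ck_on_const open_V Ck_on_compose[OF open_V opn smooth Ck_on_linear[OF open_V lin_B] V_T])
  have pd_F: "dt F w = G (B w)" if "w \<in> V" for w
  proof -
    have "\<Phi> differentiable (at (B w))" using Ck_on_differentiable[OF smooth V_T[OF that]] .
    from has_derivative_compose[OF bounded_linear_imp_has_derivative[OF lin_B] this[unfolded frechet_derivative_works]]
    have "(F has_derivative (\<lambda>v. \<sigma> * pd (B v) \<Phi> (B w))) (at w)"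
      unfolding F_def[abs_def] by (intro has_derivative_mult_right) 
    from frechet_eqI[OF this, of "(0, 1)"] show ?thesis by (simp add: G_def B_def emb_axis)
  qed
  have 0: "((prj k x0, t), x0 $ k) \<in> V" "F ((prj k x0, t), x0 $ k) = 0"
    using zero t G0 by (auto simp: V_def W'_def B_def F_def emb_prj M_def field_simps)
  have pos: "dt F w > 0" if "w \<in> V" for w
    using pd_F[OF that] that by (simp add: V_def W'_def)
  show ?thesis
  proof (rule implicit_function[OF open_V smooth_F 0 pos])
    fix e \<eta> h assume e: "e > 0" "\<eta> > 0"
      "\<And>w z. w \<in> ball (prj k x0, t) e \<Longrightarrow> \<bar>z - x0 $ k\<bar> \<le> \<eta> \<Longrightarrow> (w, z) \<in> V"
      "\<And>w. w \<in> ball (prj k x0, t) e \<Longrightarrow> \<bar>h w - x0 $ k\<bar> < \<eta>"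
      "\<And>w z. w \<in> ball (prj k x0, t) e \<Longrightarrow> \<bar>z - x0 $ k\<bar> < \<eta> \<Longrightarrow> F (w, z) = 0 \<longleftrightarrow> z = h w"
      "\<And>n. Ck_on n (ball (prj k x0, t) e) h"
    define Y where "Y = ball (prj k x0) (e/2)"
    define I where "I = ball t (e/2)"
    define C where "C = {x. prj k x \<in> Y} \<inter> {x. \<bar>x $ k - x0 $ k\<bar> < \<eta>}"
    have YI: "Y \<times> I \<subseteq> ball (prj k x0, t) e"
    proof
      fix w assume "w \<in> Y \<times> I"
      then have "dist (prj k x0) (fst w) < e/2" "dist t (snd w) < e/2" by (auto simp: Y_def I_def)
      moreover have "dist (prj k x0, t) w \<le> dist (prj k x0) (fst w) + dist t (snd w)"
        by (cases w) (simp add: dist_Pair_Pair sqrt_sum_squares_le_sum)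
      ultimately show "w \<in> ball (prj k x0, t) e" by simp
    qed
    have CI: "p \<in> W'" if "p \<in> C \<times> I" for p
    proof -
      define x s where "x = fst p" and "s = snd p"
      then have p: "p = (x, s)" "x \<in> C" "s \<in> I" using that by auto
      then have "((prj k x, s), x $ k) \<in> V"
        by (intro e(3)) (use YI in \<open>auto simp: C_def\<close>)
      then show ?thesis by (simp add: V_def B_def emb_prj p(1))
    qed
    have "moving_chart \<Phi> (UNIV \<times> T) k Y I C h"
    proof
      show "open C"
      proof -
        have "open {x. prj k x \<in> Y}"
          using open_vimage[of Y "prj k"] linear_continuous_on[OF bounded_linear_prj, of UNIV] by (simp add: Y_def vimage_def)
        moreover have "open {x :: real^3. \<bar>x $ k - x0 $ k\<bar> < \<eta>}"
          by (intro open_Collect_less continuous_intros)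
        ultimately show ?thesis unfolding C_def by (rule open_Int)
      qed
      show "C \<times> I \<subseteq> UNIV \<times> T" using CI by (auto simp: W'_def)
      show "Ck_on n (Y \<times> I) h" for n by (rule Ck_on_subset[OF e(6) YI])
      show "dx k \<Phi> p \<noteq> 0" if "p \<in> C \<times> I" for p
        using CI[OF that] by (auto simp: W'_def G_def)
      show "emb k y (h (y, s)) \<in> C" if "y \<in> Y" "s \<in> I" for y s
        using that e(4)[of "(y, s)"] YI by (auto simp: C_def)
      show "prj k x \<in> Y" if "x \<in> C" for x using that by (simp add: C_def)
      show "\<Phi> (x, s) = 0 \<longleftrightarrow> x $ k = h (prj k x, s)" if "x \<in> C" "s \<in> I" for x s
      proof -
        have "F ((prj k x, s), x $ k) = 0 \<longleftrightarrow> x $ k = h (prj k x, s)"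
          using that YI by (intro e(5)) (auto simp: C_def)
        then show ?thesis using \<sigma> by (auto simp: F_def B_def emb_prj)
      qed
    qed (use smooth opn in \<open>simp_all add: Y_def I_def del: Ck_on.simps\<close>)
    moreover have "x0 \<in> C" "t \<in> I" using e by (auto simp: C_def Y_def I_def)
    moreover have "\<bar>dx k \<Phi> p\<bar> = \<sigma> * dx k \<Phi> p" if "p \<in> C \<times> I" for p
      using CI[OF that] \<sigma> by (auto simp: W'_def G_def)
    moreover have "level_speed \<Phi> p \<le> M * \<bar>dx k \<Phi> p\<bar>" if "p \<in> C \<times> I" for p
      using CI[OF that] calculation(4)[OF that] by (simp add: W'_def G_def)
    ultimately show ?thesis by blast
  qed
qed

lemma moving_chart_subset:
  assumes "moving_chart \<Phi> W k Y I C h" "open J" "J \<subseteq> I"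
  shows "moving_chart \<Phi> W k Y J C h"
proof -
  interpret moving_chart \<Phi> W k Y I C h by (rule assms(1))
  show ?thesis
  proof
    show "C \<times> J \<subseteq> W" using C_I assms(3) by blast
    show "Ck_on n (Y \<times> J) h" for n by (rule Ck_on_subset[OF smooth_h]) (use assms(3) in blast)
    show "dx k \<Phi> p \<noteq> 0" if "p \<in> C \<times> J" for p using Phi_k[of p] that assms(3) by blast
    show "emb k y (h (y, s)) \<in> C" if "y \<in> Y" "s \<in> J" for y s using graph_in that assms(3) by blast
    show "\<Phi> (x, s) = 0 \<longleftrightarrow> x $ k = h (prj k x, s)" if "x \<in> C" "s \<in> J" for x s
      using level that assms(3) by blast
  qed (use open_W open_Y open_C bounded_Y smooth_Phi assms(2) prj_in in \<open>simp_all del: Ck_on.simps\<close>)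
qed

lemma (in moving_chart) graph_chart_slice:
  assumes s: "s \<in> I" and M: "\<And>p. p \<in> C \<times> I \<Longrightarrow> level_speed \<Phi> p \<le> M * \<bar>dx k \<Phi> p\<bar>"
  shows "graph_chart (\<lambda>x. \<Phi> (x, s)) k Y C (\<lambda>y. h (y, s)) M"
  unfolding graph_chart_def
proof (intro conjI allI ballI)
  show "Ck_on n Y (\<lambda>y. h (y, s))" for n
    by (rule Ck_on_slice[OF open_Y open_Times[OF open_Y open_I] smooth_h]) (use s in simp)
  show "Ck_on n C (\<lambda>x. \<Phi> (x, s))" for n
    by (rule Ck_on_slice[OF open_C open_W smooth_Phi]) (use s C_I in blast)
  show "pd (axis k 1) (\<lambda>x. \<Phi> (x, s)) x \<noteq> 0" "slope (\<lambda>x. \<Phi> (x, s)) k x \<le> M" if "x \<in> C" for x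
  proof -
    have xs: "(x, s) \<in> C \<times> I" using that s by simp
    have d: "\<Phi> differentiable (at (x, s))"
      by (rule Ck_on_differentiable[OF smooth_Phi subsetD[OF C_I xs]])
    show "pd (axis k 1) (\<lambda>x. \<Phi> (x, s)) x \<noteq> 0" using Phi_k[OF xs] by (simp add: pd_slice[OF d])
    show "slope (\<lambda>x. \<Phi> (x, s)) k x \<le> M"
      using M[OF xs] Phi_k[OF xs] by (simp add: slope_slice[OF d] pos_divide_le_eq)
  qed
qed (use open_Y bounded_Y open_C graph_in s prj_in level in auto)

section \<open>Surface integrals over the whole level set\<close>

text \<open>With the normal speed \<open>V = - \<Phi>\<^sub>t / \<bar>\<nabla>\<Phi>\<bar>\<close> the flux is \<open>w V n\<close>.\<close>

definition flux :: "((real^3) \<times> real \<Rightarrow> real) \<Rightarrow> ((real^3) \<times> real \<Rightarrow> real) \<Rightarrow> 3 \<Rightarrow> (real^3) \<times> real \<Rightarrow> real" where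
  "flux \<Phi> w j p = - (w p * dt \<Phi> p) * dx j \<Phi> p
     / (\<Sum>i\<in>UNIV. dx i \<Phi> p * dx i \<Phi> p)"

text \<open>The numerator \<open>w_t + div (w V n)\<close> in the derivative of
  \<open>\<integral> w / \<rho> d\<sigma>\<close>. Being linear in \<open>w\<close>, it is
  compatible with a partition of unity.\<close>

definition variation :: "((real^3) \<times> real \<Rightarrow> real) \<Rightarrow> ((real^3) \<times> real \<Rightarrow> real) \<Rightarrow> (real^3) \<times> real \<Rightarrow> real" where
  "variation \<Phi> w p = dt w p + (\<Sum>j\<in>UNIV. dx j (flux \<Phi> w j) p)"

lemma integrable_indicator_compact_support:
  fixes F :: "'a::euclidean_space \<Rightarrow> real"
  assumes "continuous_on Y F" "compact K" "K \<subseteq> Y" "\<And>y. y \<in> Y - K \<Longrightarrow> F y = 0"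
  shows "integrable lborel (\<lambda>y. indicator Y y * F y)"
proof -
  have "integrable lborel (\<lambda>y. indicator K y *\<^sub>R F y)"
    by (rule borel_integrable_compact[OF assms(2) continuous_on_subset[OF assms(1,3)]])
  moreover have "(\<lambda>y. indicator K y *\<^sub>R F y) = (\<lambda>y. indicator Y y * F y)"
    using assms(3,4) by (auto simp: indicator_def fun_eq_iff)
  ultimately show ?thesis by simp
qed

lemma divide_abs_eq_sign:
  fixes G \<sigma> a :: real
  assumes "\<bar>G\<bar> = \<sigma> * G" "G \<noteq> 0" shows "a / \<bar>G\<bar> = \<sigma> * (a / G)"
proof (cases "G > 0")
  case True
  then show ?thesis using assms by simp
next
  case False
  then have "(\<sigma> + 1) * G = 0" using assms by (simp add: distrib_right)
  then have "\<sigma> = - 1" using assms(2) by simp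
  then show ?thesis using False by simp
qed

text \<open>All charts share the time interval \<open>J\<close>, and the balls cover the surface at
  every time in \<open>J\<close>. As the closed balls lie in the charts, the cutoffs have supports
  that project to compact subsets of \<open>Y i\<close>, uniformly in time.\<close>

locale moving_atlas =
  fixes \<Phi> :: "(real^3) \<times> real \<Rightarrow> real" and T J :: "real set" and m :: nat
    and k :: "nat \<Rightarrow> 3" and Y :: "nat \<Rightarrow> (real^2) set" and C :: "nat \<Rightarrow> (real^3) set"
    and h :: "nat \<Rightarrow> (real^2) \<times> real \<Rightarrow> real" and \<sigma> M :: "nat \<Rightarrow> real" and c :: "nat \<Rightarrow> real^3" and r :: "nat \<Rightarrow> real"
  assumes open_T: "open T" and smooth_Phi: "\<And>n. Ck_on n (UNIV \<times> T) \<Phi>" and open_J: "open J" and J_T: "J \<subseteq> T"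
    and charts: "\<And>i. i < m \<Longrightarrow> moving_chart \<Phi> (UNIV \<times> T) (k i) (Y i) J (C i) (h i)"
    and sign: "\<And>i p. i < m \<Longrightarrow> p \<in> C i \<times> J \<Longrightarrow> \<bar>dx (k i) \<Phi> p\<bar> = \<sigma> i * dx (k i) \<Phi> p"
    and bound: "\<And>i p. i < m \<Longrightarrow> p \<in> C i \<times> J \<Longrightarrow> level_speed \<Phi> p \<le> M i * \<bar>dx (k i) \<Phi> p\<bar>"
    and balls: "\<And>i. i < m \<Longrightarrow> cball (c i) (r i) \<subseteq> C i" "\<And>i. i < m \<Longrightarrow> r i > 0"
    and cover: "\<And>x s. s \<in> J \<Longrightarrow> \<Phi> (x, s) = 0 \<Longrightarrow> \<exists>i<m. x \<in> ball (c i) (r i)"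
begin

abbreviation g :: "3 \<Rightarrow> (real^3) \<times> real \<Rightarrow> real" where "g j \<equiv> dx j \<Phi>"

abbreviation \<rho> :: "(real^3) \<times> real \<Rightarrow> real" where "\<rho> \<equiv> level_speed \<Phi>"

abbreviation slice :: "real \<Rightarrow> real^3 \<Rightarrow> real" where "slice s \<equiv> \<lambda>x. \<Phi> (x, s)"

abbreviation \<Gamma> :: "real \<Rightarrow> (real^3) set" where "\<Gamma> s \<equiv> {x. \<Phi> (x, s) = 0}"

abbreviation \<gamma> :: "nat \<Rightarrow> (real^2) \<times> real \<Rightarrow> (real^3) \<times> real" where "\<gamma> i \<equiv> moving_chart.\<gamma> (k i) (h i)"

abbreviation graph_integral :: "nat \<Rightarrow> ((real^3) \<times> real \<Rightarrow> real) \<Rightarrow> real \<Rightarrow> real" where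
  "graph_integral i F s \<equiv> LINT y|lborel. indicator (Y i) y * (F (\<gamma> i (y, s)) / g (k i) (\<gamma> i (y, s)))"

text \<open>Time-independent, and C^1 thanks to the outer square.\<close>

definition bump :: "nat \<Rightarrow> (real^3) \<times> real \<Rightarrow> real" where
  "bump i p = (max 0 ((r i)\<^sup>2 - (fst p - c i) \<bullet> (fst p - c i)))\<^sup>2"

definition total :: "(real^3) \<times> real \<Rightarrow> real" where "total p = (\<Sum>i<m. bump i p)"

definition pou :: "nat \<Rightarrow> (real^3) \<times> real \<Rightarrow> real" where "pou i p = bump i p / total p"

text \<open>Where the normal and the partition of unity are both defined. Since it is open,
  identities on it can be differentiated; it contains the level sets for times in \<open>J\<close>
  (\<open>level_in_D\<close>).\<close>

definition D :: "((real^3) \<times> real) set" where "D = {p \<in> UNIV \<times> J. \<rho> p > 0} \<inter> {p. total p > 0}"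

lemma bump_nonneg: "bump i p \<ge> 0" by (simp add: bump_def)

lemma Ck_on_bump: "Ck_on (Suc 0) UNIV (bump i)"
proof -
  have *: "Ck_on (Suc 0) UNIV (\<lambda>p :: (real^3) \<times> real. (fst p - c i) \<bullet> b)" for b
    by (intro Ck_on_inner_const Ck_on_diff Ck_on_const Ck_on_linear bounded_linear_fst open_UNIV)
  have "Ck_on (Suc 0) UNIV (\<lambda>p :: (real^3) \<times> real. (r i)\<^sup>2 - (\<Sum>b\<in>Basis. ((fst p - c i) \<bullet> b) * ((fst p - c i) \<bullet> b)))"
    by (intro Ck_on_diff Ck_on_const Ck_on_sum Ck_on_mult * open_UNIV)
  moreover have "(fst p - c i) \<bullet> (fst p - c i) = (\<Sum>b\<in>Basis. ((fst p - c i) \<bullet> b) * ((fst p - c i) \<bullet> b))"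
    for p :: "(real^3) \<times> real" by (rule euclidean_inner)
  ultimately have "Ck_on (Suc 0) UNIV (\<lambda>p :: (real^3) \<times> real. (r i)\<^sup>2 - (fst p - c i) \<bullet> (fst p - c i))"
    by (simp only:)
  from Ck_on_compose[OF open_UNIV open_UNIV Ck_on_pos_part_square this] show ?thesis
    by (simp add: bump_def[abs_def] del: Ck_on.simps)
qed

lemma bump_zero: "fst p \<notin> ball (c i) (r i) \<Longrightarrow> i < m \<Longrightarrow> bump i p = 0"
proof -
  assume "fst p \<notin> ball (c i) (r i)" "i < m"
  then have "r i \<le> norm (fst p - c i)" "r i > 0" using balls(2) by (auto simp: dist_norm norm_minus_commute)
  then have "(r i)\<^sup>2 \<le> (norm (fst p - c i))\<^sup>2" by (intro power_mono) auto
  then show ?thesis by (simp add: bump_def power2_norm_eq_inner)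
qed

lemma bump_pos: "fst p \<in> ball (c i) (r i) \<Longrightarrow> bump i p > 0"
proof -
  assume "fst p \<in> ball (c i) (r i)"
  then have "norm (fst p - c i) < r i" by (auto simp: dist_norm norm_minus_commute)
  then have "(norm (fst p - c i))\<^sup>2 < (r i)\<^sup>2" by (intro power_strict_mono) auto
  then show ?thesis by (simp add: bump_def power2_norm_eq_inner)
qed

lemma Ck_on_total: "Ck_on (Suc 0) UNIV total"
  unfolding total_def[abs_def] by (intro Ck_on_sum Ck_on_bump open_UNIV)

lemma open_UJ: "open (UNIV \<times> J :: ((real^3) \<times> real) set)"
  using open_J by (simp add: open_Times)

lemma open_UT: "open (UNIV \<times> T :: ((real^3) \<times> real) set)"
  using open_T by (simp add: open_Times)

lemma continuous_on_pd: "continuous_on (UNIV \<times> T) (pd v \<Phi>)"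
  using Ck_on_continuous[OF Ck_on_pd[OF smooth_Phi]] .

lemma open_D: "open D"
proof -
  have "continuous_on (UNIV \<times> J) \<rho>"
    unfolding level_speed_def
    by (intro continuous_intros continuous_on_subset[OF continuous_on_pd]) (use J_T in auto)
  then have "open ((UNIV \<times> J) \<inter> \<rho> -` {0<..})"
    by (rule continuous_open_preimage[OF _ open_UJ open_greaterThan])
  moreover have "(UNIV \<times> J) \<inter> \<rho> -` {0<..} = {p \<in> UNIV \<times> J. \<rho> p > 0}" by auto
  moreover have "open (UNIV \<inter> total -` {0<..})"
    by (rule continuous_open_preimage[OF Ck_on_continuous[OF Ck_on_total] open_UNIV open_greaterThan])
  moreover have "UNIV \<inter> total -` {0<..} = {p. total p > 0}" by auto
  ultimately show ?thesis unfolding D_def by (metis open_Int)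
qed

lemma D_sub: "D \<subseteq> UNIV \<times> J" "D \<subseteq> UNIV \<times> T"
  using J_T by (auto simp: D_def)

lemma rho_pos: "p \<in> D \<Longrightarrow> \<rho> p > 0" by (simp add: D_def)

lemma smooth_pd: "Ck_on n D (pd v \<Phi>)"
  by (rule Ck_on_subset[OF Ck_on_pd[OF smooth_Phi] D_sub(2)])

lemma sum_squares_pos: "p \<in> D \<Longrightarrow> (\<Sum>i\<in>UNIV. g i p * g i p) > 0"
  using rho_pos[of p] by (simp add: level_speed_def)

lemma smooth_rho: "Ck_on n D \<rho>"
  unfolding level_speed_def[abs_def]
  by (rule Ck_on_sqrt_compose[OF open_D _ sum_squares_pos])
    (intro Ck_on_sum Ck_on_mult smooth_pd open_D)

lemma Ck_on_chi: "Ck_on (Suc 0) D (pou i)"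
  unfolding pou_def[abs_def]
  by (intro Ck_on_divide open_D Ck_on_subset[OF Ck_on_bump] Ck_on_subset[OF Ck_on_total])
    (auto simp: D_def)

lemma sum_chi: "p \<in> D \<Longrightarrow> (\<Sum>i<m. pou i p) = 1"
  unfolding pou_def sum_divide_distrib[symmetric] by (simp add: D_def total_def)

lemma chi_zero: "fst p \<notin> ball (c i) (r i) \<Longrightarrow> i < m \<Longrightarrow> pou i p = 0"
  by (simp add: pou_def bump_zero)

lemma level_in_D: assumes "s \<in> J" "\<Phi> (x, s) = 0" shows "(x, s) \<in> D"
proof -
  obtain i where i: "i < m" "x \<in> ball (c i) (r i)" using cover[OF assms] by blast
  have "x \<in> C i" using balls(1)[OF i(1)] i(2) ball_subset_cball by blast
  then have "g (k i) (x, s) \<noteq> 0" using moving_chart.Phi_k[OF charts[OF i(1)]] assms(1) by blast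
  then have "0 < g (k i) (x, s) * g (k i) (x, s)" using not_real_square_gt_zero by blast
  also have "\<dots> \<le> (\<Sum>j\<in>UNIV. g j (x, s) * g j (x, s))" by (rule member_le_sum) auto
  finally have "\<rho> (x, s) > 0" by (simp add: level_speed_def)
  moreover have "total (x, s) > 0"
    unfolding total_def using i bump_pos[of "(x, s)" i] bump_nonneg by (intro sum_pos2[of _ i]) auto
  ultimately show ?thesis using assms(1) by (simp add: D_def)
qed

definition Di :: "nat \<Rightarrow> ((real^3) \<times> real) set" where "Di i = D \<inter> (C i \<times> J)"

lemma Di: assumes "i < m" shows "open (Di i)" "Di i \<subseteq> C i \<times> J" "\<gamma> i ` (Y i \<times> J) \<subseteq> Di i" "Di i \<subseteq> D"
proof -
  interpret mc: moving_chart \<Phi> "UNIV \<times> T" "k i" "Y i" J "C i" "h i" by (rule charts[OF assms])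
  show "open (Di i)" unfolding Di_def by (intro open_Int open_D open_Times mc.open_C open_J)
  show "Di i \<subseteq> C i \<times> J" "Di i \<subseteq> D" by (auto simp: Di_def)
  show "\<gamma> i ` (Y i \<times> J) \<subseteq> Di i"
  proof
    fix q assume "q \<in> \<gamma> i ` (Y i \<times> J)"
    then obtain p where p: "p \<in> Y i \<times> J" "q = \<gamma> i p" by blast
    have "\<gamma> i p \<in> C i \<times> J" by (rule mc.gamma_in[OF p(1)])
    moreover have "\<gamma> i p \<in> D"
      using level_in_D[of "snd (\<gamma> i p)" "fst (\<gamma> i p)"] mc.Phi_gamma[OF p(1)] calculation by auto
    ultimately show "q \<in> Di i" by (simp add: Di_def p(2))
  qed
qed

definition K :: "nat \<Rightarrow> (real^2) set" where "K i = prj (k i) ` cball (c i) (r i)"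

lemma K: assumes "i < m" shows "compact (K i)" "K i \<subseteq> Y i"
    "\<And>y s. y \<in> Y i - K i \<Longrightarrow> fst (\<gamma> i (y, s)) \<notin> cball (c i) (r i)"
proof -
  interpret mc: moving_chart \<Phi> "UNIV \<times> T" "k i" "Y i" J "C i" "h i" by (rule charts[OF assms])
  show "compact (K i)" unfolding K_def by (intro compact_continuous_image continuous_intros) auto
  show "K i \<subseteq> Y i" unfolding K_def using mc.prj_in balls(1)[OF assms] by blast
  show "fst (\<gamma> i (y, s)) \<notin> cball (c i) (r i)" if "y \<in> Y i - K i" for y s
  proof
    assume "fst (\<gamma> i (y, s)) \<in> cball (c i) (r i)"
    then have "prj (k i) (fst (\<gamma> i (y, s))) \<in> K i" unfolding K_def by (rule imageI)
    then show False using that by (simp add: mc.\<gamma>_def)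
  qed
qed

section \<open>Reduction of surface integrals to integrals over graphs\<close>

lemma surface_measure_level: 
  assumes s: "s \<in> J" shows "is_surface_measure (\<Gamma> s) (surface_measure (\<Gamma> s))"
proof (rule surface_measure_works, rule ex1_surface_measure)
  show "graph_chart (slice s) (k i) (Y i) (C i) (\<lambda>y. h i (y, s)) (M i)" if "i < m" for i
    by (rule moving_chart.graph_chart_slice[OF charts[OF that] s bound[OF that]])
  have "continuous_on UNIV (slice s)"
    by (rule continuous_on_slice[OF Ck_on_continuous[OF smooth_Phi]]) (use s J_T in blast)
  then show "closed (\<Gamma> s)" using continuous_closed_preimage_constant[of UNIV "\<lambda>x. \<Phi> (x, s)" 0] by simp
  show "\<Gamma> s \<subseteq> (\<Union>i<m. C i)"
  proof
    fix x assume "x \<in> \<Gamma> s"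
    then obtain i where i: "i < m" "x \<in> ball (c i) (r i)" using cover[OF s] by blast
    then show "x \<in> (\<Union>i<m. C i)" using balls(1)[OF i(1)] ball_subset_cball by blast
  qed
qed

text \<open>The area density of the chart is \<open>\<rho>\<close> divided by the absolute value of
  \<open>g (k i)\<close>. This derivative has constant sign in the chart, so the absolute value
  costs only the factor \<open>\<sigma> i\<close> and the weight stays differentiable.\<close>

lemma chart_integral:
  assumes i: "i < m" and s: "s \<in> J" and q: "continuous_on D q"
    and zero: "\<And>p. p \<in> D \<Longrightarrow> fst p \<notin> cball (c i) (r i) \<Longrightarrow> q p = 0"
  shows "(LINT x:\<Gamma> s|surface_measure (\<Gamma> s). q (x, s)) =
      \<sigma> i * graph_integral i (\<lambda>p. \<rho> p * q p) s" (is ?eq)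
    and "set_integrable (surface_measure (\<Gamma> s)) (\<Gamma> s) (\<lambda>x. q (x, s))" (is ?int)
proof -
  interpret mc: moving_chart \<Phi> "UNIV \<times> T" "k i" "Y i" J "C i" "h i" by (rule charts[OF i])
  interpret sg: surface_graph "\<lambda>x. \<Phi> (x, s)" "k i" "Y i" "C i" "\<lambda>y. h i (y, s)" "M i"
    by unfold_locales (rule mc.graph_chart_slice[OF s bound[OF i]])
  have S: "sg.S = \<Gamma> s" by (simp add: sg.S_def)
  have \<gamma>: "\<gamma> i (y, s) = (sg.r y, s)" for y by (simp add: mc.\<gamma>_def sg.r_def)
  have in_D: "(sg.r y, s) \<in> D" if "y \<in> Y i" for y
    using Di(3,4)[OF i] that s by (auto simp: \<gamma>[symmetric])
  have cont: "continuous_on (Y i) (\<lambda>y. q (sg.r y, s))"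
    by (rule continuous_on_compose2[OF q]) (use in_D in \<open>auto intro!: continuous_intros sg.continuous_on_r\<close>)
  have q0: "q (x, s) = 0" if "x \<in> sg.S" "x \<notin> C i" for x
  proof -
    have "x \<notin> cball (c i) (r i)" using that(2) balls(1)[OF i] by blast
    moreover have "(x, s) \<in> D" using level_in_D[OF s] that(1) by (simp add: S)
    ultimately show ?thesis using zero[of "(x, s)"] by simp
  qed
  have wt: "sg.wt y * q (sg.r y, s) = \<sigma> i * (indicator (Y i) y * (\<rho> (\<gamma> i (y, s)) * q (\<gamma> i (y, s)) / g (k i) (\<gamma> i (y, s))))" for y
  proof (cases "y \<in> Y i")
    case True
    have CJ: "\<gamma> i (y, s) \<in> C i \<times> J" using mc.gamma_in[of "(y, s)"] True s by simp
    have d: "\<Phi> differentiable (at (sg.r y, s))"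
      by (rule Ck_on_differentiable[OF smooth_Phi]) (use s J_T in auto)
    have nz: "g (k i) (\<gamma> i (y, s)) \<noteq> 0" by (rule mc.Phi_k[OF CJ])
    have "\<bar>g (k i) (\<gamma> i (y, s))\<bar> = \<sigma> i * g (k i) (\<gamma> i (y, s))" by (rule sign[OF i CJ])
    then have "a / \<bar>g (k i) (\<gamma> i (y, s))\<bar> = \<sigma> i * (a / g (k i) (\<gamma> i (y, s)))" for a
      using nz by (rule divide_abs_eq_sign)
    then show ?thesis using True
      by (simp add: sg.wt_def slope_slice[OF d] \<gamma>[symmetric])
  qed (simp add: sg.wt_def)
  note N = surface_measure_level[OF s, folded S]
  have int: "integrable lborel (\<lambda>y. sg.wt y * q (sg.r y, s))"
  proof -
    have "integrable lborel (\<lambda>y. indicator (Y i) y * (slope (slice s) (k i) (sg.r y) * q (sg.r y, s)))"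
    proof (rule integrable_indicator_compact_support[OF _ K(1,2)[OF i]])
      show "continuous_on (Y i) (\<lambda>y. slope (slice s) (k i) (sg.r y) * q (sg.r y, s))"
        by (intro continuous_intros cont sg.continuous_on_slope_r)
      show "slope (slice s) (k i) (sg.r y) * q (sg.r y, s) = 0" if "y \<in> Y i - K i" for y
        using zero[OF in_D] K(3)[OF i that, of s] that by (simp add: \<gamma>)
    qed
    then show ?thesis by (simp add: sg.wt_def mult.assoc)
  qed
  have "(LINT x:sg.S|surface_measure sg.S. q (x, s)) = (LINT y|lborel. sg.wt y * q (sg.r y, s))"
    by (rule sg.surface_integral(1)[OF N q0 cont])
  then show ?eq unfolding wt S by (simp only: integral_mult_right_zero)
  show ?int using sg.surface_integral(2)[OF N q0 cont int] unfolding S .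
qed

text \<open>The summands \<open>Q i\<close> need not be \<open>pou i * q\<close>: in the two
  theorems below they contain derivatives of the cutoffs, which disappear only in the sum.\<close>

lemma partition_integral:
  assumes s: "s \<in> J" and Q: "\<And>i. i < m \<Longrightarrow> continuous_on D (Q i)"
    and zero: "\<And>i p. i < m \<Longrightarrow> p \<in> D \<Longrightarrow> fst p \<notin> cball (c i) (r i) \<Longrightarrow> Q i p = 0"
    and sum: "\<And>p. p \<in> D \<Longrightarrow> q p = (\<Sum>i<m. Q i p)"
  shows "(LINT x:\<Gamma> s|surface_measure (\<Gamma> s). q (x, s)) =
      (\<Sum>i<m. \<sigma> i * graph_integral i (\<lambda>p. \<rho> p * Q i p) s)"
    and "set_integrable (surface_measure (\<Gamma> s)) (\<Gamma> s) (\<lambda>x. q (x, s))"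
proof -
  have int: "set_integrable (surface_measure (\<Gamma> s)) (\<Gamma> s) (\<lambda>x. Q i (x, s))" if "i < m" for i
    by (rule chart_integral(2)[OF that s Q[OF that] zero[OF that]])
  have eq: "indicator (\<Gamma> s) x *\<^sub>R q (x, s) = (\<Sum>i<m. indicator (\<Gamma> s) x *\<^sub>R Q i (x, s))" for x
    using sum[OF level_in_D[OF s]] by (auto simp: indicator_def)
  have "(LINT x:\<Gamma> s|surface_measure (\<Gamma> s). q (x, s)) = (\<Sum>i<m. LINT x:\<Gamma> s|surface_measure (\<Gamma> s). Q i (x, s))"
    unfolding set_lebesgue_integral_def eq
    by (rule Bochner_Integration.integral_sum) (use int in \<open>simp add: set_integrable_def\<close>)
  also have "\<dots> = (\<Sum>i<m. \<sigma> i * graph_integral i (\<lambda>p. \<rho> p * Q i p) s)"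
    by (intro sum.cong refl chart_integral(1)[OF _ s]) (use Q zero in auto)
  finally show "(LINT x:\<Gamma> s|surface_measure (\<Gamma> s). q (x, s)) =
      (\<Sum>i<m. \<sigma> i * graph_integral i (\<lambda>p. \<rho> p * Q i p) s)" .
  show "set_integrable (surface_measure (\<Gamma> s)) (\<Gamma> s) (\<lambda>x. q (x, s))"
    unfolding set_integrable_def eq
    by (rule Bochner_Integration.integrable_sum) (use int in \<open>simp add: set_integrable_def\<close>)
qed

lemma pd_zero_off_ball:
  assumes "p \<in> D" "fst p \<notin> cball (c i) (r i)" and zero: "\<And>p. p \<in> D \<Longrightarrow> fst p \<notin> cball (c i) (r i) \<Longrightarrow> F p = (0::real)"
  shows "pd v F p = 0"
proof -
  have "open (D \<inter> ((- cball (c i) (r i)) \<times> UNIV))" by (intro open_Int open_D open_Times) auto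
  moreover have "p \<in> D \<inter> ((- cball (c i) (r i)) \<times> UNIV)" using assms(1,2) by (cases p) auto
  moreover have "F p = 0" if "p \<in> D \<inter> ((- cball (c i) (r i)) \<times> UNIV)" for p
    using zero[of p] that by (cases p) auto
  ultimately have "pd v F p = pd v (\<lambda>_. 0) p" by (rule pd_cong_open)
  then show ?thesis by simp
qed

lemma chi_zero_cball: "fst p \<notin> cball (c i) (r i) \<Longrightarrow> i < m \<Longrightarrow> pou i p = 0"
  using chi_zero ball_subset_cball by blast

text \<open>A cutoff keeps the field tangential, so each cut-off field integrates to zero in its
  chart; the divergences of the pieces add up to that of \<open>X\<close> because the cutoffs sum to
  1 on an open set.\<close>

lemma surface_divergence_theorem:
  assumes s: "s \<in> J" and X: "\<And>j. Ck_on (Suc 0) D (X j)"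
    and tang: "\<And>p. p \<in> D \<Longrightarrow> (\<Sum>j\<in>UNIV. X j p * g j p) = 0"
  shows "(LINT x:\<Gamma> s|surface_measure (\<Gamma> s). (\<Sum>j\<in>UNIV. dx j (X j) (x, s)) / \<rho> (x, s)) = 0"
    and "set_integrable (surface_measure (\<Gamma> s)) (\<Gamma> s) (\<lambda>x. (\<Sum>j\<in>UNIV. dx j (X j) (x, s)) / \<rho> (x, s))"
proof -
  define XX where "XX i j p = pou i p * X j p" for i j p
  define Q where "Q i p = (\<Sum>j\<in>UNIV. dx j (XX i j) p) / \<rho> p" for i p
  have XC: "Ck_on (Suc 0) D (XX i j)" for i j
    unfolding XX_def[abs_def] by (intro Ck_on_mult open_D Ck_on_chi X)
  have QC: "continuous_on D (Q i)" for i
    unfolding Q_def[abs_def]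
    by (intro continuous_intros Ck_on_continuous[OF Ck_on_pd[OF XC]] Ck_on_continuous[OF smooth_rho])
      (use rho_pos in force)
  have Q0: "Q i p = 0" if "i < m" "p \<in> D" "fst p \<notin> cball (c i) (r i)" for i p
  proof -
    have "dx j (XX i j) p = 0" for j
      by (rule pd_zero_off_ball[OF that(2,3)]) (simp add: XX_def chi_zero_cball[OF _ that(1)])
    then show ?thesis by (simp add: Q_def)
  qed
  have sum: "(\<Sum>j\<in>UNIV. dx j (X j) p) / \<rho> p = (\<Sum>i<m. Q i p)" if p: "p \<in> D" for p
  proof -
    have "pd v (X j) p = (\<Sum>i<m. pd v (XX i j) p)" for v j
    proof -
      have "pd v (X j) p = pd v (\<lambda>p. \<Sum>i<m. XX i j p) p"
        by (rule pd_cong_open[OF open_D p]) (simp add: XX_def sum_distrib_right[symmetric] sum_chi)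
      also have "\<dots> = (\<Sum>i<m. pd v (XX i j) p)"
        by (rule pd_sum) (rule Ck_on_differentiable[OF XC p])
      finally show ?thesis .
    qed
    then have "(\<Sum>j\<in>UNIV. dx j (X j) p) = (\<Sum>j\<in>UNIV. \<Sum>i<m. dx j (XX i j) p)"
      by (intro sum.cong) auto
    also have "\<dots> = (\<Sum>i<m. \<Sum>j\<in>UNIV. dx j (XX i j) p)" by (rule sum.swap)
    finally show ?thesis by (simp add: Q_def sum_divide_distrib)
  qed
  have "graph_integral i (\<lambda>p. \<rho> p * Q i p) s = 0"
    if i: "i < m" for i
  proof -
    interpret mc: moving_chart \<Phi> "UNIV \<times> T" "k i" "Y i" J "C i" "h i" by (rule charts[OF i])
    have "graph_integral i (\<lambda>p. (\<Sum>j\<in>UNIV. dx j (XX i j) p)) s = 0"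
    proof (rule mc.surface_divergence(1)[OF Di(1-3)[OF i] _ _ K(1,2)[OF i] _ s])
      show "Ck_on (Suc 0) (Di i) (XX i j)" for j by (rule Ck_on_subset[OF XC Di(4)[OF i]])
      show "(\<Sum>j\<in>UNIV. XX i j p * g j p) = 0" if "p \<in> Di i" for p
      proof -
        have "(\<Sum>j\<in>UNIV. XX i j p * g j p) = pou i p * (\<Sum>j\<in>UNIV. X j p * g j p)"
          by (simp add: XX_def sum_distrib_left mult.assoc)
        then show ?thesis using tang[OF subsetD[OF Di(4)[OF i] that]] by simp
      qed
      show "XX i j (\<gamma> i (y, s)) = 0" if "y \<in> Y i - K i" for j y s
        using chi_zero_cball[OF K(3)[OF i that] i] by (simp add: XX_def)
    qed
    moreover have "indicator (Y i) y * (\<rho> (\<gamma> i (y, s)) * Q i (\<gamma> i (y, s)) / g (k i) (\<gamma> i (y, s)))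
      = indicator (Y i) y * ((\<Sum>j\<in>UNIV. dx j (XX i j) (\<gamma> i (y, s))) / g (k i) (\<gamma> i (y, s)))" for y
    proof (cases "y \<in> Y i")
      case True
      then have "\<gamma> i (y, s) \<in> D" using Di(3,4)[OF i] s by blast
      then show ?thesis using rho_pos[of "\<gamma> i (y, s)"] by (simp add: Q_def)
    qed simp
    ultimately show ?thesis by (simp only:)
  qed
  then show "(LINT x:\<Gamma> s|surface_measure (\<Gamma> s). (\<Sum>j\<in>UNIV. dx j (X j) (x, s)) / \<rho> (x, s)) = 0"
    using partition_integral(1)[OF s QC Q0 sum] by simp
  show "set_integrable (surface_measure (\<Gamma> s)) (\<Gamma> s) (\<lambda>x. (\<Sum>j\<in>UNIV. dx j (X j) (x, s)) / \<rho> (x, s))"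
    by (rule partition_integral(2)[OF s QC Q0 sum])
qed

lemma Ck_on_flux: "Ck_on (Suc 0) D w \<Longrightarrow> Ck_on (Suc 0) D (flux \<Phi> w j)"
  unfolding flux_def[abs_def]
  by (intro Ck_on_divide Ck_on_mult Ck_on_minus Ck_on_sum open_D smooth_pd) (use sum_squares_pos in force)+

text \<open>For the piece \<open>pou i * f\<close> the area density leaves the planar integral of
  \<open>w i / g (k i)\<close>, the form handled by \<open>time_derivative\<close>. As
  \<open>dt\<close> and the flux are linear, the derivatives of the cutoffs cancel in the
  sum.\<close>

lemma first_variation:
  assumes s: "s \<in> J" and f: "Ck_on (Suc 0) D f"
  shows "((\<lambda>s. LINT x:\<Gamma> s|surface_measure (\<Gamma> s). f (x, s)) has_real_derivative
      (LINT x:\<Gamma> s|surface_measure (\<Gamma> s). variation \<Phi> (\<lambda>p. \<rho> p * f p) (x, s) / \<rho> (x, s))) (at s)"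
    and "set_integrable (surface_measure (\<Gamma> s)) (\<Gamma> s) (\<lambda>x. variation \<Phi> (\<lambda>p. \<rho> p * f p) (x, s) / \<rho> (x, s))"
proof -
  define w where "w i p = \<rho> p * (pou i p * f p)" for i p
  define w0 where "w0 = (\<lambda>p. \<rho> p * f p)"
  define Q where "Q i p = variation \<Phi> (w i) p / \<rho> p" for i p
  have w0C: "Ck_on (Suc 0) D w0"
    unfolding w0_def by (intro Ck_on_mult open_D f smooth_rho)
  have wC: "Ck_on (Suc 0) D (w i)" for i
    unfolding w_def[abs_def] by (intro Ck_on_mult open_D Ck_on_chi f smooth_rho)
  note FC = Ck_on_flux[OF wC]
  have QC: "continuous_on D (Q i)" for i
    unfolding Q_def[abs_def] variation_def
    by (intro continuous_intros Ck_on_continuous[OF Ck_on_pd[OF FC]] Ck_on_continuous[OF Ck_on_pd[OF wC]] Ck_on_continuous[OF smooth_rho])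
      (use rho_pos in force)
  have w_zero: "w i p = 0" if "i < m" "fst p \<notin> cball (c i) (r i)" for i p
    using chi_zero_cball[OF that(2,1)] by (simp add: w_def)
  have Q0: "Q i p = 0" if "i < m" "p \<in> D" "fst p \<notin> cball (c i) (r i)" for i p
  proof -
    have "dt (w i) p = 0"
      by (rule pd_zero_off_ball[OF that(2,3)]) (rule w_zero[OF that(1)])
    moreover have "dx j (flux \<Phi> (w i) j) p = 0" for j
      by (rule pd_zero_off_ball[OF that(2,3)]) (simp add: flux_def w_zero[OF that(1)])
    ultimately show ?thesis by (simp add: Q_def variation_def)
  qed
  have w_sum: "w0 p = (\<Sum>i<m. w i p)" if "p \<in> D" for p
    using sum_chi[OF that] unfolding w0_def w_def sum_distrib_left[symmetric] sum_distrib_right[symmetric] by simp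
  have flux_sum: "flux \<Phi> w0 j p = (\<Sum>i<m. flux \<Phi> (w i) j p)" if "p \<in> D" for p j
    unfolding flux_def sum_divide_distrib[symmetric] sum_distrib_right[symmetric] sum_negf w_sum[OF that] ..
  have sum: "variation \<Phi> w0 p / \<rho> p = (\<Sum>i<m. Q i p)" if p: "p \<in> D" for p
  proof -
    have "dt w0 p = dt (\<lambda>p. \<Sum>i<m. w i p) p"
      by (rule pd_cong_open[OF open_D p w_sum])
    also have "\<dots> = (\<Sum>i<m. dt (w i) p)"
      by (rule pd_sum) (rule Ck_on_differentiable[OF wC p])
    finally have 1: "dt w0 p = (\<Sum>i<m. dt (w i) p)" .
    have 2: "pd v (flux \<Phi> w0 j) p = (\<Sum>i<m. pd v (flux \<Phi> (w i) j) p)" for v j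
    proof -
      have "pd v (flux \<Phi> w0 j) p = pd v (\<lambda>p. \<Sum>i<m. flux \<Phi> (w i) j p) p"
        by (rule pd_cong_open[OF open_D p flux_sum])
      also have "\<dots> = (\<Sum>i<m. pd v (flux \<Phi> (w i) j) p)"
        by (rule pd_sum) (rule Ck_on_differentiable[OF FC p])
      finally show ?thesis .
    qed
    have "(\<Sum>j\<in>UNIV. dx j (flux \<Phi> w0 j) p) = (\<Sum>j\<in>UNIV. \<Sum>i<m. dx j (flux \<Phi> (w i) j) p)"
      unfolding 2 ..
    also have "\<dots> = (\<Sum>i<m. \<Sum>j\<in>UNIV. dx j (flux \<Phi> (w i) j) p)" by (rule sum.swap)
    finally show ?thesis using 1 by (simp add: Q_def variation_def sum_divide_distrib[symmetric] sum.distrib)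
  qed
  have part: "(LINT x:\<Gamma> s'|surface_measure (\<Gamma> s'). f (x, s')) =
      (\<Sum>i<m. \<sigma> i * graph_integral i (w i) s')" if s': "s' \<in> J" for s'
  proof -
    have "(LINT x:\<Gamma> s'|surface_measure (\<Gamma> s'). f (x, s')) =
      (\<Sum>i<m. \<sigma> i * graph_integral i (\<lambda>p. \<rho> p * (pou i p * f p)) s')"
    proof (rule partition_integral(1)[OF s'])
      show "continuous_on D (\<lambda>p. pou i p * f p)" for i
        by (intro continuous_intros Ck_on_continuous[OF Ck_on_chi] Ck_on_continuous[OF f])
      show "pou i p * f p = 0" if "i < m" "fst p \<notin> cball (c i) (r i)" for i p
        using chi_zero_cball[OF that(2,1)] by simp
      show "f p = (\<Sum>i<m. pou i p * f p)" if "p \<in> D" for p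
        using sum_chi[OF that] by (simp add: sum_distrib_right[symmetric])
    qed
    then show ?thesis by (simp add: w_def)
  qed
  have der: "((\<lambda>s. LINT y|lborel. indicator (Y i) y * (w i (\<gamma> i (y, s)) / g (k i) (\<gamma> i (y, s)))) has_real_derivative
       graph_integral i (\<lambda>p. \<rho> p * Q i p) s) (at s)"
    if i: "i < m" for i
  proof -
    interpret mc: moving_chart \<Phi> "UNIV \<times> T" "k i" "Y i" J "C i" "h i" by (rule charts[OF i])
    have "((\<lambda>s. LINT y|lborel. indicator (Y i) y * (w i (\<gamma> i (y, s)) / g (k i) (\<gamma> i (y, s)))) has_real_derivative
       graph_integral i (\<lambda>p. variation \<Phi> (w i) p) s) (at s)"
      unfolding variation_def flux_def[abs_def]
    proof (rule mc.time_derivative(1)[OF Di(1-3)[OF i] _ K(1,2)[OF i] _ s])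
      show "Ck_on (Suc 0) (Di i) (w i)" by (rule Ck_on_subset[OF wC Di(4)[OF i]])
      show "w i (\<gamma> i (y, s)) = 0" if "y \<in> Y i - K i" for y s
        by (rule w_zero[OF i K(3)[OF i that]])
    qed
    moreover have "indicator (Y i) y * (\<rho> (\<gamma> i (y, s)) * Q i (\<gamma> i (y, s)) / g (k i) (\<gamma> i (y, s)))
      = indicator (Y i) y * (variation \<Phi> (w i) (\<gamma> i (y, s)) / g (k i) (\<gamma> i (y, s)))" for y
    proof (cases "y \<in> Y i")
      case True
      then have "\<gamma> i (y, s) \<in> D" using Di(3,4)[OF i] s by blast
      then show ?thesis using rho_pos[of "\<gamma> i (y, s)"] by (simp add: Q_def)
    qed simp
    ultimately show ?thesis by (simp only:)
  qed
  have "((\<lambda>s. \<Sum>i<m. \<sigma> i * graph_integral i (w i) s) has_real_derivative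
       (\<Sum>i<m. \<sigma> i * graph_integral i (\<lambda>p. \<rho> p * Q i p) s)) (at s)"
    by (intro DERIV_sum DERIV_cmult der) simp
  moreover have "(LINT x:\<Gamma> s|surface_measure (\<Gamma> s). variation \<Phi> w0 (x, s) / \<rho> (x, s)) =
      (\<Sum>i<m. \<sigma> i * graph_integral i (\<lambda>p. \<rho> p * Q i p) s)"
    by (rule partition_integral(1)[OF s QC Q0 sum])
  ultimately have "((\<lambda>s. \<Sum>i<m. \<sigma> i * graph_integral i (w i) s) has_real_derivative
      (LINT x:\<Gamma> s|surface_measure (\<Gamma> s). variation \<Phi> w0 (x, s) / \<rho> (x, s))) (at s)"
    by (simp only:)
  then show "((\<lambda>s. LINT x:\<Gamma> s|surface_measure (\<Gamma> s). f (x, s)) has_real_derivative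
      (LINT x:\<Gamma> s|surface_measure (\<Gamma> s). variation \<Phi> (\<lambda>p. \<rho> p * f p) (x, s) / \<rho> (x, s))) (at s)"
    unfolding w0_def by (rule has_field_derivative_transform_within_open[OF _ open_J s]) (rule part[symmetric])
  show "set_integrable (surface_measure (\<Gamma> s)) (\<Gamma> s) (\<lambda>x. variation \<Phi> (\<lambda>p. \<rho> p * f p) (x, s) / \<rho> (x, s))"
    using partition_integral(2)[OF s QC Q0 sum] unfolding w0_def .
qed

end

text \<open>Compactness at time \<open>t\<close> gives finitely many balls. That they still cover
  the surface at nearby times takes two facts: uniform boundedness keeps the surface in one large
  ball, and the tube lemma keeps it away from the compact rest \<open>L\<close> of that
  ball.\<close>

lemma exists_moving_atlas:
  fixes \<Phi> :: "(real^3) \<times> real \<Rightarrow> real"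
  assumes T: "open T" and smooth: "\<And>n. Ck_on n (UNIV \<times> T) \<Phi>" and t: "t \<in> T"
    and compact: "compact {x. \<Phi> (x, t) = 0}"
    and bounded: "\<epsilon> > 0" "bounded (\<Union>s \<in> {s\<in>T. \<bar>s - t\<bar> < \<epsilon>}. {x. \<Phi> (x, s) = 0})"
    and regular: "\<And>x. \<Phi> (x, t) = 0 \<Longrightarrow> \<exists>k. dx k \<Phi> (x, t) \<noteq> 0"
  shows "\<exists>J m k Y C h \<sigma> M c r. moving_atlas \<Phi> T J m k Y C h \<sigma> M c r \<and> t \<in> J"
proof -
  define P where "P x k Y I C h M \<sigma> r \<longleftrightarrow> moving_chart \<Phi> (UNIV \<times> T) k Y I C h \<and> t \<in> I \<and>
     (\<forall>p\<in>C \<times> I. \<bar>dx k \<Phi> p\<bar> = \<sigma> * dx k \<Phi> p) \<and>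
     (\<forall>p\<in>C \<times> I. level_speed \<Phi> p \<le> M * \<bar>dx k \<Phi> p\<bar>) \<and> r > 0 \<and> cball x r \<subseteq> C"
    for x k Y I C h and M \<sigma> r :: real
  have "\<exists>k Y I C h M \<sigma> r. P x k Y I C h M \<sigma> r" if x: "\<Phi> (x, t) = 0" for x
  proof -
    obtain k where k: "dx k \<Phi> (x, t) \<noteq> 0" using regular[OF x] by blast
    obtain Y I C h M \<sigma> where *: "moving_chart \<Phi> (UNIV \<times> T) k Y I C h" "x \<in> C" "t \<in> I"
       "\<forall>p\<in>C \<times> I. \<bar>dx k \<Phi> p\<bar> = \<sigma> * dx k \<Phi> p"
       "\<forall>p\<in>C \<times> I. level_speed \<Phi> p \<le> M * \<bar>dx k \<Phi> p\<bar>"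
      using exists_moving_chart[OF T smooth t x k] by blast
    obtain r where "r > 0" "cball x r \<subseteq> C"
      using moving_chart.open_C[OF *(1)] *(2) open_contains_cball by metis
    then show ?thesis unfolding P_def using * by blast
  qed
  then obtain k' Y' I' C' h' M' \<sigma>' r' where
    P: "P x (k' x) (Y' x) (I' x) (C' x) (h' x) (M' x) (\<sigma>' x) (r' x)" if "\<Phi> (x, t) = 0" for x
    by metis
  obtain F where F: "F \<subseteq> {x. \<Phi> (x, t) = 0}" "finite F" "{x. \<Phi> (x, t) = 0} \<subseteq> (\<Union>x\<in>F. ball x (r' x))"
  proof (rule compactE_image[OF compact, of "{x. \<Phi> (x, t) = 0}" "\<lambda>x. ball x (r' x)"])
    show "{x. \<Phi> (x, t) = 0} \<subseteq> (\<Union>x\<in>{x. \<Phi> (x, t) = 0}. ball x (r' x))"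
      using P unfolding P_def by auto
  qed auto
  obtain c where c: "bij_betw c {..<card F} F"
    using ex_bij_betw_nat_finite[OF F(2)] by (auto simp: atLeast0LessThan)
  define U where "U = (\<Union>x\<in>F. ball x (r' x))"
  obtain R where R: "(\<Union>s \<in> {s\<in>T. \<bar>s - t\<bar> < \<epsilon>}. {x. \<Phi> (x, s) = 0}) \<subseteq> cball 0 R"
    using bounded(2) unfolding bounded_iff by (auto simp: subset_iff)
  define L where "L = cball 0 R - U"
  \<comment> \<open>Coordinates are swapped so that time comes first, as in the tube around
    \<open>{t} \<times> L\<close>.\<close>
  define W where "W = (\<lambda>p. (snd p, fst p)) -` ({p \<in> UNIV \<times> T. \<Phi> p \<noteq> 0})"
  have "open {p \<in> UNIV \<times> T. \<Phi> p \<noteq> 0}"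
  proof -
    have "open ((UNIV \<times> T) \<inter> \<Phi> -` (- {0}))"
      by (rule continuous_open_preimage[OF Ck_on_continuous[OF smooth]]) (use T in \<open>auto intro: open_Times\<close>)
    moreover have "(UNIV \<times> T) \<inter> \<Phi> -` (- {0}) = {p \<in> UNIV \<times> T. \<Phi> p \<noteq> 0}" by auto
    ultimately show ?thesis by simp
  qed
  then have open_W: "open W" unfolding W_def by (intro open_vimage continuous_intros)
  have compact_L: "compact L"
    unfolding L_def U_def by (intro compact_diff open_UN ballI) auto
  have "{t} \<times> L \<subseteq> W" using F(3) t by (auto simp: W_def L_def U_def)
  from Elementary_Topology.tube_lemma[OF compact_L open_W this]
  obtain X0 where X0: "t \<in> X0" "open X0" "X0 \<times> L \<subseteq> W" by blast
  define J where "J = ball t \<epsilon> \<inter> T \<inter> X0 \<inter> (\<Inter>x\<in>F. I' x)"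
  have cF: "c i \<in> F" if "i < card F" for i using c that by (auto simp: bij_betw_def)
  have Pc: "P (c i) (k' (c i)) (Y' (c i)) (I' (c i)) (C' (c i)) (h' (c i)) (M' (c i)) (\<sigma>' (c i)) (r' (c i))"
    and JI: "J \<subseteq> I' (c i)" if "i < card F" for i
    using P cF[OF that] F(1) by (auto simp: J_def)
  have atlas: "moving_atlas \<Phi> T J (card F) (\<lambda>i. k' (c i)) (\<lambda>i. Y' (c i)) (\<lambda>i. C' (c i)) (\<lambda>i. h' (c i))
      (\<lambda>i. \<sigma>' (c i)) (\<lambda>i. M' (c i)) c (\<lambda>i. r' (c i))"
  proof (rule moving_atlas.intro)
    show J: "open J"
    proof -
      have "open (I' x)" if "x \<in> F" for x
        using moving_chart.open_I[OF conjunct1[OF P[unfolded P_def]]] F(1) that by blast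
      then show ?thesis unfolding J_def by (intro open_Int open_INT T X0(2) F(2)) auto
    qed
    show "J \<subseteq> T" by (auto simp: J_def)
    show "moving_chart \<Phi> (UNIV \<times> T) (k' (c i)) (Y' (c i)) J (C' (c i)) (h' (c i))" if "i < card F" for i
      by (rule moving_chart_subset[OF conjunct1[OF Pc[unfolded P_def, OF that]] J JI[OF that]])
    have CJ: "p \<in> C' (c i) \<times> I' (c i)" if "i < card F" "p \<in> C' (c i) \<times> J" for i p
      using that(2) JI[OF that(1)] by auto
    show "\<bar>dx (k' (c i)) \<Phi> p\<bar> = \<sigma>' (c i) * dx (k' (c i)) \<Phi> p"
      if "i < card F" "p \<in> C' (c i) \<times> J" for i p
      using Pc[unfolded P_def, OF that(1)] CJ[OF that] by (elim conjE) (rule bspec)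
    show "level_speed \<Phi> p \<le> M' (c i) * \<bar>dx (k' (c i)) \<Phi> p\<bar>"
      if "i < card F" "p \<in> C' (c i) \<times> J" for i p
      using Pc[unfolded P_def, OF that(1)] CJ[OF that] by (elim conjE) (rule bspec)
    show "cball (c i) (r' (c i)) \<subseteq> C' (c i)" if "i < card F" for i
      using Pc[unfolded P_def, OF that] by (elim conjE)
    show "r' (c i) > 0" if "i < card F" for i
      using Pc[unfolded P_def, OF that] by (elim conjE)
    show "\<exists>i<card F. x \<in> ball (c i) (r' (c i))" if "s \<in> J" "\<Phi> (x, s) = 0" for x s
    proof -
      have "s \<in> T" "\<bar>s - t\<bar> < \<epsilon>" "s \<in> X0" using that(1) by (auto simp: J_def dist_real_def)
      then have "x \<in> cball 0 R" using R that(2) by blast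
      moreover have "x \<notin> L" using X0(3) \<open>s \<in> X0\<close> that(2) by (auto simp: W_def)
      ultimately have "x \<in> U" by (simp add: L_def)
      then obtain z where z: "z \<in> F" "x \<in> ball z (r' z)" by (auto simp: U_def)
      then obtain i where "i < card F" "c i = z" using c unfolding bij_betw_def by (metis imageE lessThan_iff)
      then show ?thesis using z(2) by blast
    qed
  qed (fact T smooth)+
  have "t \<in> I' x" if "x \<in> F" for x using P[unfolded P_def, of x] F(1) that by blast
  then have tJ: "t \<in> J" using t X0(1) bounded(1) by (simp add: J_def)
  show ?thesis by (intro exI conjI) (rule atlas, rule tJ)
qed

section \<open>The first variation of the curvature energy\<close>

context moving_atlas
begin

text \<open>Here \<open>vel\<close> is the normal speed, \<open>mc\<close> is \<open>H\<close> and \<open>bend\<close> is \<open>(\<nabla>n) n\<close>. Away from \<open>D\<close> they are junk.\<close>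

definition nu :: "3 \<Rightarrow> (real^3) \<times> real \<Rightarrow> real" where "nu i p = g i p / \<rho> p"

definition vel :: "(real^3) \<times> real \<Rightarrow> real" where "vel p = - dt \<Phi> p / \<rho> p"

definition mc :: "(real^3) \<times> real \<Rightarrow> real" where "mc p = (\<Sum>i\<in>UNIV. dx i (nu i) p)"

definition bend :: "3 \<Rightarrow> (real^3) \<times> real \<Rightarrow> real" where "bend i p = (\<Sum>j\<in>UNIV. nu j p * dx j (nu i) p)"

definition tgrad :: "((real^3) \<times> real \<Rightarrow> real) \<Rightarrow> 3 \<Rightarrow> (real^3) \<times> real \<Rightarrow> real" where
  "tgrad F i p = dx i F p - (\<Sum>j\<in>UNIV. dx j F p * nu j p) * nu i p"

lemma Ck_nu: "Ck_on n D (nu i)"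
  unfolding nu_def[abs_def] by (intro Ck_on_divide open_D smooth_pd smooth_rho) (use rho_pos in force)

lemma Ck_vel: "Ck_on n D vel"
  unfolding vel_def[abs_def] by (intro Ck_on_divide Ck_on_minus open_D smooth_pd smooth_rho) (use rho_pos in force)

lemma Ck_pd_nu: "Ck_on n D (pd v (nu i))"
  by (rule Ck_on_pd[OF Ck_nu])

lemma Ck_mc: "Ck_on n D mc"
  unfolding mc_def[abs_def] by (intro Ck_on_sum open_D Ck_pd_nu)

lemma Ck_bend: "Ck_on n D (bend i)"
  unfolding bend_def[abs_def] by (intro Ck_on_sum Ck_on_mult open_D Ck_nu Ck_pd_nu)

lemma Ck_tgrad: "Ck_on (Suc n) D F \<Longrightarrow> Ck_on n D (tgrad F i)"
  unfolding tgrad_def[abs_def]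
  by (intro Ck_on_diff Ck_on_mult Ck_on_sum open_D Ck_nu; rule Ck_on_pd; assumption)

lemma g_eq: "q \<in> D \<Longrightarrow> g i q = \<rho> q * nu i q"
  using rho_pos[of q] by (simp add: nu_def)

lemma Phi_t_eq: "q \<in> D \<Longrightarrow> dt \<Phi> q = - (vel q * \<rho> q)"
  using rho_pos[of q] by (simp add: vel_def)

lemma sum_g_squares: "q \<in> D \<Longrightarrow> (\<Sum>i\<in>UNIV. g i q * g i q) = \<rho> q * \<rho> q"
  using sum_squares_pos[of q] by (simp add: level_speed_def less_imp_le)

lemma sum_nu_squares: "q \<in> D \<Longrightarrow> (\<Sum>i\<in>UNIV. nu i q * nu i q) = 1"
proof -
  assume q: "q \<in> D"
  have "(\<Sum>i\<in>UNIV. nu i q * nu i q) = (\<Sum>i\<in>UNIV. g i q * g i q) / (\<rho> q * \<rho> q)"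
    by (simp add: nu_def sum_divide_distrib)
  then show ?thesis using sum_g_squares[OF q] rho_pos[OF q] by simp
qed

section \<open>Pointwise identities for the normal, the gradient norm and the normal speed\<close>

context
  fixes p assumes p: "p \<in> D"
begin

lemma diff_nu: "nu i differentiable (at p)" and diff_vel: "vel differentiable (at p)"
  and diff_rho: "\<rho> differentiable (at p)" and diff_mc: "mc differentiable (at p)"
  and diff_pd_nu: "pd v (nu i) differentiable (at p)" and diff_bend: "bend i differentiable (at p)"
  by (rule Ck_on_differentiable[OF _ p], rule Ck_nu Ck_vel smooth_rho Ck_mc Ck_pd_nu Ck_bend)+

lemma nu_pd_nu: "(\<Sum>i\<in>UNIV. nu i p * pd v (nu i) p) = 0"
proof -
  have "pd v (\<lambda>q. \<Sum>i\<in>UNIV. nu i q * nu i q) p = pd v (\<lambda>_. 1) p"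
    by (rule pd_cong_open[OF open_D p sum_nu_squares])
  moreover have "pd v (\<lambda>q. \<Sum>i\<in>UNIV. nu i q * nu i q) p = (\<Sum>i\<in>UNIV. pd v (\<lambda>q. nu i q * nu i q) p)"
    by (rule pd_sum) (intro differentiable_mult diff_nu)
  moreover have "pd v (\<lambda>q. nu i q * nu i q) p = 2 * (nu i p * pd v (nu i) p)" for i
    using pd_mult[OF diff_nu diff_nu] by simp
  ultimately show ?thesis by (simp add: sum_distrib_left[symmetric])
qed

lemma pd_g: "pd v (g i) p = \<rho> p * pd v (nu i) p + pd v \<rho> p * nu i p"
  using pd_cong_open[OF open_D p g_eq, where v=v] pd_mult[OF diff_rho diff_nu] by simp

lemma bend_nu: "(\<Sum>i\<in>UNIV. bend i p * nu i p) = 0"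
proof -
  have "(\<Sum>i\<in>UNIV. bend i p * nu i p) = (\<Sum>i\<in>UNIV. \<Sum>j\<in>UNIV. nu j p * (nu i p * dx j (nu i) p))"
    by (simp add: bend_def sum_distrib_left sum_distrib_right mult_ac)
  also have "\<dots> = (\<Sum>j\<in>UNIV. \<Sum>i\<in>UNIV. nu j p * (nu i p * dx j (nu i) p))" by (rule sum.swap)
  also have "\<dots> = 0" by (simp add: sum_distrib_left[symmetric] nu_pd_nu)
  finally show ?thesis .
qed

text \<open>Symmetry of the spatial Hessian of \<open>\<Phi>\<close>, written with
  \<open>g i = \<rho> * nu i\<close> and contracted with the normal. It says that the tangential
  part of the gradient of \<open>\<rho>\<close> is \<open>\<rho> * bend\<close>.\<close>

lemma pd_rho: "dx i \<rho> p = (\<Sum>j\<in>UNIV. dx j \<rho> p * nu j p) * nu i p + \<rho> p * bend i p"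
proof -
  have in_W: "p \<in> UNIV \<times> T" using p D_sub by blast
  have sym: "\<rho> p * dx i (nu j) p + dx i \<rho> p * nu j p = \<rho> p * dx j (nu i) p + dx j \<rho> p * nu i p" for j
    using pd_commute[OF open_UT smooth_Phi in_W, of "(axis i 1, 0)" "(axis j 1, 0)"] by (simp add: pd_g)
  have "(\<Sum>j\<in>UNIV. (\<rho> p * dx i (nu j) p + dx i \<rho> p * nu j p) * nu j p)
     = \<rho> p * (\<Sum>j\<in>UNIV. nu j p * dx i (nu j) p) + dx i \<rho> p * (\<Sum>j\<in>UNIV. nu j p * nu j p)"
    by (simp add: sum_distrib_left sum.distrib[symmetric] algebra_simps)
  also have "\<dots> = dx i \<rho> p" by (simp add: nu_pd_nu sum_nu_squares[OF p])
  finally have "dx i \<rho> p = (\<Sum>j\<in>UNIV. (\<rho> p * dx j (nu i) p + dx j \<rho> p * nu i p) * nu j p)"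
    by (simp add: sym)
  also have "\<dots> = (\<Sum>j\<in>UNIV. dx j \<rho> p * nu j p) * nu i p + \<rho> p * bend i p"
    by (simp add: bend_def sum_distrib_left sum_distrib_right sum.distrib[symmetric] algebra_simps)
  finally show ?thesis .
qed

text \<open>Commuting time and space derivatives of \<open>\<Phi>\<close> equates the time
  derivative of \<open>\<rho> * nu\<close> with minus the gradient of \<open>vel * \<rho>\<close>.
  The normal part of this is the formula for \<open>\<rho>\<close>; the rest, with
  \<open>pd_rho\<close> inserted, is the one for \<open>nu\<close>.\<close>

lemma pd_t_eqs:
  shows pd_t_rho: "dt \<rho> p = - (\<rho> p * (\<Sum>j\<in>UNIV. dx j vel p * nu j p) + vel p * (\<Sum>j\<in>UNIV. dx j \<rho> p * nu j p))"
    and pd_t_nu: "dt (nu i) p = - tgrad vel i p - vel p * bend i p"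
proof -
  have in_W: "p \<in> UNIV \<times> T" using p D_sub by blast
  have "pd v (dt \<Phi>) p = - (vel p * pd v \<rho> p + pd v vel p * \<rho> p)" for v
  proof -
    have "pd v (dt \<Phi>) p = pd v (\<lambda>q. - (vel q * \<rho> q)) p" by (rule pd_cong_open[OF open_D p Phi_t_eq])
    also have "\<dots> = - pd v (\<lambda>q. vel q * \<rho> q) p" by (intro pd_minus differentiable_mult diff_vel diff_rho)
    finally show ?thesis by (simp add: pd_mult[OF diff_vel diff_rho])
  qed
  then have eq: "\<rho> p * dt (nu i) p + dt \<rho> p * nu i p = - (vel p * dx i \<rho> p + dx i vel p * \<rho> p)" for i
    using pd_commute[OF open_UT smooth_Phi in_W, of "(0, 1)" "(axis i 1, 0)"] by (simp add: pd_g)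
  have "dt \<rho> p = \<rho> p * (\<Sum>j\<in>UNIV. nu j p * dt (nu j) p) + dt \<rho> p * (\<Sum>j\<in>UNIV. nu j p * nu j p)"
    by (simp add: nu_pd_nu sum_nu_squares[OF p])
  also have "\<dots> = (\<Sum>j\<in>UNIV. (\<rho> p * dt (nu j) p + dt \<rho> p * nu j p) * nu j p)"
    by (simp add: sum_distrib_left sum.distrib[symmetric] algebra_simps)
  also have "\<dots> = - (\<rho> p * (\<Sum>j\<in>UNIV. dx j vel p * nu j p) + vel p * (\<Sum>j\<in>UNIV. dx j \<rho> p * nu j p))"
    unfolding eq by (simp add: sum_distrib_left sum.distrib[symmetric] sum_negf[symmetric] algebra_simps)
  finally show R: "dt \<rho> p = - (\<rho> p * (\<Sum>j\<in>UNIV. dx j vel p * nu j p) + vel p * (\<Sum>j\<in>UNIV. dx j \<rho> p * nu j p))" .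
  have "\<rho> p * dt (nu i) p = \<rho> p * (- tgrad vel i p - vel p * bend i p)"
    using eq[of i] unfolding R tgrad_def pd_rho[of i] by (simp add: algebra_simps)
  then show "dt (nu i) p = - tgrad vel i p - vel p * bend i p"
    using rho_pos[OF p] by simp
qed

text \<open>Interchanging the second derivatives of \<open>nu i\<close> gathers them into the
  derivative of the divergence \<open>mc\<close> along the normal.\<close>

lemma div_bend: "(\<Sum>i\<in>UNIV. dx i (bend i) p) = (\<Sum>i\<in>UNIV. \<Sum>j\<in>UNIV. dx i (nu j) p * dx j (nu i) p) + (\<Sum>j\<in>UNIV. nu j p * dx j mc p)"
proof -
  have 1: "dx i (bend i) p = (\<Sum>j\<in>UNIV. nu j p * dx j (dx i (nu i)) p + dx i (nu j) p * dx j (nu i) p)" for i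
  proof -
    have sym: "dx i (dx j (nu i)) p = dx j (dx i (nu i)) p" for j
      by (rule pd_commute[OF open_D Ck_nu p])
    have "dx i (bend i) p = (\<Sum>j\<in>UNIV. dx i (\<lambda>q. nu j q * dx j (nu i) q) p)"
      unfolding bend_def[abs_def] by (rule pd_sum) (intro differentiable_mult diff_nu diff_pd_nu)
    also have "\<dots> = (\<Sum>j\<in>UNIV. nu j p * dx j (dx i (nu i)) p + dx i (nu j) p * dx j (nu i) p)"
      by (simp only: pd_mult[OF diff_nu diff_pd_nu] sym)
    finally show ?thesis .
  qed
  have 2: "dx j mc p = (\<Sum>i\<in>UNIV. dx j (dx i (nu i)) p)" for j
    unfolding mc_def[abs_def] by (rule pd_sum) (rule diff_pd_nu)
  have "(\<Sum>i\<in>UNIV. \<Sum>j\<in>UNIV. nu j p * dx j (dx i (nu i)) p) = (\<Sum>j\<in>UNIV. \<Sum>i\<in>UNIV. nu j p * dx j (dx i (nu i)) p)"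
    by (rule sum.swap)
  then show ?thesis unfolding 1 2 by (simp add: sum.distrib sum_distrib_left)
qed

end

end

section \<open>Tangential fields and the evolution of the mean curvature\<close>

context moving_atlas
begin

lemma flux_eq:
  assumes "q \<in> D" shows "flux \<Phi> (\<lambda>p. \<rho> p * f p) j q = (\<rho> q * f q) * (vel q * nu j q)"
  using rho_pos[OF assms] unfolding flux_def sum_g_squares[OF assms]
  by (simp add: Phi_t_eq[OF assms] g_eq[OF assms])

lemma tgrad_nu: assumes "q \<in> D" shows "(\<Sum>i\<in>UNIV. tgrad F i q * nu i q) = 0"
proof -
  have "(\<Sum>i\<in>UNIV. tgrad F i q * nu i q) 
    = (\<Sum>i\<in>UNIV. dx i F q * nu i q) - (\<Sum>j\<in>UNIV. dx j F q * nu j q) * (\<Sum>i\<in>UNIV. nu i q * nu i q)"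
    by (simp add: tgrad_def left_diff_distrib sum_subtractf sum_distrib_left mult.assoc)
  then show ?thesis by (simp add: sum_nu_squares[OF assms])
qed

context
  fixes p assumes p: "p \<in> D"
begin

lemma tgrad_bend: "(\<Sum>i\<in>UNIV. tgrad F i p * bend i p) = (\<Sum>i\<in>UNIV. dx i F p * bend i p)"
proof -
  define S where "S = (\<Sum>j\<in>UNIV. dx j F p * nu j p)"
  have "(\<Sum>i\<in>UNIV. tgrad F i p * bend i p) = (\<Sum>i\<in>UNIV. dx i F p * bend i p) - S * (\<Sum>i\<in>UNIV. bend i p * nu i p)"
    unfolding tgrad_def S_def[symmetric]
    by (simp add: algebra_simps sum_subtractf sum_distrib_left)
  then show ?thesis by (simp add: bend_nu[OF p])
qed

text \<open>The normal part of the gradient of \<open>\<rho>\<close> is invisible to a tangential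
  field, so only the \<open>bend\<close> part from \<open>pd_rho\<close> survives.\<close>

lemma pd_rho_tgrad: "(\<Sum>i\<in>UNIV. dx i \<rho> p * tgrad F i p) = \<rho> p * (\<Sum>i\<in>UNIV. dx i F p * bend i p)"
proof -
  define S where "S = (\<Sum>j\<in>UNIV. dx j \<rho> p * nu j p)"
  have "dx i \<rho> p = S * nu i p + \<rho> p * bend i p" for i
    unfolding S_def by (rule pd_rho[OF p])
  then have "(\<Sum>i\<in>UNIV. dx i \<rho> p * tgrad F i p) 
    = S * (\<Sum>i\<in>UNIV. tgrad F i p * nu i p) + \<rho> p * (\<Sum>i\<in>UNIV. tgrad F i p * bend i p)"
    by (simp add: algebra_simps sum.distrib sum_distrib_left)
  then show ?thesis by (simp add: tgrad_nu[OF p] tgrad_bend)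
qed

text \<open>Both sides are the inner product of the tangential parts of the two gradients.\<close>

lemma tgrad_symmetric: "(\<Sum>i\<in>UNIV. dx i F p * tgrad G i p) = (\<Sum>i\<in>UNIV. dx i G p * tgrad F i p)"
  by (simp add: tgrad_def right_diff_distrib sum_subtractf sum_distrib_left[symmetric] mult_ac)
    (simp add: sum_distrib_left sum_distrib_right mult_ac, subst sum.swap, simp add: mult_ac)

text \<open>Obtained by differentiating the tangency of \<open>tgrad F\<close> along the normal. The
  left side is what separates full from tangential divergence, so the Laplace-Beltrami operator is
  \<open>div (tgrad F) + \<nabla>F \<cdot> bend\<close>.\<close>

lemma normal_pd_tgrad:
  assumes F: "Ck_on (Suc (Suc 0)) D F"
  shows "(\<Sum>i\<in>UNIV. (\<Sum>j\<in>UNIV. dx j (tgrad F i) p * nu j p) * nu i p) = - (\<Sum>i\<in>UNIV. dx i F p * bend i p)"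
proof -
  note dF = Ck_on_differentiable[OF Ck_tgrad[OF F] p]
  have "(\<Sum>i\<in>UNIV. tgrad F i p * dx j (nu i) p + dx j (tgrad F i) p * nu i p) = 0" for j
  proof -
    have "dx j (\<lambda>q. \<Sum>i\<in>UNIV. tgrad F i q * nu i q) p = dx j (\<lambda>_. 0) p"
      by (rule pd_cong_open[OF open_D p tgrad_nu])
    moreover have "dx j (\<lambda>q. \<Sum>i\<in>UNIV. tgrad F i q * nu i q) p = (\<Sum>i\<in>UNIV. dx j (\<lambda>q. tgrad F i q * nu i q) p)"
      by (rule pd_sum) (intro differentiable_mult dF diff_nu[OF p])
    ultimately show ?thesis by (simp add: pd_mult[OF dF diff_nu[OF p]])
  qed
  then have "(\<Sum>i\<in>UNIV. dx j (tgrad F i) p * nu i p) = - (\<Sum>i\<in>UNIV. tgrad F i p * dx j (nu i) p)" for j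
    by (simp add: sum.distrib eq_neg_iff_add_eq_0 add.commute)
  then have *: "(\<Sum>j\<in>UNIV. nu j p * (\<Sum>i\<in>UNIV. dx j (tgrad F i) p * nu i p)) 
      = - (\<Sum>j\<in>UNIV. \<Sum>i\<in>UNIV. nu j p * (tgrad F i p * dx j (nu i) p))"
    by (simp add: sum_negf sum_distrib_left)
  have "(\<Sum>i\<in>UNIV. (\<Sum>j\<in>UNIV. dx j (tgrad F i) p * nu j p) * nu i p)
      = (\<Sum>i\<in>UNIV. \<Sum>j\<in>UNIV. nu j p * (dx j (tgrad F i) p * nu i p))"
    unfolding sum_distrib_right by (simp add: mult_ac)
  also have "\<dots> = (\<Sum>j\<in>UNIV. nu j p * (\<Sum>i\<in>UNIV. dx j (tgrad F i) p * nu i p))"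
    by (subst sum.swap) (simp add: sum_distrib_left)
  also have "\<dots> = - (\<Sum>i\<in>UNIV. \<Sum>j\<in>UNIV. nu j p * (tgrad F i p * dx j (nu i) p))"
    unfolding * by (subst sum.swap) simp
  also have "\<dots> = - (\<Sum>i\<in>UNIV. tgrad F i p * bend i p)"
    by (simp add: bend_def sum_distrib_left mult_ac)
  finally show ?thesis by (simp add: tgrad_bend)
qed

text \<open>The divergence of the formula for \<open>dt (nu i)\<close>. By
  \<open>normal_pd_tgrad\<close> the first two terms together are minus the Laplace-Beltrami
  operator applied to \<open>vel\<close>.\<close>

lemma pd_t_mc:
  "dt mc p = - (\<Sum>i\<in>UNIV. dx i (tgrad vel i) p) - (\<Sum>i\<in>UNIV. dx i vel p * bend i p)
     - vel p * ((\<Sum>i\<in>UNIV. \<Sum>j\<in>UNIV. dx i (nu j) p * dx j (nu i) p) + (\<Sum>j\<in>UNIV. nu j p * dx j mc p))"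
proof -
  have dY: "tgrad vel i differentiable (at p)" for i
    by (rule Ck_on_differentiable[OF Ck_tgrad[OF Ck_vel] p])
  have "dt mc p = (\<Sum>i\<in>UNIV. dt (dx i (nu i)) p)"
    unfolding mc_def[abs_def] by (rule pd_sum) (rule diff_pd_nu[OF p])
  also have "\<dots> = (\<Sum>i\<in>UNIV. - dx i (tgrad vel i) p - (vel p * dx i (bend i) p + dx i vel p * bend i p))"
  proof (rule sum.cong[OF refl])
    fix i
    have "dt (dx i (nu i)) p = dx i (dt (nu i)) p" by (rule pd_commute[OF open_D Ck_nu p])
    also have "\<dots> = dx i (\<lambda>q. - tgrad vel i q - vel q * bend i q) p"
      by (rule pd_cong_open[OF open_D p pd_t_nu])
    also have "\<dots> = dx i (\<lambda>q. - tgrad vel i q) p - dx i (\<lambda>q. vel q * bend i q) p"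
      by (intro pd_diff differentiable_minus differentiable_mult dY diff_vel[OF p] diff_bend[OF p])
    also have "dx i (\<lambda>q. - tgrad vel i q) p = - dx i (tgrad vel i) p" by (rule pd_minus[OF dY])
    also have "dx i (\<lambda>q. vel q * bend i q) p = vel p * dx i (bend i) p + dx i vel p * bend i p"
      by (rule pd_mult[OF diff_vel[OF p] diff_bend[OF p]])
    finally show "dt (dx i (nu i)) p = - dx i (tgrad vel i) p - (vel p * dx i (bend i) p + dx i vel p * bend i p)" .
  qed
  also have "\<dots> = - (\<Sum>i\<in>UNIV. dx i (tgrad vel i) p) - (\<Sum>i\<in>UNIV. dx i vel p * bend i p) - vel p * (\<Sum>i\<in>UNIV. dx i (bend i) p)"
    by (simp add: sum_subtractf sum.distrib sum_negf sum_distrib_left)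
  finally show ?thesis by (simp only: div_bend[OF p])
qed

text \<open>Green's second identity in disguise: the evolution of \<open>mc\<close> produces
  \<open>a\<close> times the surface Laplacian of \<open>vel\<close>, the assertion has
  \<open>vel\<close> times that of \<open>a\<close>, and the last line is their difference in
  divergence form. \<open>f\<close> and \<open>a\<close> are linked only through the chain rule
  \<open>fa\<close>.\<close>

lemma variation_identity:
  assumes a: "Ck_on (Suc (Suc 0)) D a" and f: "Ck_on (Suc 0) D f" and fa: "\<And>v. pd v f p = a p * pd v mc p"
  shows "variation \<Phi> (\<lambda>p. \<rho> p * f p) p / \<rho> p =
     (f p * mc p - ((\<Sum>i\<in>UNIV. dx i (tgrad a i) p) - (\<Sum>i\<in>UNIV. (\<Sum>j\<in>UNIV. dx j (tgrad a i) p * nu j p) * nu i p))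
       - a p * (\<Sum>i\<in>UNIV. \<Sum>j\<in>UNIV. dx i (nu j) p * dx j (nu i) p)) * vel p
     + (\<Sum>j\<in>UNIV. dx j (\<lambda>q. \<rho> q * (vel q * tgrad a j q - a q * tgrad vel j q)) p) / \<rho> p"
proof -
  note df = Ck_on_differentiable[OF f p] and da = Ck_on_differentiable[OF a p]
  note dP = Ck_on_differentiable[OF Ck_tgrad[OF a] p] and dY = Ck_on_differentiable[OF Ck_tgrad[OF Ck_vel] p]
  note dn = diff_nu[OF p] and dv = diff_vel[OF p] and dr = diff_rho[OF p]
  define Hn where "Hn = (\<Sum>j\<in>UNIV. nu j p * dx j mc p)"
  define Rn where "Rn = (\<Sum>j\<in>UNIV. dx j \<rho> p * nu j p)"
  define Vn where "Vn = (\<Sum>j\<in>UNIV. dx j vel p * nu j p)"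
  define DP where "DP = (\<Sum>i\<in>UNIV. dx i (tgrad a i) p)"
  define DY where "DY = (\<Sum>i\<in>UNIV. dx i (tgrad vel i) p)"
  define ca where "ca = (\<Sum>i\<in>UNIV. dx i a p * bend i p)"
  define cV where "cV = (\<Sum>i\<in>UNIV. dx i vel p * bend i p)"
  define tr where "tr = (\<Sum>i\<in>UNIV. \<Sum>j\<in>UNIV. dx i (nu j) p * dx j (nu i) p)"
  have R: "\<rho> p > 0" by (rule rho_pos[OF p])
  have flux: "dx j (flux \<Phi> (\<lambda>p. \<rho> p * f p) j) p = \<rho> p * f p * (vel p * dx j (nu j) p + dx j vel p * nu j p)
     + (\<rho> p * (a p * dx j mc p) + dx j \<rho> p * f p) * (vel p * nu j p)" for j
  proof -
    have "dx j (flux \<Phi> (\<lambda>p. \<rho> p * f p) j) p = dx j (\<lambda>q. (\<rho> q * f q) * (vel q * nu j q)) p"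
      by (rule pd_cong_open[OF open_D p flux_eq])
    also have "\<dots> = \<rho> p * f p * dx j (\<lambda>q. vel q * nu j q) p + dx j (\<lambda>q. \<rho> q * f q) p * (vel p * nu j p)"
      by (intro pd_mult differentiable_mult dr df dv dn)
    finally show ?thesis by (simp only: pd_mult[OF dv dn] pd_mult[OF dr df] fa)
  qed
  have "(\<Sum>j\<in>UNIV. dx j (flux \<Phi> (\<lambda>p. \<rho> p * f p) j) p)
     = \<rho> p * f p * (vel p * mc p + Vn) + \<rho> p * a p * vel p * Hn + f p * vel p * Rn"
    unfolding flux mc_def Vn_def Hn_def Rn_def
    by (simp add: sum_distrib_left sum.distrib[symmetric] algebra_simps)
  moreover have "dt (\<lambda>q. \<rho> q * f q) p = \<rho> p * (a p * dt mc p) - (\<rho> p * Vn + vel p * Rn) * f p"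
    unfolding pd_mult[OF dr df] fa pd_t_rho[OF p] Vn_def[symmetric] Rn_def[symmetric] by (simp add: algebra_simps)
  \<comment> \<open>The normal derivatives of \<open>vel\<close> and \<open>\<rho>\<close> in the
    divergence of the flux cancel those in \<open>dt \<rho>\<close>.\<close>
  ultimately have var: "variation \<Phi> (\<lambda>p. \<rho> p * f p) p = \<rho> p * (a p * dt mc p + f p * vel p * mc p + a p * vel p * Hn)"
    unfolding variation_def by (simp add: algebra_simps)
  have Ht: "dt mc p = - DY - cV - vel p * (tr + Hn)"
    unfolding pd_t_mc DY_def cV_def tr_def Hn_def ..
  have X: "dx j (\<lambda>q. \<rho> q * (vel q * tgrad a j q - a q * tgrad vel j q)) p
     = \<rho> p * (vel p * dx j (tgrad a j) p + dx j vel p * tgrad a j p - (a p * dx j (tgrad vel j) p + dx j a p * tgrad vel j p))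
       + dx j \<rho> p * (vel p * tgrad a j p - a p * tgrad vel j p)" for j
  proof -
    have "dx j (\<lambda>q. \<rho> q * (vel q * tgrad a j q - a q * tgrad vel j q)) p
      = \<rho> p * dx j (\<lambda>q. vel q * tgrad a j q - a q * tgrad vel j q) p + dx j \<rho> p * (vel p * tgrad a j p - a p * tgrad vel j p)"
      by (intro pd_mult differentiable_diff differentiable_mult dr dv da dP dY)
    also have "dx j (\<lambda>q. vel q * tgrad a j q - a q * tgrad vel j q) p = dx j (\<lambda>q. vel q * tgrad a j q) p - dx j (\<lambda>q. a q * tgrad vel j q) p"
      by (intro pd_diff differentiable_mult dv da dP dY)
    finally show ?thesis by (simp only: pd_mult[OF dv dP] pd_mult[OF da dY])
  qed
  have "(\<Sum>j\<in>UNIV. dx j (\<lambda>q. \<rho> q * (vel q * tgrad a j q - a q * tgrad vel j q)) p)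
     = \<rho> p * (vel p * DP + (\<Sum>j\<in>UNIV. dx j vel p * tgrad a j p) - a p * DY - (\<Sum>j\<in>UNIV. dx j a p * tgrad vel j p))
       + vel p * (\<Sum>j\<in>UNIV. dx j \<rho> p * tgrad a j p) - a p * (\<Sum>j\<in>UNIV. dx j \<rho> p * tgrad vel j p)"
    unfolding X DP_def DY_def
    by (simp add: sum_distrib_left sum.distrib[symmetric] sum_subtractf[symmetric] algebra_simps)
  \<comment> \<open>Products of first derivatives of \<open>a\<close> and \<open>vel\<close> cancel
    by \<open>tgrad_symmetric\<close>. The gradient of \<open>\<rho>\<close> contributes
    \<open>ca\<close> and \<open>cV\<close>, which complete \<open>DP\<close> and \<open>DY\<close>
    to Laplace-Beltrami operators.\<close>
  also have "\<dots> = \<rho> p * (vel p * DP - a p * DY + vel p * ca - a p * cV)"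
    unfolding pd_rho_tgrad tgrad_symmetric[of vel a] ca_def cV_def by (simp add: algebra_simps)
  finally have divX: "(\<Sum>j\<in>UNIV. dx j (\<lambda>q. \<rho> q * (vel q * tgrad a j q - a q * tgrad vel j q)) p)
     = \<rho> p * (vel p * DP - a p * DY + vel p * ca - a p * cV)" .
  have "variation \<Phi> (\<lambda>p. \<rho> p * f p) p / \<rho> p = a p * dt mc p + f p * vel p * mc p + a p * vel p * Hn"
    unfolding var using R by simp
  \<comment> \<open>\<open>Hn\<close> drops out: the flux and the evolution of \<open>mc\<close>
    contribute it with opposite signs.\<close>
  also have "\<dots> = (f p * mc p - (DP - (- ca)) - a p * tr) * vel p
    + (vel p * DP - a p * DY + vel p * ca - a p * cV)"
    unfolding Ht by (simp add: algebra_simps)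
  finally show ?thesis
    unfolding divX normal_pd_tgrad[OF a] using R by (simp add: DP_def ca_def tr_def)
qed

end

end

section \<open>Identification with the geometric quantities of a time slice\<close>

lemma differentiable_vec:
  fixes v :: "'a::real_normed_vector \<Rightarrow> real^'n"
  assumes "\<And>i. (\<lambda>x. v x $ i) differentiable (at x)"
  shows "v differentiable (at x)"
  unfolding differentiable_componentwise_within[of v] using assms
  by (auto simp: Basis_vec_def inner_axis)

lemma jacobian_nth:
  fixes v :: "real^'m \<Rightarrow> real^'n"
  assumes "v differentiable (at x)"
  shows "jacobian v (at x) $ i $ j = pd (axis j 1) (\<lambda>x. v x $ i) x"
proof -
  have "((\<lambda>x. v x $ i) has_derivative (\<lambda>w. pd w v x $ i)) (at x)"
    using bounded_linear.has_derivative[OF bounded_linear_vec_nth assms[unfolded frechet_derivative_works]] .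
  from frechet_eqI[OF this, of "axis j 1"] show ?thesis
    by (simp add: jacobian_def matrix_def)
qed

context moving_atlas
begin

lemma open_D_slice: "open {x. (x, s) \<in> D}"
  using open_vimage[OF open_D, of "\<lambda>x. (x, s)"] by (simp add: vimage_def continuous_on_Pair)

text \<open>Agreement on \<open>D\<close> is all that can be asked: the normal of a time slice need not be
  differentiable at critical points.\<close>

lemma slice_field:
  fixes v :: "real^3 \<Rightarrow> real^3"
  assumes p: "(x, s) \<in> D" and v: "\<And>y i. (y, s) \<in> D \<Longrightarrow> v y $ i = F i (y, s)"
    and F: "\<And>i. Ck_on (Suc 0) D (F i)"
  shows "jacobian v (at x) $ i $ j = dx j (F i) (x, s)"
    and "divergence v x = (\<Sum>i\<in>UNIV. dx i (F i) (x, s))"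
proof -
  have dF: "F i differentiable (at (x, s))" for i by (rule Ck_on_differentiable[OF F p])
  have xD: "x \<in> {x. (x, s) \<in> D}" using p by simp
  have comp: "(\<lambda>y. v y $ i) differentiable (at x)" for i
  proof (rule differentiable_cong_open[OF open_D_slice xD])
    show "F i (y, s) = v y $ i" if "y \<in> {x. (x, s) \<in> D}" for y using v that by simp
    show "(\<lambda>y. F i (y, s)) differentiable (at x)"
      using has_derivative_compose[OF has_derivative_Pair[OF has_derivative_ident has_derivative_const] dF[unfolded frechet_derivative_works]]
      unfolding differentiable_def by blast
  qed
  have J: "jacobian v (at x) $ i $ j = dx j (F i) (x, s)" for i j
  proof -
    have "pd (axis j 1) (\<lambda>y. v y $ i) x = pd (axis j 1) (\<lambda>y. F i (y, s)) x"
      by (rule pd_cong_open[OF open_D_slice xD]) (simp add: v)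
    then show ?thesis using jacobian_nth[OF differentiable_vec[OF comp]] pd_slice[OF dF] by simp
  qed
  then show "jacobian v (at x) $ i $ j = dx j (F i) (x, s)" .
  show "divergence v x = (\<Sum>i\<in>UNIV. dx i (F i) (x, s))"
    by (simp add: divergence_def trace_def J)
qed

lemma diff_Phi: "s \<in> T \<Longrightarrow> \<Phi> differentiable (at (x, s))"
  by (rule Ck_on_differentiable[OF smooth_Phi]) simp

lemma unit_normal_slice:
  assumes "s \<in> T" shows "unit_normal (slice s) x $ i = nu i (x, s)"
  by (simp add: unit_normal_def norm_grad_slice[OF diff_Phi[OF assms]] grad_nth pd_slice[OF diff_Phi[OF assms]]
      nu_def divide_inverse mult.commute)

lemma mean_curvature_slice:
  assumes "(x, s) \<in> D" shows "mean_curvature (slice s) x = mc (x, s)"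
proof -
  have s: "s \<in> T" using assms D_sub(2) by auto
  show ?thesis
    unfolding mean_curvature_def mc_def
    by (rule slice_field(2)[OF assms _ Ck_nu]) (rule unit_normal_slice[OF s])
qed

text \<open>The trace formula for the cofactor matrix turns \<open>H^2 - 2 G\<close> into
  \<open>Tr ((\<nabla>n)^2)\<close>, the double sum that arises when \<open>mc\<close> is
  differentiated in time.\<close>

lemma gaussian_curvature_slice:
  assumes "(x, s) \<in> D"
  shows "(mc (x, s))\<^sup>2 - 2 * gaussian_curvature (slice s) x
     = (\<Sum>i\<in>UNIV. \<Sum>j\<in>UNIV. dx i (nu j) (x, s) * dx j (nu i) (x, s))"
proof -
  have s: "s \<in> T" using assms D_sub(2) by auto
  have J: "jacobian (unit_normal (slice s)) (at x) $ i $ j = dx j (nu i) (x, s)" for i j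
    by (rule slice_field(1)[OF assms _ Ck_nu]) (rule unit_normal_slice[OF s])
  have tr: "trace (jacobian (unit_normal (slice s)) (at x)) = mc (x, s)"
    by (simp add: trace_def J mc_def)
  have tr2: "trace (jacobian (unit_normal (slice s)) (at x) ** jacobian (unit_normal (slice s)) (at x))
     = (\<Sum>i\<in>UNIV. \<Sum>j\<in>UNIV. dx i (nu j) (x, s) * dx j (nu i) (x, s))"
    by (simp add: trace_def matrix_matrix_mult_def J mult.commute)
  have "h - 2 * ((h - z) / 2) = z" for h z :: real by (simp add: field_simps)
  then show ?thesis
    unfolding gaussian_curvature_def trace_cofactor_matrix_3 tr tr2 .
qed

lemma laplace_beltrami_slice:
  assumes p: "(x, s) \<in> D" and F: "\<And>y. (y, s) \<in> D \<Longrightarrow> F y = a (y, s)" and a: "Ck_on (Suc (Suc 0)) D a"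
  shows "laplace_beltrami (unit_normal (slice s)) F x =
     (\<Sum>i\<in>UNIV. dx i (tgrad a i) (x, s)) - (\<Sum>i\<in>UNIV. (\<Sum>j\<in>UNIV. dx j (tgrad a i) (x, s) * nu j (x, s)) * nu i (x, s))"
proof -
  have s: "s \<in> T" using p D_sub(2) by auto
  have v: "surf_grad (unit_normal (slice s)) F y $ i = tgrad a i (y, s)" if y: "(y, s) \<in> D" for y i
  proof -
    have da: "a differentiable (at (y, s))" by (rule Ck_on_differentiable[OF a y])
    have "grad F y $ i = dx i a (y, s)" for i
      unfolding grad_nth pd_slice[OF da, symmetric]
      by (rule pd_cong_open[OF open_D_slice]) (use y F in simp_all)
    then show ?thesis
      by (simp add: surf_grad_def tgrad_def inner_vec_def unit_normal_slice[OF s])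
  qed
  have div: "divergence (surf_grad (unit_normal (slice s)) F) x = (\<Sum>i\<in>UNIV. dx i (tgrad a i) (x, s))"
    by (rule slice_field(2)[OF p v Ck_tgrad[OF a]])
  have jac: "jacobian (surf_grad (unit_normal (slice s)) F) (at x) $ i $ j = dx j (tgrad a i) (x, s)" for i j
    by (rule slice_field(1)[OF p v Ck_tgrad[OF a]])
  show ?thesis
    by (simp add: laplace_beltrami_def surf_div_def div inner_vec_def matrix_vector_mult_def jac unit_normal_slice[OF s])
qed

text \<open>By \<open>variation_identity\<close> the asserted integrand is that of the first
  variation minus \<open>div X / \<rho>\<close>, whose integral vanishes since \<open>X\<close> is
  tangential. Both parts come with integrability, so the integral may be split.\<close>

lemma curvature_energy_derivative:
  assumes A: "\<And>n. Ck_on n UNIV A" and t: "t \<in> J"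
  shows "((\<lambda>s. curvature_energy A (slice s)) has_real_derivative
     (LINT x:\<Gamma> t|surface_measure (\<Gamma> t).
        (A (mean_curvature (slice t) x) * mean_curvature (slice t) x
          - laplace_beltrami (unit_normal (slice t)) (\<lambda>y. deriv A (mean_curvature (slice t) y)) x
          - deriv A (mean_curvature (slice t) x)
             * ((mean_curvature (slice t) x)\<^sup>2 - 2 * gaussian_curvature (slice t) x)) * vel (x, t))) (at t)"
    (is "(_ has_real_derivative (LINT x:_|_. ?R x)) _")
proof -
  define f where "f p = A (mc p)" for p
  define a where "a p = deriv A (mc p)" for p
  define X where "X j q = \<rho> q * (vel q * tgrad a j q - a q * tgrad vel j q)" for j q
  have dA: "A differentiable (at y)" for y using Ck_on_differentiable[OF A] by blast
  have "deriv A y = pd 1 A y" for y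
  proof -
    have "(A has_derivative (\<lambda>v. deriv A y * v)) (at y)"
      using dA[of y] by (simp add: DERIV_deriv_iff_real_differentiable[symmetric] has_field_derivative_def)
    from frechet_eqI[OF this, of 1] show ?thesis by simp
  qed
  \<comment> \<open>Smoothness is phrased through \<open>frechet_derivative\<close> and reaches
    \<open>deriv A\<close> as the derivative in direction 1.\<close>
  then have "deriv A = pd 1 A" by blast
  then have A': "Ck_on n UNIV (deriv A)" for n using Ck_on_pd[OF A] by metis
  have fC: "Ck_on n D f" for n
    unfolding f_def[abs_def] by (rule Ck_on_compose[OF open_D open_UNIV A Ck_mc]) simp
  have aC: "Ck_on n D a" for n
    unfolding a_def[abs_def] by (rule Ck_on_compose[OF open_D open_UNIV A' Ck_mc]) simp
  have fa: "pd v f p = a p * pd v mc p" if "p \<in> D" for v p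
    unfolding f_def[abs_def] a_def by (rule pd_compose_real[OF diff_mc[OF that] dA])
  have XC: "Ck_on (Suc 0) D (X j)" for j
    unfolding X_def[abs_def]
    by (intro Ck_on_mult Ck_on_diff open_D smooth_rho Ck_vel aC Ck_tgrad[OF aC] Ck_tgrad[OF Ck_vel])
  have tang: "(\<Sum>j\<in>UNIV. X j p * g j p) = 0" if p: "p \<in> D" for p
  proof -
    have "(\<Sum>j\<in>UNIV. X j p * g j p) = \<rho> p * \<rho> p * (vel p * (\<Sum>j\<in>UNIV. tgrad a j p * nu j p) - a p * (\<Sum>j\<in>UNIV. tgrad vel j p * nu j p))"
      unfolding sum_distrib_left sum_subtractf[symmetric]
      by (intro sum.cong refl) (simp add: X_def g_eq[OF p] algebra_simps)
    then show ?thesis by (simp add: tgrad_nu[OF p])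
  qed
  have energy: "curvature_energy A (slice s) = (LINT x:\<Gamma> s|surface_measure (\<Gamma> s). f (x, s))" if s: "s \<in> J" for s
  proof -
    have "indicator (\<Gamma> s) x *\<^sub>R A (mean_curvature (slice s) x) = indicator (\<Gamma> s) x *\<^sub>R f (x, s)" for x
      using mean_curvature_slice[OF level_in_D[OF s]] by (auto simp: indicator_def f_def)
    then show ?thesis unfolding curvature_energy_def set_lebesgue_integral_def by (simp only:)
  qed
  \<comment> \<open>Off \<open>D\<close> the geometric quantities may be junk, hence the comparison
    under the indicator of the surface.\<close>
  have R: "indicator (\<Gamma> t) x *\<^sub>R ?R x = indicator (\<Gamma> t) x *\<^sub>R (variation \<Phi> (\<lambda>p. \<rho> p * f p) (x, t) / \<rho> (x, t))
     - indicator (\<Gamma> t) x *\<^sub>R ((\<Sum>j\<in>UNIV. dx j (X j) (x, t)) / \<rho> (x, t))" for x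
  proof (cases "x \<in> \<Gamma> t")
    case True
    then have p: "(x, t) \<in> D" using level_in_D[OF t] by simp
    have "laplace_beltrami (unit_normal (slice t)) (\<lambda>y. deriv A (mean_curvature (slice t) y)) x =
       (\<Sum>i\<in>UNIV. dx i (tgrad a i) (x, t)) - (\<Sum>i\<in>UNIV. (\<Sum>j\<in>UNIV. dx j (tgrad a i) (x, t) * nu j (x, t)) * nu i (x, t))"
      by (rule laplace_beltrami_slice[OF p _ aC]) (simp add: mean_curvature_slice a_def)
    moreover have "f (x, t) = A (mc (x, t))" "a (x, t) = deriv A (mc (x, t))"
      by (simp_all add: f_def a_def)
    ultimately have "?R x = variation \<Phi> (\<lambda>p. \<rho> p * f p) (x, t) / \<rho> (x, t) - (\<Sum>j\<in>UNIV. dx j (X j) (x, t)) / \<rho> (x, t)"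
      using variation_identity[OF p aC fC fa[OF p]]
      unfolding mean_curvature_slice[OF p] gaussian_curvature_slice[OF p] X_def[abs_def] by simp
    then show ?thesis using True by simp
  qed simp
  note var = first_variation[OF t fC] and div = surface_divergence_theorem[OF t XC tang]
  have "(LINT x:\<Gamma> t|surface_measure (\<Gamma> t). ?R x) =
      (LINT x:\<Gamma> t|surface_measure (\<Gamma> t). variation \<Phi> (\<lambda>p. \<rho> p * f p) (x, t) / \<rho> (x, t))
      - (LINT x:\<Gamma> t|surface_measure (\<Gamma> t). (\<Sum>j\<in>UNIV. dx j (X j) (x, t)) / \<rho> (x, t))"
    unfolding set_lebesgue_integral_def R
    by (rule Bochner_Integration.integral_diff) (use var(2) div(2) in \<open>simp_all only: set_integrable_def\<close>)
  then have "(LINT x:\<Gamma> t|surface_measure (\<Gamma> t). ?R x) =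
      (LINT x:\<Gamma> t|surface_measure (\<Gamma> t). variation \<Phi> (\<lambda>p. \<rho> p * f p) (x, t) / \<rho> (x, t))"
    by (simp only: div(1) diff_zero)
  then have "((\<lambda>s. LINT x:\<Gamma> s|surface_measure (\<Gamma> s). f (x, s)) has_real_derivative
      (LINT x:\<Gamma> t|surface_measure (\<Gamma> t). ?R x)) (at t)"
    using var(1) by (simp only:)
  then show ?thesis
    by (rule has_field_derivative_transform_within_open[OF _ open_J t]) (rule energy[symmetric])
qed

end

theorem mainTheorem2:
  fixes \<phi> :: "real^3 \<Rightarrow> real \<Rightarrow> real"
    and u :: "real^3 \<Rightarrow> real \<Rightarrow> real^3"
    and \<Omega> :: "real \<Rightarrow> (real^3) set"
    and A :: "real \<Rightarrow> real"
    and T :: "real set"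
    and t :: real
  assumes "open T"
    and "smooth_on (UNIV \<times> T) (\<lambda>(x, s). \<phi> x s)"
    and "smooth_on (UNIV \<times> T) (\<lambda>(x, s). u x s)"
    and "smooth_on UNIV A"
    and transport: "\<And>x s. s \<in> T \<Longrightarrow>
          deriv (\<lambda>\<tau>. \<phi> x \<tau>) s + u x s \<bullet> grad (\<lambda>y. \<phi> y s) x = 0"
    and domain: "\<And>s. s \<in> T \<Longrightarrow>
          regular_open_set (\<Omega> s) \<and> connected (\<Omega> s) \<and> frontier (\<Omega> s) = {x. \<phi> x s = 0}"
    and closed_surface: "moving_closed_surface T (\<lambda>s. {x. \<phi> x s = 0})"
    and regular_level: "\<And>s. s \<in> T \<Longrightarrow>
          \<exists>N. open N \<and> {x. \<phi> x s = 0} \<subseteq> N \<and> (\<forall>x\<in>N. norm (grad (\<lambda>y. \<phi> y s) x) > 0)"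
    and "t \<in> T"
  shows "let \<Gamma> = {x. \<phi> x t = 0};
             n = unit_normal (\<lambda>y. \<phi> y t);
             H = mean_curvature (\<lambda>y. \<phi> y t);
             G = gaussian_curvature (\<lambda>y. \<phi> y t);
             A' = deriv A
         in ((\<lambda>s. curvature_energy A (\<lambda>y. \<phi> y s)) has_real_derivative
              (LINT x:\<Gamma>|surface_measure \<Gamma>.
                 (A (H x) * H x - laplace_beltrami n (\<lambda>y. A' (H y)) x
                   - A' (H x) * ((H x)\<^sup>2 - 2 * G x)) * (u x t \<bullet> n x)))
            (at t)"
proof -
  define \<Phi> where "\<Phi> = (\<lambda>(x, s). \<phi> x s)"
  have smooth: "Ck_on n (UNIV \<times> T) \<Phi>" for n
    using assms(2) by (simp add: \<Phi>_def smooth_on_def del: Ck_on.simps)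
  have A: "Ck_on n UNIV A" for n
    using assms(4) by (simp add: smooth_on_def del: Ck_on.simps)
  have diff: "\<Phi> differentiable (at (x, s))" if "s \<in> T" for x s
    by (rule Ck_on_differentiable[OF smooth]) (use that in simp)
  have regular: "\<exists>k. dx k \<Phi> (x, t) \<noteq> 0" if "\<Phi> (x, t) = 0" for x
  proof -
    have "norm (grad (\<lambda>y. \<phi> y t) x) > 0"
      using regular_level[OF \<open>t \<in> T\<close>] that by (auto simp: \<Phi>_def)
    then obtain k where "grad (\<lambda>y. \<phi> y t) x $ k \<noteq> 0" by (auto simp: vec_eq_iff)
    then have "pd (axis k 1) (\<lambda>y. \<Phi> (y, t)) x \<noteq> 0" by (simp add: grad_nth \<Phi>_def)
    then show ?thesis using pd_slice[OF diff[OF \<open>t \<in> T\<close>]] by metis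
  qed
  have compact: "compact {x. \<Phi> (x, t) = 0}"
    using closed_surface \<open>t \<in> T\<close> by (simp add: moving_closed_surface_def \<Phi>_def)
  obtain \<epsilon> where \<epsilon>: "\<epsilon> > 0" "bounded (\<Union>s \<in> {s\<in>T. \<bar>s - t\<bar> < \<epsilon>}. {x. \<Phi> (x, s) = 0})"
    using closed_surface \<open>t \<in> T\<close> unfolding moving_closed_surface_def \<Phi>_def by auto
  have "\<exists>J m k Y C h \<sigma> M c r. moving_atlas \<Phi> T J m k Y C h \<sigma> M c r \<and> t \<in> J"
    by (rule exists_moving_atlas[OF \<open>open T\<close> smooth \<open>t \<in> T\<close> compact \<epsilon>]) (rule regular)
  then obtain J m k Y C h \<sigma> M c r where atlas: "moving_atlas \<Phi> T J m k Y C h \<sigma> M c r" and tJ: "t \<in> J"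
    by blast
  interpret moving_atlas \<Phi> T J m k Y C h \<sigma> M c r by (rule atlas)
  \<comment> \<open>The transport equation divided by the gradient norm. It holds at every
    \<open>x\<close>: where the gradient vanishes, both sides are 0 by the convention for division
    by zero.\<close>
  have vel: "vel (x, t) = u x t \<bullet> unit_normal (\<lambda>y. \<phi> y t) x" for x
  proof -
    have "((\<lambda>s. \<Phi> (x, s)) has_real_derivative dt \<Phi> (x, t)) (at t)"
      by (rule DERIV_snd[OF diff[OF \<open>t \<in> T\<close>]])
    then have "deriv (\<lambda>\<tau>. \<phi> x \<tau>) t = dt \<Phi> (x, t)"
      by (simp add: DERIV_imp_deriv \<Phi>_def)
    then have "dt \<Phi> (x, t) = - (u x t \<bullet> grad (\<lambda>y. \<phi> y t) x)"
      using transport[OF \<open>t \<in> T\<close>, of x] by linarith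
    moreover have "level_speed \<Phi> (x, t) = norm (grad (\<lambda>y. \<phi> y t) x)"
      using norm_grad_slice[OF diff[OF \<open>t \<in> T\<close>]] by (simp add: \<Phi>_def)
    ultimately show ?thesis by (simp add: vel_def unit_normal_def divide_inverse mult.commute)
  qed
  show ?thesis
    using curvature_energy_derivative[OF A tJ] unfolding vel by (simp add: \<Phi>_def Let_def)
qed

end
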